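(* Let $p=2$, let $E$ be a finite extension of $\mathbb{Q}_2$ and let $D\subset\mathbb{C}_2$ be a disk (open or closed) defined over $E$. Let $e$ be the smallest integer such that there exists a finite extension $F$ of $E$ with ramification index $e_{F/E}=e$ and $F\cap D\neq\emptyset$. Then $e=2^s$ for some integer $s\geq 0$, and there exists a totally ramified extension $F$ of $E$ with $[F:E]=2^s$ such that $F\cap D\neq\emptyset$.
   Context: A disk in $\mathbb{C}_p$ is a set $\{x\in\mathbb{C}_p : |x-a|\leq r\}$ (closed) or $\{x\in\mathbb{C}_p: |x-a|<r\}$ (open) for some $a\in\mathbb{C}_p$ and real $r>0$. Finite extensions are taken inside $\bar{\mathbb{Q}}_p\subset\mathbb{C}_p$. The group $G_E=\operatorname{Gal}(\bar{\mathbb{Q}}_p/E)$ acts continuously on $\mathbb{C}_p$; $D$ is defined over $E$ if $\sigma(D)=D$ for all $\sigma\in G_E$. *)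

theory Defs
  imports "HOL-Analysis.Analysis" "HOL-Algebra.Algebra" "HOL-Computational_Algebra.Primes"
begin

locale valued_field = field C for C (structure) +
  fixes v :: "'a \<Rightarrow> real"
  assumes v_nonneg: "x \<in> carrier C \<Longrightarrow> 0 \<le> v x"
    and v_eq_0_iff: "x \<in> carrier C \<Longrightarrow> v x = 0 \<longleftrightarrow> x = \<zero>"
    and v_mult: "\<lbrakk>x \<in> carrier C; y \<in> carrier C\<rbrakk> \<Longrightarrow> v (x \<otimes> y) = v x * v y"
    and v_ultrametric: "\<lbrakk>x \<in> carrier C; y \<in> carrier C\<rbrakk> \<Longrightarrow> v (x \<oplus> y) \<le> max (v x) (v y)"
begin

lemma v_one: "v \<one> = 1"
proof -
  have "v \<one> * v \<one> = v \<one>"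
    using v_mult[of \<one> \<one>] by simp
  moreover have "v \<one> \<noteq> 0"
    using v_eq_0_iff[of \<one>] by simp
  ultimately show ?thesis by simp
qed

lemma v_minus:
  assumes "x \<in> carrier C" shows "v (\<ominus> x) = v x"
proof -
  have "v (\<ominus> \<one>) * v (\<ominus> \<one>) = 1"
    using v_mult[of "\<ominus> \<one>" "\<ominus> \<one>"] by (simp add: l_minus v_one)
  moreover have "v (\<ominus> \<one>) \<ge> 0"
    by (simp add: v_nonneg)
  ultimately have "v (\<ominus> \<one>) = 1"
    by (metis abs_of_nonneg abs_square_eq_1 power2_eq_square)
  then show ?thesis
    using v_mult[of "\<ominus> \<one>" x] assms by (simp add: l_minus)
qed

text \<open>The guard is there because \<open>Metric_space\<close> asks for nonnegativity and symmetry on the whole type.\<close>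

definition vdist :: "'a \<Rightarrow> 'a \<Rightarrow> real"
  where "vdist x y = (if x \<in> carrier C \<and> y \<in> carrier C then v (x \<ominus> y) else 0)"

sublocale metric: Metric_space "carrier C" vdist
proof
  fix x y
  show "0 \<le> vdist x y"
    by (simp add: vdist_def v_nonneg)
  show "vdist x y = vdist y x"
  proof (cases "x \<in> carrier C \<and> y \<in> carrier C")
    case True
    then have "\<ominus> (x \<ominus> y) = y \<ominus> x"
      by (simp add: minus_eq minus_add a_comm)
    with True show ?thesis
      using v_minus[of "x \<ominus> y"] by (simp add: vdist_def)
  qed (auto simp: vdist_def)
next
  fix x y
  assume "x \<in> carrier C" "y \<in> carrier C"
  then show "vdist x y = 0 \<longleftrightarrow> x = y"
    by (simp add: vdist_def v_eq_0_iff)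
next
  fix x y z
  assume xyz: "x \<in> carrier C" "y \<in> carrier C" "z \<in> carrier C"
  then have "x \<ominus> z = (x \<ominus> y) \<oplus> (y \<ominus> z)"
    by (simp add: minus_eq a_assoc r_neg1)
  then have "v (x \<ominus> z) \<le> max (v (x \<ominus> y)) (v (y \<ominus> z))"
    using v_ultrametric[of "x \<ominus> y" "y \<ominus> z"] xyz by simp
  also have "\<dots> \<le> v (x \<ominus> y) + v (y \<ominus> z)"
    using xyz by (simp add: v_nonneg)
  finally show "vdist x z \<le> vdist x y + vdist y z"
    using xyz by (simp add: vdist_def)
qed

definition is_disk :: "'a set \<Rightarrow> bool"
  where "is_disk D \<longleftrightarrow>
    (\<exists>a \<in> carrier C. \<exists>r > 0. D = metric.mcball a r \<or> D = metric.mball a r)"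

text \<open>In a complete field of characteristic zero with \<open>v p = 1 / p\<close> the prime field is \<open>\<rat>\<close>
  with its \<open>p\<close>-adic absolute value, so its closure is the completion \<open>\<rat>\<^sub>p\<close>.\<close>

definition Qp :: "'a set"
  where "Qp = metric.mtopology closure_of (generate_field C {})"

definition Qp_bar :: "'a set"
  where "Qp_bar = {x \<in> carrier C. (algebraic over Qp) x}"

definition Qp_bar_field :: "('a, 'b) ring_scheme"
  where "Qp_bar_field = C \<lparr> carrier := Qp_bar \<rparr>"

definition is_finite_extension :: "'a set \<Rightarrow> 'a set \<Rightarrow> bool"
  where "is_finite_extension K F \<longleftrightarrow>
    subfield K C \<and> subfield F C \<and> K \<subseteq> F \<and> F \<subseteq> Qp_bar \<and> finite_dimension K F"

definition value_group :: "'a set \<Rightarrow> real monoid"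
  where "value_group K = \<lparr> carrier = v ` (K - {\<zero>}), mult = (*), one = 1 \<rparr>"

text \<open>The index of \<open>v(K\<^sup>*)\<close> in \<open>v(F\<^sup>*)\<close>.\<close>

definition ramification_index :: "'a set \<Rightarrow> 'a set \<Rightarrow> nat"
  where "ramification_index K F =
    card (rcosets\<^bsub>value_group F\<^esub> (carrier (value_group K)))"

definition is_totally_ramified :: "'a set \<Rightarrow> 'a set \<Rightarrow> bool"
  where "is_totally_ramified K F \<longleftrightarrow>
    is_finite_extension K F \<and> ramification_index K F = (dim over K) F"

definition abs_Galois :: "'a set \<Rightarrow> ('a \<Rightarrow> 'a) set"
  where "abs_Galois E = {g \<in> ring_iso Qp_bar_field Qp_bar_field. \<forall>x \<in> E. g x = x}"

text \<open>The action of \<open>g\<close> on the whole field: its unique continuous extension from the dense subfield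
  \<open>Qp_bar\<close>.\<close>

definition Galois_action :: "('a \<Rightarrow> 'a) \<Rightarrow> 'a \<Rightarrow> 'a"
  where "Galois_action g = (THE \<tau>. \<tau> \<in> extensional (carrier C) \<and>
    continuous_map metric.mtopology metric.mtopology \<tau> \<and> (\<forall>x \<in> Qp_bar. \<tau> x = g x))"

definition is_defined_over :: "'a set \<Rightarrow> 'a set \<Rightarrow> bool"
  where "is_defined_over E D \<longleftrightarrow> (\<forall>g \<in> abs_Galois E. Galois_action g ` D = D)"

end

text \<open>\<open>\<complex>\<^sub>p\<close> is the completion of an algebraic closure of \<open>\<rat>\<^sub>p\<close>. HOL has no canonical copy of it, so the
  locale describes its models: a complete field whose absolute value restricts to the \<open>p\<close>-adic one,
  and in which \<open>Qp_bar\<close> is a dense algebraic closure of \<open>Qp\<close>. Any two models are isomorphic as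
  valued fields.\<close>

locale padic_complex_field = valued_field C v for C (structure) and v +
  fixes p :: nat
  assumes prime_p: "Factorial_Ring.prime p"
    and v_p: "v ([p] \<cdot> \<one>) = 1 / real p"
    and complete: "metric.mcomplete"
    and Qp_bar_algebraic_closure: "algebraic_closure Qp_bar_field Qp"
    and Qp_bar_dense: "metric.mtopology closure_of Qp_bar = carrier C"

end

theory Submission
  imports Defs
begin

text \<open>Automorphisms of \<open>Qp_bar\<close> are isometries because finite-dimensional spaces over \<open>Qp\<close> are complete,
  and the elements fixed by \<open>abs_Galois E\<close> are those of \<open>E\<close>. So a polynomial that is assembled
  from points of \<open>D\<close> in a Galois-invariant way has coefficients in \<open>E\<close>, and if its leading coefficient
  is a unit, it has a root in \<open>D\<close>.

  Let \<open>\<alpha> \<in> F \<inter> D\<close>, and let \<open>M\<close> be the group of roots of unity of order prime to \<open>p\<close> in \<open>F\<close>. The conjugates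
  of \<open>\<alpha>\<close> under the automorphisms that fix \<open>M\<close> are at most \<open>ramification_index E F\<close> in number. The
  polynomial with these roots, multiplied by some \<open>u \<in> M\<close>, is summed over the conjugates of the pair.
  By independence of the characters modulo the maximal ideal, \<open>u\<close> can be chosen so that its trace is a
  unit. This gives a point of \<open>D\<close> of degree at most \<open>ramification_index E F\<close> over \<open>E\<close>. The ramification
  index never exceeds the degree, so a point of minimal degree generates a totally ramified extension.
  That its degree is a power of \<open>p\<close> is Ax's argument: summing over the subsets of its conjugates of a
  size \<open>n\<close> with a unit binomial coefficient gives a point of degree at most \<open>n\<close>.\<close>

section \<open>Ultrametric estimates\<close>

context valued_field
begin

lemma v_zero [simp]: "v \<zero> = 0"
  by (simp add: v_eq_0_iff)

lemma v_pos: "\<lbrakk>x \<in> carrier C; x \<noteq> \<zero>\<rbrakk> \<Longrightarrow> 0 < v x"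
  using v_nonneg v_eq_0_iff by (metis less_eq_real_def)

lemma v_pow: "x \<in> carrier C \<Longrightarrow> v (x [^] (n::nat)) = v x ^ n"
  by (induction n) (auto simp: v_one v_mult)

lemma v_inv: "\<lbrakk>x \<in> carrier C; x \<noteq> \<zero>\<rbrakk> \<Longrightarrow> v (inv x) = inverse (v x)"
  using v_mult[of x "inv x"] v_one field_Units v_pos[of x]
  by (simp add: field_simps)

lemma v_add_le: "\<lbrakk>x \<in> carrier C; y \<in> carrier C; v x \<le> r; v y \<le> r\<rbrakk> \<Longrightarrow> v (x \<oplus> y) \<le> r"
  using v_ultrametric[of x y] by auto

lemma v_add_less: "\<lbrakk>x \<in> carrier C; y \<in> carrier C; v x < r; v y < r\<rbrakk> \<Longrightarrow> v (x \<oplus> y) < r"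
  using v_ultrametric[of x y] by auto

lemma v_minus_le: "\<lbrakk>x \<in> carrier C; y \<in> carrier C; v x \<le> r; v y \<le> r\<rbrakk> \<Longrightarrow> v (x \<ominus> y) \<le> r"
  using v_add_le[of x "\<ominus> y"] v_minus[of y] by (simp add: minus_eq)

lemma v_minus_less: "\<lbrakk>x \<in> carrier C; y \<in> carrier C; v x < r; v y < r\<rbrakk> \<Longrightarrow> v (x \<ominus> y) < r"
  using v_add_less[of x "\<ominus> y"] v_minus[of y] by (simp add: minus_eq)

lemma v_minus_commute: "\<lbrakk>x \<in> carrier C; y \<in> carrier C\<rbrakk> \<Longrightarrow> v (x \<ominus> y) = v (y \<ominus> x)"
proof -
  assume "x \<in> carrier C" "y \<in> carrier C"
  moreover from this have "x \<ominus> y = \<ominus> (y \<ominus> x)" by algebra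
  ultimately show ?thesis by (simp add: v_minus)
qed

lemma v_trans_less:
  assumes "x \<in> carrier C" "y \<in> carrier C" "z \<in> carrier C" "v (x \<ominus> y) < r" "v (y \<ominus> z) < r"
  shows "v (x \<ominus> z) < r"
proof -
  have "x \<ominus> z = (x \<ominus> y) \<oplus> (y \<ominus> z)" using assms(1-3) by algebra
  then show ?thesis using assms v_add_less[of "x \<ominus> y" "y \<ominus> z"] by simp
qed

lemma v_trans_le:
  assumes "x \<in> carrier C" "y \<in> carrier C" "z \<in> carrier C" "v (x \<ominus> y) \<le> r" "v (y \<ominus> z) \<le> r"
  shows "v (x \<ominus> z) \<le> r"
proof -
  have "x \<ominus> z = (x \<ominus> y) \<oplus> (y \<ominus> z)" using assms(1-3) by algebra
  then show ?thesis using assms v_add_le[of "x \<ominus> y" "y \<ominus> z"] by simp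
qed

lemma v_add_dominant:
  assumes "x \<in> carrier C" "y \<in> carrier C" "v x < v y"
  shows "v (x \<oplus> y) = v y"
proof (rule antisym)
  show "v (x \<oplus> y) \<le> v y" using assms by (intro v_add_le) auto
  have "y = (x \<oplus> y) \<ominus> x" using assms(1,2) by algebra
  then have "v y \<le> max (v (x \<oplus> y)) (v x)"
    using v_ultrametric[of "x \<oplus> y" "\<ominus> x"] assms by (simp add: minus_eq v_minus)
  then show "v y \<le> v (x \<oplus> y)" using assms(3) by linarith
qed

lemma v_add_eq_max:
  assumes "x \<in> carrier C" "y \<in> carrier C" "v x \<noteq> v y"
  shows "v (x \<oplus> y) = max (v x) (v y)"
  using v_add_dominant[of x y] v_add_dominant[of y x] assms by (auto simp: a_comm max_def)

lemma v_eq_of_close: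
  assumes "x \<in> carrier C" "y \<in> carrier C" "v (x \<ominus> y) < v x"
  shows "v y = v x"
proof -
  have "y = (y \<ominus> x) \<oplus> x" using assms(1,2) by algebra
  then show ?thesis using v_add_dominant[of "y \<ominus> x" x] assms v_minus_commute[of x y] by auto
qed

lemma v_finsum_le:
  assumes "finite A" "\<And>i. i \<in> A \<Longrightarrow> f i \<in> carrier C" "\<And>i. i \<in> A \<Longrightarrow> v (f i) \<le> r" "0 \<le> r"
  shows "v (finsum C f A) \<le> r"
  using assms
proof (induction A)
  case (insert a A)
  then have "v (f a \<oplus> finsum C f A) \<le> r"
    by (intro v_add_le) (auto intro!: finsum_closed)
  with insert show ?case by (auto simp: finsum_insert)
qed simp

lemma v_finsum_less:
  assumes "finite A" "\<And>i. i \<in> A \<Longrightarrow> f i \<in> carrier C" "\<And>i. i \<in> A \<Longrightarrow> v (f i) < r" "0 < r"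
  shows "v (finsum C f A) < r"
  using assms
proof (induction A)
  case (insert a A)
  then have "v (f a \<oplus> finsum C f A) < r"
    by (intro v_add_less) (auto intro!: finsum_closed)
  with insert show ?case by (auto simp: finsum_insert)
qed simp

lemma v_finprod:
  assumes "finite A" "\<And>i. i \<in> A \<Longrightarrow> f i \<in> carrier C"
  shows "v (finprod C f A) = (\<Prod>i\<in>A. v (f i))"
  using assms
proof (induction A)
  case (insert a A)
  then show ?case by (auto simp: finprod_insert v_mult)
qed (simp add: v_one)

lemma inv_nonzero_closed: "\<lbrakk>x \<in> carrier C; x \<noteq> \<zero>\<rbrakk> \<Longrightarrow> inv x \<in> carrier C"
  using field_Units by auto

lemma mult_inv_cancel:
  assumes "x \<in> carrier C" "x \<noteq> \<zero>"
  shows "x \<otimes> inv x = \<one>" "inv x \<otimes> x = \<one>" "inv x \<noteq> \<zero>"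
proof -
  have "x \<in> Units C" using assms field_Units by auto
  then show 1: "x \<otimes> inv x = \<one>" "inv x \<otimes> x = \<one>" by auto
  then show "inv x \<noteq> \<zero>" using assms(1) by auto
qed

end

section \<open>Polynomial functions\<close>

context field
begin

lemma eval_vanishing:
  assumes "set p \<subseteq> carrier R" "infinite A" "A \<subseteq> carrier R" "\<And>x. x \<in> A \<Longrightarrow> eval p x = \<zero>"
  shows "set p \<subseteq> {\<zero>}"
proof -
  have p: "normalize p \<in> carrier (poly_ring R)"
    using normalize_gives_polynomial[OF assms(1)] univ_poly_carrier by blast
  have "normalize p = []"
  proof (rule ccontr)
    assume "normalize p \<noteq> []"
    then have "A \<subseteq> {x. is_root (normalize p) x}"
      using assms eval_normalize[OF assms(1)] by (auto simp: is_root_def)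
    then show False
      using finite_number_of_roots[OF p] assms(2) finite_subset by blast
  qed
  then have "p = replicate (length p) \<zero>"
    using normalize_trick[of p] by simp
  then show ?thesis
    by (metis in_set_replicate singletonI subsetI)
qed

lemma eval_map2_minus:
  assumes "length p = length q" "set p \<subseteq> carrier R" "set q \<subseteq> carrier R" "x \<in> carrier R"
  shows "eval (map2 (\<lambda>a b. a \<ominus> b) p q) x = eval p x \<ominus> eval q x"
  using assms
proof (induction p q rule: list_induct2)
  case (Cons a p b q)
  then have "eval p x \<in> carrier R" "eval q x \<in> carrier R"
    by (auto intro!: eval_in_carrier)
  moreover have "a \<in> carrier R" "b \<in> carrier R" "x [^] length q \<in> carrier R"
    using Cons by auto
  ultimately have "(a \<ominus> b) \<otimes> x [^] length q \<oplus> (eval p x \<ominus> eval q x) =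
      (a \<otimes> x [^] length q \<oplus> eval p x) \<ominus> (b \<otimes> x [^] length q \<oplus> eval q x)"
    by algebra
  with Cons show ?case by simp
qed (simp add: minus_eq)

lemma eval_list_eqI:
  assumes "length p = length q" "set p \<subseteq> carrier R" "set q \<subseteq> carrier R"
    and "infinite A" "A \<subseteq> carrier R" "\<And>x. x \<in> A \<Longrightarrow> eval p x = eval q x"
  shows "p = q"
proof -
  let ?d = "map2 (\<lambda>a b. a \<ominus> b) p q"
  have sub: "set ?d \<subseteq> carrier R"
  proof
    fix d assume "d \<in> set ?d"
    then obtain a b where ab: "(a, b) \<in> set (zip p q)" "d = a \<ominus> b" by auto
    then have "a \<in> carrier R" "b \<in> carrier R"
      using assms(2,3) set_zip_leftD[OF ab(1)] set_zip_rightD[OF ab(1)] by auto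
    then show "d \<in> carrier R" using ab by simp
  qed
  have "set ?d \<subseteq> {\<zero>}"
  proof (rule eval_vanishing[OF sub assms(4,5)])
    fix x assume "x \<in> A"
    then show "eval ?d x = \<zero>"
      using assms eval_map2_minus[OF assms(1-3)] eval_in_carrier[OF assms(3)] by (auto simp: r_right_minus_eq)
  qed
  with assms(1-3) show ?thesis
  proof (induction p q rule: list_induct2)
    case (Cons a p b q)
    then show ?case by (auto simp: r_right_minus_eq)
  qed simp
qed

definition polyfun :: "'a set \<Rightarrow> nat \<Rightarrow> 'a \<Rightarrow> ('a \<Rightarrow> 'a) \<Rightarrow> bool"
  where "polyfun K n c f \<longleftrightarrow>
    (\<exists>p. set p \<subseteq> K \<and> length p = Suc n \<and> hd p = c \<and> (\<forall>x \<in> carrier R. f x = eval p x))"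

lemma polyfun_cong:
  assumes "polyfun K n c f" "\<And>x. x \<in> carrier R \<Longrightarrow> f x = g x"
  shows "polyfun K n c g"
  using assms unfolding polyfun_def by metis

lemma polyfun_const:
  assumes "c \<in> K" "K \<subseteq> carrier R"
  shows "polyfun K 0 c (\<lambda>_. c)"
  unfolding polyfun_def using assms by (intro exI[of _ "[c]"]) auto

lemma polyfun_zero_degree:
  assumes "polyfun K 0 c f" "K \<subseteq> carrier R"
  shows "c \<in> K" "x \<in> carrier R \<Longrightarrow> f x = c"
proof -
  obtain p where p: "set p \<subseteq> K" "length p = Suc 0" "hd p = c" "\<forall>x \<in> carrier R. f x = eval p x"
    using assms unfolding polyfun_def by blast
  then have "p = [c]" by (cases p) auto
  then show "c \<in> K" "x \<in> carrier R \<Longrightarrow> f x = c"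
    using p assms(2) by auto
qed

lemma polyfun_Suc:
  assumes "polyfun K n c f" "a \<in> K" "K \<subseteq> carrier R"
  shows "polyfun K (Suc n) c (\<lambda>x. f x \<otimes> x \<oplus> a)"
proof -
  obtain p where p: "set p \<subseteq> K" "length p = Suc n" "hd p = c" "\<forall>x \<in> carrier R. f x = eval p x"
    using assms unfolding polyfun_def by blast
  then have "hd (p @ [a]) = c" by (cases p) auto
  moreover have "f x \<otimes> x \<oplus> a = eval (p @ [a]) x" if "x \<in> carrier R" for x
  proof -
    have "set p \<subseteq> carrier R" "a \<in> carrier R" using p assms by auto
    then show ?thesis using p(4) that eval_append_aux[of p a x] by auto
  qed
  ultimately show ?thesis
    unfolding polyfun_def using p assms by (intro exI[of _ "p @ [a]"]) auto
qed

lemma polyfun_SucE: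
  assumes "polyfun K (Suc n) c f" "K \<subseteq> carrier R"
  obtains g a where "polyfun K n c g" "a \<in> K" "\<And>x. x \<in> carrier R \<Longrightarrow> f x = g x \<otimes> x \<oplus> a"
proof -
  obtain p where p: "set p \<subseteq> K" "length p = Suc (Suc n)" "hd p = c" "\<forall>x \<in> carrier R. f x = eval p x"
    using assms unfolding polyfun_def by blast
  then obtain q a where q: "p = q @ [a]" by (metis length_0_conv nat.distinct(1) rev_exhaust)
  then have "hd q = c" using p by (cases q) auto
  then have "polyfun K n c (eval q)"
    using p q unfolding polyfun_def by (intro exI[of _ q]) auto
  moreover have "f x = eval q x \<otimes> x \<oplus> a" if "x \<in> carrier R" for x
  proof -
    have "set q \<subseteq> carrier R" "a \<in> carrier R" using p q assms(2) by auto
    then show ?thesis using p(4) q that eval_append_aux[of q a x] by auto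
  qed
  ultimately show ?thesis using that p q by auto
qed

lemma polyfun_closed:
  assumes "polyfun K n c f" "K \<subseteq> carrier R" "x \<in> carrier R"
  shows "f x \<in> carrier R"
proof -
  obtain p where "set p \<subseteq> K" "f x = eval p x"
    using assms unfolding polyfun_def by blast
  then show ?thesis using assms(2,3) eval_in_carrier[of p x] by auto
qed

lemma polyfun_lead:
  assumes "polyfun K n c f"
  shows "c \<in> K"
  using assms unfolding polyfun_def by (metis Suc_length_conv list.sel(1) list.set_intros(1) subsetD)

lemma polyfun_mono:
  assumes "polyfun K n c f" "K \<subseteq> L"
  shows "polyfun L n c f"
proof -
  obtain p where "set p \<subseteq> K" "length p = Suc n" "hd p = c" "\<forall>x \<in> carrier R. f x = eval p x"
    using assms unfolding polyfun_def by blast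
  then show ?thesis using assms(2) unfolding polyfun_def by (intro exI[of _ p]) auto
qed

lemma polyfun_add:
  assumes "subring K R" "polyfun K n c f" "polyfun K n d g"
  shows "polyfun K n (c \<oplus> d) (\<lambda>x. f x \<oplus> g x)"
  using assms(2,3)
proof (induction n arbitrary: f g)
  case 0
  note K = subringE(1)[OF assms(1)]
  show ?case
    using polyfun_const[of "c \<oplus> d" K] polyfun_zero_degree[OF 0(1) K] polyfun_zero_degree[OF 0(2) K]
      subringE(7)[OF assms(1)] K by (auto intro: polyfun_cong)
next
  case (Suc n)
  note K = subringE(1)[OF assms(1)]
  obtain f' a where f: "polyfun K n c f'" "a \<in> K" "\<And>x. x \<in> carrier R \<Longrightarrow> f x = f' x \<otimes> x \<oplus> a"
    by (rule polyfun_SucE[OF Suc(2) K]) blast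
  obtain g' b where g: "polyfun K n d g'" "b \<in> K" "\<And>x. x \<in> carrier R \<Longrightarrow> g x = g' x \<otimes> x \<oplus> b"
    by (rule polyfun_SucE[OF Suc(3) K]) blast
  have "polyfun K (Suc n) (c \<oplus> d) (\<lambda>x. (f' x \<oplus> g' x) \<otimes> x \<oplus> (a \<oplus> b))"
    using f g K subringE(7)[OF assms(1)] by (intro polyfun_Suc Suc.IH) auto
  then show ?case
  proof (rule polyfun_cong)
    fix x assume x: "x \<in> carrier R"
    then have "f' x \<in> carrier R" "g' x \<in> carrier R" "a \<in> carrier R" "b \<in> carrier R"
      using polyfun_closed f g K by auto
    with x show "(f' x \<oplus> g' x) \<otimes> x \<oplus> (a \<oplus> b) = f x \<oplus> g x"
      unfolding f(3)[OF x] g(3)[OF x] by algebra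
  qed
qed

lemma polyfun_smult:
  assumes "subring K R" "polyfun K n c f" "k \<in> K"
  shows "polyfun K n (k \<otimes> c) (\<lambda>x. k \<otimes> f x)"
  using assms(2)
proof (induction n arbitrary: f)
  case 0
  note K = subringE(1)[OF assms(1)]
  show ?case
    using polyfun_const[of "k \<otimes> c" K] polyfun_zero_degree[OF 0(1) K] assms(3)
      subringE(6)[OF assms(1)] K by (auto intro: polyfun_cong)
next
  case (Suc n)
  note K = subringE(1)[OF assms(1)]
  obtain f' a where f: "polyfun K n c f'" "a \<in> K" "\<And>x. x \<in> carrier R \<Longrightarrow> f x = f' x \<otimes> x \<oplus> a"
    by (rule polyfun_SucE[OF Suc(2) K]) blast
  have "polyfun K (Suc n) (k \<otimes> c) (\<lambda>x. (k \<otimes> f' x) \<otimes> x \<oplus> (k \<otimes> a))"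
    using f K assms(3) subringE(6)[OF assms(1)] by (intro polyfun_Suc Suc.IH) auto
  then show ?case
  proof (rule polyfun_cong)
    fix x assume x: "x \<in> carrier R"
    then have "f' x \<in> carrier R" "k \<in> carrier R" "a \<in> carrier R"
      using polyfun_closed f K assms(3) by auto
    with x show "(k \<otimes> f' x) \<otimes> x \<oplus> (k \<otimes> a) = k \<otimes> f x"
      unfolding f(3)[OF x] by algebra
  qed
qed

lemma polyfun_add_const:
  assumes "subring K R" "polyfun K (Suc n) c f" "k \<in> K"
  shows "polyfun K (Suc n) c (\<lambda>x. f x \<oplus> k)"
proof -
  note K = subringE(1)[OF assms(1)]
  obtain f' a where f: "polyfun K n c f'" "a \<in> K" "\<And>x. x \<in> carrier R \<Longrightarrow> f x = f' x \<otimes> x \<oplus> a"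
    by (rule polyfun_SucE[OF assms(2) K]) blast
  have "polyfun K (Suc n) c (\<lambda>x. f' x \<otimes> x \<oplus> (a \<oplus> k))"
    using f assms(3) K subringE(7)[OF assms(1)] by (intro polyfun_Suc) auto
  then show ?thesis
  proof (rule polyfun_cong)
    fix x assume x: "x \<in> carrier R"
    then have "f' x \<in> carrier R" "k \<in> carrier R" "a \<in> carrier R"
      using polyfun_closed f K assms(3) by auto
    with x show "f' x \<otimes> x \<oplus> (a \<oplus> k) = f x \<oplus> k"
      unfolding f(3)[OF x] by algebra
  qed
qed

lemma polyfun_times_linear:
  assumes "subring K R" "polyfun K n c f" "b \<in> K"
  shows "polyfun K (Suc n) c (\<lambda>x. f x \<otimes> (x \<ominus> b))"
proof -
  note K = subringE(1)[OF assms(1)]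
  have "\<zero> \<in> K" "\<ominus> b \<in> K" using subringE(2,5)[OF assms(1)] assms(3) by auto
  then have "polyfun K (Suc n) c (\<lambda>x. f x \<otimes> x \<oplus> \<zero>)"
    using polyfun_Suc[OF assms(2)] K by auto
  show ?thesis
  proof (cases n)
    case 0
    note f = polyfun_zero_degree[OF assms(2)[unfolded 0] K]
    have "polyfun K (Suc n) c (\<lambda>x. f x \<otimes> x \<oplus> (\<ominus> b \<otimes> c))"
      using assms(2) f(1) \<open>\<ominus> b \<in> K\<close> K subringE(6)[OF assms(1)] by (intro polyfun_Suc) auto
    then show ?thesis
    proof (rule polyfun_cong)
      fix x assume x: "x \<in> carrier R"
      have "c \<in> carrier R" "b \<in> carrier R" using f(1) assms(3) K by auto
      with x show "f x \<otimes> x \<oplus> (\<ominus> b \<otimes> c) = f x \<otimes> (x \<ominus> b)"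
        unfolding f(2)[OF x] by algebra
    qed
  next
    case (Suc m)
    have *: "polyfun K (Suc n) \<zero> (\<lambda>x. \<ominus> b \<otimes> f x)"
    proof -
      obtain p where p: "set p \<subseteq> K" "length p = Suc n" "hd p = c" "\<forall>x \<in> carrier R. f x = eval p x"
        using assms unfolding polyfun_def by blast
      obtain q where q: "set q \<subseteq> K" "length q = Suc n" "\<forall>x \<in> carrier R. \<ominus> b \<otimes> f x = eval q x"
        using polyfun_smult[OF assms(1,2) \<open>\<ominus> b \<in> K\<close>] unfolding polyfun_def by blast
      have "eval (\<zero> # q) x = eval q x" if "x \<in> carrier R" for x
        using that q(1) K eval_in_carrier[of q x] by auto
      with q \<open>\<zero> \<in> K\<close> show ?thesis
        unfolding polyfun_def by (intro exI[of _ "\<zero> # q"]) auto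
    qed
    have "c \<oplus> \<zero> = c" using polyfun_lead[OF assms(2)] K by auto
    then have "polyfun K (Suc n) c (\<lambda>x. (f x \<otimes> x \<oplus> \<zero>) \<oplus> (\<ominus> b \<otimes> f x))"
      using polyfun_add[OF assms(1) \<open>polyfun K (Suc n) c (\<lambda>x. f x \<otimes> x \<oplus> \<zero>)\<close> *] by simp
    then show ?thesis
    proof (rule polyfun_cong)
      fix x assume x: "x \<in> carrier R"
      have "b \<in> carrier R" "f x \<in> carrier R" using assms(3) K polyfun_closed[OF assms(2) K x] by auto
      with x show "(f x \<otimes> x \<oplus> \<zero>) \<oplus> (\<ominus> b \<otimes> f x) = f x \<otimes> (x \<ominus> b)"
        by algebra
    qed
  qed
qed

lemma polyfun_prod_linear:
  assumes "subring K R" "finite S" "S \<subseteq> K"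
  shows "polyfun K (card S) \<one> (\<lambda>x. \<Otimes>b\<in>S. x \<ominus> b)"
  using assms(2,3)
proof (induction S)
  case empty
  show ?case using polyfun_const[of \<one> K] subringE(1,3)[OF assms(1)] by auto
next
  case (insert b S)
  note K = subringE(1)[OF assms(1)]
  have "polyfun K (Suc (card S)) \<one> (\<lambda>x. (\<Otimes>b\<in>S. x \<ominus> b) \<otimes> (x \<ominus> b))"
    using insert by (intro polyfun_times_linear assms) auto
  then have "polyfun K (Suc (card S)) \<one> (\<lambda>x. \<Otimes>b\<in>insert b S. x \<ominus> b)"
  proof (rule polyfun_cong)
    fix x assume x: "x \<in> carrier R"
    have "(\<lambda>b. x \<ominus> b) \<in> S \<rightarrow> carrier R" "b \<in> carrier R" using insert K x by auto
    then show "(\<Otimes>b\<in>S. x \<ominus> b) \<otimes> (x \<ominus> b) = (\<Otimes>b\<in>insert b S. x \<ominus> b)"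
      using insert x by (subst finprod_insert) (auto simp: m_comm)
  qed
  then show ?case using insert by simp
qed

lemma polyfun_finsum:
  assumes "subring K R" "finite I" "I \<noteq> {}" "\<And>i. i \<in> I \<Longrightarrow> polyfun K n (c i) (f i)"
  shows "polyfun K n (finsum R c I) (\<lambda>x. \<Oplus>i\<in>I. f i x)"
  using assms(2-4)
proof (induction I rule: finite_ne_induct)
  case (singleton i)
  note K = subringE(1)[OF assms(1)]
  have "c i \<in> carrier R" using polyfun_lead singleton K by blast
  then have "finsum R c {i} = c i" by simp
  moreover have "(\<Oplus>i\<in>{i}. f i x) = f i x" if "x \<in> carrier R" for x
    using polyfun_closed[of K n "c i" "f i" x] singleton K that by simp
  ultimately show ?case using singleton by (auto intro: polyfun_cong)
next
  case (insert i I)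
  note K = subringE(1)[OF assms(1)]
  have c: "c j \<in> carrier R" if "j \<in> insert i I" for j using polyfun_lead insert(5)[OF that] K by blast
  have "polyfun K n (c i \<oplus> finsum R c I) (\<lambda>x. f i x \<oplus> (\<Oplus>i\<in>I. f i x))"
    using insert by (intro polyfun_add assms(1)) auto
  moreover have "finsum R c (insert i I) = c i \<oplus> finsum R c I"
    using insert c by (intro finsum_insert) auto
  moreover have "(\<Oplus>i\<in>insert i I. f i x) = f i x \<oplus> (\<Oplus>i\<in>I. f i x)" if "x \<in> carrier R" for x
    using insert polyfun_closed[OF insert(5) K that] by (intro finsum_insert) auto
  ultimately show ?case by (auto intro: polyfun_cong)
qed

lemma polyfun_divide_linear:
  assumes "subring K R" "polyfun K (Suc n) c f" "b \<in> K"
  obtains h where "polyfun K n c h" "\<And>x. x \<in> carrier R \<Longrightarrow> f x = h x \<otimes> (x \<ominus> b) \<oplus> f b"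
proof -
  have "\<exists>h. polyfun K n c h \<and> (\<forall>x \<in> carrier R. f x = h x \<otimes> (x \<ominus> b) \<oplus> f b) \<and> f b \<in> K"
    using assms(2)
  proof (induction n arbitrary: f)
    case 0
    note K = subringE(1)[OF assms(1)]
    obtain f' a where f: "polyfun K 0 c f'" "a \<in> K" "\<And>x. x \<in> carrier R \<Longrightarrow> f x = f' x \<otimes> x \<oplus> a"
      by (rule polyfun_SucE[OF 0 K]) blast
    note f' = polyfun_zero_degree[OF f(1) K]
    have carr: "b \<in> carrier R" "c \<in> carrier R" "a \<in> carrier R"
      using f(2) f'(1) K assms(3) by auto
    have fb: "f b = c \<otimes> b \<oplus> a" using f(3) f'(2) carr by simp
    have "f x = f' x \<otimes> (x \<ominus> b) \<oplus> f b" if "x \<in> carrier R" for x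
      unfolding fb f(3)[OF that] f'(2)[OF that] using carr that by algebra
    moreover have "f b \<in> K" unfolding fb using f'(1) f(2) assms(3) subringE(6,7)[OF assms(1)] by auto
    ultimately show ?case using f(1) by blast
  next
    case (Suc n)
    note K = subringE(1)[OF assms(1)]
    obtain f' a where f: "polyfun K (Suc n) c f'" "a \<in> K" "\<And>x. x \<in> carrier R \<Longrightarrow> f x = f' x \<otimes> x \<oplus> a"
      by (rule polyfun_SucE[OF Suc(2) K]) blast
    obtain h where h: "polyfun K n c h" "\<forall>x \<in> carrier R. f' x = h x \<otimes> (x \<ominus> b) \<oplus> f' b" "f' b \<in> K"
      using Suc.IH[OF f(1)] by blast
    have carr: "b \<in> carrier R" "a \<in> carrier R" "f' b \<in> carrier R"
      using f(2) h(3) K assms(3) by auto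
    have fb: "f b = f' b \<otimes> b \<oplus> a" using f(3) carr by simp
    have "f x = (h x \<otimes> x \<oplus> f' b) \<otimes> (x \<ominus> b) \<oplus> f b" if x: "x \<in> carrier R" for x
    proof -
      have hx: "h x \<in> carrier R" using polyfun_closed h(1) K x by blast
      have "f' x = h x \<otimes> (x \<ominus> b) \<oplus> f' b" using h x by auto
      then have "f x = (h x \<otimes> (x \<ominus> b) \<oplus> f' b) \<otimes> x \<oplus> a" using f(3)[OF x] by simp
      then show ?thesis unfolding fb using carr x hx by algebra
    qed
    moreover have "polyfun K (Suc n) c (\<lambda>x. h x \<otimes> x \<oplus> f' b)"
      using h K by (intro polyfun_Suc) auto
    moreover have "f b \<in> K" unfolding fb using h(3) f(2) assms(3) subringE(6,7)[OF assms(1)] by auto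
    ultimately show ?case by blast
  qed
  then show ?thesis using that by blast
qed

lemma polyfun_roots:
  assumes "subring K R" "polyfun K n c f" "c \<noteq> \<zero>"
  shows "finite {x \<in> K. f x = \<zero>} \<and> card {x \<in> K. f x = \<zero>} \<le> n"
  using assms(2)
proof (induction n arbitrary: f)
  case 0
  note K = subringE(1)[OF assms(1)]
  have "{x \<in> K. f x = \<zero>} = {}"
    using polyfun_zero_degree[OF 0 K] assms(3) K by auto
  then show ?case by (metis card.empty finite.emptyI le0)
next
  case (Suc n)
  note K = subringE(1)[OF assms(1)]
  show ?case
  proof (cases "{x \<in> K. f x = \<zero>} = {}")
    case False
    then obtain b where b: "b \<in> K" "f b = \<zero>" by auto
    obtain h where h: "polyfun K n c h" "\<And>x. x \<in> carrier R \<Longrightarrow> f x = h x \<otimes> (x \<ominus> b) \<oplus> f b"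
      by (rule polyfun_divide_linear[OF assms(1) Suc(2) b(1)]) blast
    have "{x \<in> K. f x = \<zero>} \<subseteq> insert b {x \<in> K. h x = \<zero>}"
    proof
      fix x assume x: "x \<in> {x \<in> K. f x = \<zero>}"
      then have carr: "x \<in> carrier R" "b \<in> carrier R" "h x \<in> carrier R"
        using K b polyfun_closed[OF h(1) K] by auto
      then have "h x \<otimes> (x \<ominus> b) = \<zero>" using h(2)[of x] x b by auto
      then have "h x = \<zero> \<or> x \<ominus> b = \<zero>" using carr integral[of "h x" "x \<ominus> b"] by auto
      then show "x \<in> insert b {x \<in> K. h x = \<zero>}" using x carr r_right_minus_eq by auto
    qed
    moreover have "finite {x \<in> K. h x = \<zero>}" "card {x \<in> K. h x = \<zero>} \<le> n"
      using Suc.IH[OF h(1)] by auto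
    ultimately have "finite {x \<in> K. f x = \<zero>}"
      and "card {x \<in> K. f x = \<zero>} \<le> card (insert b {x \<in> K. h x = \<zero>})"
      by (auto intro: finite_subset card_mono)
    then show ?thesis
      using \<open>finite {x \<in> K. h x = \<zero>}\<close> \<open>card {x \<in> K. h x = \<zero>} \<le> n\<close>
      by (simp add: card_insert_if split: if_splits)
  next
    case True
    show ?thesis unfolding True by simp
  qed
qed

end

context padic_complex_field
begin

section \<open>Intermediate fields and automorphisms\<close>

lemma subfield_Qp: "subfield Qp C"
proof -
  interpret A: algebraic_closure Qp_bar_field Qp by (rule Qp_bar_algebraic_closure)
  have "field (Qp_bar_field \<lparr> carrier := Qp \<rparr>)"
    using A.subfield_iff(2)[OF A.subfield_axioms] .
  then have "field (C \<lparr> carrier := Qp \<rparr>)" by (simp add: Qp_bar_field_def)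
  moreover have "Qp \<subseteq> carrier C"
    unfolding Qp_def using closure_of_subset_topspace[of metric.mtopology] by simp
  ultimately show ?thesis by (rule subfield_iff(1))
qed

lemma subfield_Qp_bar: "subfield Qp_bar C"
  unfolding Qp_bar_def by (rule subfield_of_algebraics[OF subfield_Qp])

lemma Qp_bar_carrier: "Qp_bar \<subseteq> carrier C"
  using subfieldE(3)[OF subfield_Qp_bar] .

lemma polyfun_exists_root:
  assumes "polyfun Qp_bar (Suc n) c f" "c \<noteq> \<zero>"
  shows "\<exists>b \<in> Qp_bar. f b = \<zero>"
proof -
  interpret A: algebraic_closure Qp_bar_field Qp by (rule Qp_bar_algebraic_closure)
  obtain q where q: "set q \<subseteq> Qp_bar" "length q = Suc (Suc n)" "hd q = c" "\<forall>x \<in> carrier C. f x = eval q x"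
    using assms unfolding polyfun_def by blast
  have "polynomial\<^bsub>Qp_bar_field\<^esub> Qp_bar q"
    using q assms(2) by (auto simp: polynomial_def Qp_bar_field_def)
  then have q_in: "q \<in> carrier (poly_ring Qp_bar_field)"
    by (simp add: univ_poly_carrier Qp_bar_field_def)
  have "size (A.roots q) = Suc n"
    using A.roots_over_carrier[OF q_in] q(2) by (simp add: A.splitted_def)
  then obtain b where "b \<in># A.roots q"
    by (metis nat.distinct(1) multiset_nonemptyE size_empty)
  then have "A.is_root q b" using A.roots_mem_iff_is_root[OF q_in] by simp
  then have "b \<in> carrier Qp_bar_field" "A.eval q b = \<zero>\<^bsub>Qp_bar_field\<^esub>"
    unfolding A.is_root_def by auto
  moreover have "A.eval = eval"
    unfolding Qp_bar_field_def using eval_consistent[OF subfieldE(1)[OF subfield_Qp_bar]] .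
  ultimately have b: "b \<in> Qp_bar" "eval q b = \<zero>" by (auto simp: Qp_bar_field_def)
  then have "f b = \<zero>" using q(4) Qp_bar_carrier by auto
  with b show ?thesis by auto
qed

definition intermediate :: "'a set \<Rightarrow> bool"
  where "intermediate K \<longleftrightarrow> subfield K C \<and> Qp \<subseteq> K \<and> K \<subseteq> Qp_bar"

lemma intermediateD:
  assumes "intermediate K"
  shows "subfield K C" "subring K C" "K \<subseteq> carrier C" "Qp \<subseteq> K" "K \<subseteq> Qp_bar"
  using assms subfieldE[of K C] unfolding intermediate_def by auto

lemma algebraic_over_intermediate:
  assumes "intermediate K" "x \<in> Qp_bar"
  shows "(algebraic over K) x"
  using assms algebraic_mono[of Qp K x] unfolding intermediate_def Qp_bar_def by auto

lemma Irr_polyfun: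
  assumes "intermediate K" "x \<in> Qp_bar"
  shows "polyfun K (degree (Irr K x)) \<one> (eval (Irr K x))"
    and "eval (Irr K x) x = \<zero>" and "1 \<le> degree (Irr K x)" and "Irr K x \<in> carrier (K[X])"
proof -
  note K = intermediateD[OF assms(1)]
  have x: "x \<in> carrier C" using assms(2) Qp_bar_carrier by auto
  note E = IrrE[OF K(1) x algebraic_over_intermediate[OF assms]]
  show "Irr K x \<in> carrier (K[X])" "eval (Irr K x) x = \<zero>" using E by auto
  show "1 \<le> degree (Irr K x)" using pirreducible_degree[OF K(1) E(1,2)] .
  then have "length (Irr K x) = Suc (degree (Irr K x))" by linarith
  moreover have "set (Irr K x) \<subseteq> K" using E(1) polynomial_incl univ_poly_carrier by blast
  ultimately show "polyfun K (degree (Irr K x)) \<one> (eval (Irr K x))"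
    unfolding polyfun_def using E by blast
qed

lemma intermediate_subring:
  assumes "intermediate K" "subring L C" "K \<subseteq> L" "L \<subseteq> Qp_bar"
  shows "intermediate L"
proof -
  note K = intermediateD[OF assms(1)]
  have "inv x \<in> L" if "x \<in> L - {\<zero>}" for x
  proof -
    have x: "x \<in> carrier C" "x \<in> Qp_bar" "x \<noteq> \<zero>" using that assms Qp_bar_carrier by auto
    then have "subfield (simple_extension K x) C"
      using simple_extension_is_subfield[OF K(1)] algebraic_over_intermediate[OF assms(1)] by auto
    moreover have "x \<in> simple_extension K x" by (rule simple_extension_mem[OF K(2) x(1)])
    ultimately have "inv x \<in> simple_extension K x" using subfield_m_inv(1) x(3) by blast
    moreover have "simple_extension K x \<subseteq> L"
      using simple_extension_subring_incl[OF assms(2,3)] that by auto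
    ultimately show ?thesis by auto
  qed
  then have "subfield L C" using subfieldI'[OF assms(2)] by blast
  then show ?thesis unfolding intermediate_def using K assms by auto
qed

lemma intermediate_simple_extension:
  assumes "intermediate K" "x \<in> Qp_bar"
  shows "intermediate (simple_extension K x)" "K \<subseteq> simple_extension K x" "x \<in> simple_extension K x"
proof -
  note K = intermediateD[OF assms(1)]
  have x: "x \<in> carrier C" using assms(2) Qp_bar_carrier by auto
  show 1: "K \<subseteq> simple_extension K x" using simple_extension_incl[OF K(3) x] .
  show "x \<in> simple_extension K x" using simple_extension_mem[OF K(2) x] .
  have "simple_extension K x \<subseteq> Qp_bar"
    using simple_extension_subring_incl[OF subfieldE(1)[OF subfield_Qp_bar] K(5) assms(2)] .
  then show "intermediate (simple_extension K x)"
    using intermediate_subring[OF assms(1) simple_extension_is_subring[OF K(2) x] 1] by blast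
qed

definition embedding :: "'a set \<Rightarrow> ('a \<Rightarrow> 'a) \<Rightarrow> bool"
  where "embedding L h \<longleftrightarrow> intermediate L \<and> h \<in> ring_hom (C \<lparr> carrier := L \<rparr>) C \<and> h ` L \<subseteq> Qp_bar"

lemma embedding_ring_hom_ring:
  assumes "embedding L h"
  shows "ring_hom_ring (C \<lparr> carrier := L \<rparr>) C h"
proof -
  have "ring (C \<lparr> carrier := L \<rparr>)"
    using assms subring_is_ring intermediateD(2) unfolding embedding_def by blast
  then show ?thesis
    using assms ring_hom_ringI2[OF _ ring_axioms] unfolding embedding_def by blast
qed

lemma embeddingD:
  assumes "embedding L h"
  shows "\<And>x y. \<lbrakk>x \<in> L; y \<in> L\<rbrakk> \<Longrightarrow> h (x \<oplus> y) = h x \<oplus> h y"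
    and "\<And>x y. \<lbrakk>x \<in> L; y \<in> L\<rbrakk> \<Longrightarrow> h (x \<otimes> y) = h x \<otimes> h y"
    and "h \<one> = \<one>" and "\<And>x. x \<in> L \<Longrightarrow> h x \<in> Qp_bar" and "\<And>x. x \<in> L \<Longrightarrow> h x \<in> carrier C"
  using assms Qp_bar_carrier unfolding embedding_def ring_hom_def by auto

lemma embedding_zero:
  assumes "embedding L h" shows "h \<zero> = \<zero>"
proof -
  interpret H: ring_hom_ring "C \<lparr> carrier := L \<rparr>" C h by (rule embedding_ring_hom_ring[OF assms])
  show ?thesis using H.hom_zero by simp
qed

lemma embedding_inj:
  assumes "embedding L h"
  shows "inj_on h L"
proof -
  have "field (C \<lparr> carrier := L \<rparr>)"
    using assms subfield_iff(2) intermediateD(1) unfolding embedding_def by blast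
  then show ?thesis
    using non_trivial_field_hom_is_inj[OF _ _ field_axioms, of h "C \<lparr> carrier := L \<rparr>"] assms
    unfolding embedding_def by auto
qed

lemma embedding_minus:
  assumes "embedding L h" "x \<in> L"
  shows "h (\<ominus> x) = \<ominus> h x"
proof -
  have L: "subring L C" using assms intermediateD unfolding embedding_def by blast
  then have mem: "\<ominus> x \<in> L" "x \<in> carrier C" using subringE(1,5)[OF L] assms(2) by auto
  then have "h x \<oplus> h (\<ominus> x) = h (x \<oplus> \<ominus> x)" using embeddingD(1)[OF assms(1) assms(2) mem(1)] by simp
  also have "\<dots> = \<zero>" using embedding_zero[OF assms(1)] mem by (simp add: r_neg)
  finally show ?thesis
    using embeddingD(5)[OF assms] embeddingD(5)[OF assms(1) mem(1)] by (metis a_comm minus_equality)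
qed

lemma embedding_extend:
  assumes h: "embedding L h" and x: "x \<in> Qp_bar" and x': "x' \<in> Qp_bar"
    and root: "eval (map h (Irr L x)) x' = \<zero>"
  obtains h' where "embedding (simple_extension L x) h'" "h' x = x'" "\<And>y. y \<in> L \<Longrightarrow> h' y = h y"
proof -
  let ?R = "C \<lparr> carrier := L \<rparr>"
  have int: "intermediate L" using h unfolding embedding_def by blast
  note L = intermediateD[OF int]
  have carr: "x \<in> carrier C" "x' \<in> carrier C" using x x' Qp_bar_carrier by auto
  interpret H: ring_hom_ring ?R C h by (rule embedding_ring_hom_ring[OF h])
  interpret P: domain "L[X]" by (rule univ_poly_is_domain[OF L(2)])
  interpret E: ring_hom_ring "L[X]" C "\<lambda>p. eval p x" by (rule eval_ring_hom[OF L(2) carr(1)])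
  define \<Psi> where "\<Psi> p = eval (map h p) x'" for p
  have in_L: "set p \<subseteq> L" if "p \<in> carrier (L[X])" for p
    using that polynomial_incl univ_poly_carrier by blast
  have in_C: "set (map h p) \<subseteq> carrier C" if "set p \<subseteq> L" for p
    using that embeddingD(5)[OF h] by auto
  have \<Psi>_add: "\<Psi> (p \<oplus>\<^bsub>L[X]\<^esub> q) = \<Psi> p \<oplus> \<Psi> q" if "p \<in> carrier (L[X])" "q \<in> carrier (L[X])" for p q
  proof -
    have "normalize (map h (poly_add p q)) = poly_add (map h p) (map h q)"
      using H.poly_add_hom'[of p q] in_L that poly_add_consistent[OF L(2)]
      by (simp del: poly_add.simps)
    moreover have "set (poly_add p q) \<subseteq> L"
      using in_L[OF P.a_closed[OF that]] by (simp add: univ_poly_add del: poly_add.simps)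
    ultimately have "\<Psi> (poly_add p q) = eval (poly_add (map h p) (map h q)) x'"
      using eval_normalize[OF in_C carr(2), of "poly_add p q"] by (simp add: \<Psi>_def del: poly_add.simps)
    then show ?thesis
      using eval_poly_add[OF in_C in_C carr(2)] in_L that by (simp add: \<Psi>_def univ_poly_add del: poly_add.simps)
  qed
  have \<Psi>_mult: "\<Psi> (p \<otimes>\<^bsub>L[X]\<^esub> q) = \<Psi> p \<otimes> \<Psi> q" if "p \<in> carrier (L[X])" "q \<in> carrier (L[X])" for p q
  proof -
    have "normalize (map h (poly_mult p q)) = poly_mult (map h p) (map h q)"
      using H.poly_mult_hom'[of p q] in_L that poly_mult_consistent[OF L(2)]
      by (simp del: poly_mult.simps)
    moreover have "set (poly_mult p q) \<subseteq> L"
      using in_L[OF P.m_closed[OF that]] by (simp add: univ_poly_mult del: poly_mult.simps)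
    ultimately have "\<Psi> (poly_mult p q) = eval (poly_mult (map h p) (map h q)) x'"
      using eval_normalize[OF in_C carr(2), of "poly_mult p q"] by (simp add: \<Psi>_def del: poly_mult.simps)
    then show ?thesis
      using eval_poly_mult[OF in_C in_C carr(2)] in_L that by (simp add: \<Psi>_def univ_poly_mult del: poly_mult.simps)
  qed
  have \<Psi>_carr: "\<Psi> p \<in> carrier C" if "p \<in> carrier (L[X])" for p
    unfolding \<Psi>_def using eval_in_carrier[OF in_C carr(2)] in_L that by blast
  have const: "[k] \<in> carrier (L[X]) \<and> eval [k] x = k \<and> \<Psi> [k] = h k" if "k \<in> L" "k \<noteq> \<zero>" for k
    using that L(3) carr embeddingD(5)[OF h] unfolding \<Psi>_def
    by (auto simp: univ_poly_carrier[symmetric] polynomial_def)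
  have one: "\<one> \<in> L" "\<one> \<noteq> \<zero>" using subringE(3)[OF L(2)] by auto
  have \<Psi>_hom: "\<Psi> \<in> ring_hom (L[X]) C"
  proof (rule ring_hom_memI)
    show "\<Psi> \<one>\<^bsub>L[X]\<^esub> = \<one>"
      using const[OF one] embeddingD(3)[OF h] by (simp add: univ_poly_one)
  qed (auto simp: \<Psi>_carr \<Psi>_add \<Psi>_mult)
  interpret Psi: ring_hom_ring "L[X]" C \<Psi>
    by (rule ring_hom_ringI2[OF P.ring_axioms ring_axioms \<Psi>_hom])
  note Irr = Irr_polyfun[OF int x]
  have ker: "\<Psi> p = \<zero>" if p: "p \<in> carrier (L[X])" "eval p x = \<zero>" for p
  proof -
    have "Irr L x pdivides p"
      using Irr_minimal[OF L(1) carr(1) algebraic_over_intermediate[OF int x] p] .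
    then have "Irr L x divides\<^bsub>L[X]\<^esub> p" using pdivides_iff_shell[OF L(1) Irr(4) p(1)] by simp
    then obtain r where r: "r \<in> carrier (L[X])" "p = Irr L x \<otimes>\<^bsub>L[X]\<^esub> r" by (auto elim: dividesE)
    have "\<Psi> (Irr L x) = \<zero>" using root unfolding \<Psi>_def .
    then show ?thesis using r \<Psi>_mult[OF Irr(4) r(1)] \<Psi>_carr[OF r(1)] by simp
  qed
  have eq: "\<Psi> p = \<Psi> q" if "p \<in> carrier (L[X])" "q \<in> carrier (L[X])" "eval p x = eval q x" for p q
  proof -
    have "eval (p \<ominus>\<^bsub>L[X]\<^esub> q) x = \<zero>"
      using that E.hom_closed by (simp add: a_minus_def r_neg)
    then have "\<Psi> (p \<ominus>\<^bsub>L[X]\<^esub> q) = \<zero>" using ker that by simp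
    then have "\<Psi> p \<ominus> \<Psi> q = \<zero>" using that by (simp add: a_minus_def)
    then show ?thesis using \<Psi>_carr that by simp
  qed
  define h' where "h' y = \<Psi> (SOME p. p \<in> carrier (L[X]) \<and> eval p x = y)" for y
  have h': "h' (eval p x) = \<Psi> p" if "p \<in> carrier (L[X])" for p
    unfolding h'_def by (rule someI2[of _ p]) (use that eq[OF _ that] in blast)+
  have img: "simple_extension L x = (\<lambda>p. eval p x) ` carrier (L[X])"
    using simple_extension_as_eval_img[OF L(3) carr(1)] .
  have X: "X \<in> carrier (L[X])" "eval X x = x" "\<Psi> X = x'"
  proof -
    show "X \<in> carrier (L[X])" using var_closed(1)[OF L(2)] .
    show "eval X x = x" using eval_var[OF carr(1)] .
    have "map h X = X" using embedding_zero[OF h] embeddingD(3)[OF h] by (simp add: var_def)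
    then show "\<Psi> X = x'" unfolding \<Psi>_def using eval_var[OF carr(2)] by simp
  qed
  have h'_L: "h' y = h y" if "y \<in> L" for y
  proof (cases "y = \<zero>")
    case True
    have "h' (eval [] x) = \<Psi> []" using h'[of "[]"] by (simp add: univ_poly_carrier[symmetric] polynomial_def)
    then show ?thesis using True embedding_zero[OF h] by (simp add: \<Psi>_def)
  next
    case False
    then show ?thesis using const[OF that] h'[of "[y]"] by metis
  qed
  have "\<Psi> p \<in> Qp_bar" if "p \<in> carrier (L[X])" for p
  proof -
    have "set (map h p) \<subseteq> Qp_bar" using in_L[OF that] embeddingD(4)[OF h] by auto
    moreover have "eval q x' \<in> Qp_bar" if "set q \<subseteq> Qp_bar" for q
      using that
    proof (induction q)
      case Nil
      then show ?case using subringE(2)[OF subfieldE(1)[OF subfield_Qp_bar]] by simp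
    next
      case (Cons a q)
      have pow: "x' [^] n \<in> Qp_bar" for n :: nat
        by (induction n) (use x' subringE(3,6)[OF subfieldE(1)[OF subfield_Qp_bar]] in auto)
      show ?case
        using Cons pow[of "length q"] subringE(6,7)[OF subfieldE(1)[OF subfield_Qp_bar]] by auto
    qed
    ultimately show ?thesis unfolding \<Psi>_def by blast
  qed
  then have "h' ` simple_extension L x \<subseteq> Qp_bar" unfolding img using h' by auto
  moreover have "h' \<in> ring_hom (C \<lparr> carrier := simple_extension L x \<rparr>) C"
  proof (rule ring_hom_memI)
    fix y z assume "y \<in> carrier (C \<lparr> carrier := simple_extension L x \<rparr>)"
      "z \<in> carrier (C \<lparr> carrier := simple_extension L x \<rparr>)"
    then obtain a b where ab: "a \<in> carrier (L[X])" "b \<in> carrier (L[X])" "y = eval a x" "z = eval b x"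
      unfolding img by auto
    have "eval (a \<otimes>\<^bsub>L[X]\<^esub> b) x = y \<otimes> z" "eval (a \<oplus>\<^bsub>L[X]\<^esub> b) x = y \<oplus> z"
      using ab E.hom_mult E.hom_add by simp_all
    then have "h' (y \<otimes> z) = \<Psi> a \<otimes> \<Psi> b" "h' (y \<oplus> z) = \<Psi> a \<oplus> \<Psi> b"
      using h'[OF P.m_closed[OF ab(1,2)]] h'[OF P.a_closed[OF ab(1,2)]] \<Psi>_mult[OF ab(1,2)] \<Psi>_add[OF ab(1,2)]
      by simp_all
    moreover have "h' y = \<Psi> a" "h' z = \<Psi> b" using h' ab by auto
    ultimately show "h' (y \<otimes>\<^bsub>C \<lparr> carrier := simple_extension L x \<rparr>\<^esub> z) = h' y \<otimes> h' z"
        "h' (y \<oplus>\<^bsub>C \<lparr> carrier := simple_extension L x \<rparr>\<^esub> z) = h' y \<oplus> h' z"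
      by simp_all
  next
    fix y assume "y \<in> carrier (C \<lparr> carrier := simple_extension L x \<rparr>)"
    then obtain a where a: "a \<in> carrier (L[X])" "y = eval a x" unfolding img by auto
    show "h' y \<in> carrier C" unfolding a(2) h'[OF a(1)] by (rule \<Psi>_carr[OF a(1)])
  next
    have "h' \<one> = \<one>" using h'_L[OF one(1)] embeddingD(3)[OF h] by (rule trans)
    then show "h' \<one>\<^bsub>C \<lparr> carrier := simple_extension L x \<rparr>\<^esub> = \<one>" by simp
  qed
  ultimately have "embedding (simple_extension L x) h'"
    unfolding embedding_def using intermediate_simple_extension(1)[OF int x] by blast
  moreover have "h' x = x'" using h'[OF X(1)] X by simp
  ultimately show ?thesis using that h'_L by blast
qed

lemma embedding_root_exists:
  assumes h: "embedding L h" and x: "x \<in> Qp_bar"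
  obtains x' where "x' \<in> Qp_bar" "eval (map h (Irr L x)) x' = \<zero>"
proof -
  have int: "intermediate L" using h unfolding embedding_def by blast
  note Irr = Irr_polyfun[OF int x]
  let ?q = "map h (Irr L x)"
  have "x \<in> carrier C" using x Qp_bar_carrier by auto
  then have "hd (Irr L x) = \<one>"
    using IrrE(3)[OF intermediateD(1)[OF int] _ algebraic_over_intermediate[OF int x]] by blast
  moreover have "Irr L x \<noteq> []" using Irr(3) by auto
  ultimately have "hd ?q = \<one>" using embeddingD(3)[OF h] by (simp add: list.map_sel(1))
  moreover have "set (Irr L x) \<subseteq> L" using Irr(4) polynomial_incl univ_poly_carrier by blast
  then have "set ?q \<subseteq> Qp_bar" using embeddingD(4)[OF h] by auto
  ultimately have "polyfun Qp_bar (Suc (degree (Irr L x) - 1)) \<one> (eval ?q)"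
    unfolding polyfun_def using Irr(3) by (intro exI[of _ ?q] conjI) simp_all
  from polyfun_exists_root[OF this one_not_zero] show ?thesis using that by blast
qed

lemma embedding_id:
  assumes "intermediate K" shows "embedding K (\<lambda>x. x)"
  using intermediateD(3,5)[OF assms] assms unfolding embedding_def ring_hom_def by auto

text \<open>Graphs of embeddings, described by closure conditions that survive unions of chains.\<close>

definition embedding_graph :: "'a set \<Rightarrow> ('a \<times> 'a) set \<Rightarrow> bool"
  where "embedding_graph K \<phi> \<longleftrightarrow> \<phi> \<subseteq> Qp_bar \<times> Qp_bar \<and> single_valued \<phi> \<and> Id_on K \<subseteq> \<phi> \<and>
    (\<forall>a a' b b'. (a, a') \<in> \<phi> \<longrightarrow> (b, b') \<in> \<phi> \<longrightarrow> (a \<oplus> b, a' \<oplus> b') \<in> \<phi> \<and> (a \<otimes> b, a' \<otimes> b') \<in> \<phi>)"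

lemma embedding_graph_of_embedding:
  assumes h: "embedding L h" "K \<subseteq> L" "\<And>x. x \<in> K \<Longrightarrow> h x = x"
  shows "embedding_graph K ((\<lambda>x. (x, h x)) ` L)"
proof -
  have "intermediate L" using h(1) unfolding embedding_def by blast
  note L = intermediateD[OF this]
  show ?thesis
    unfolding embedding_graph_def
  proof (intro conjI allI impI)
    show "(\<lambda>x. (x, h x)) ` L \<subseteq> Qp_bar \<times> Qp_bar" using L embeddingD(4)[OF h(1)] by auto
    show "single_valued ((\<lambda>x. (x, h x)) ` L)" by (auto simp: single_valued_def)
    show "Id_on K \<subseteq> (\<lambda>x. (x, h x)) ` L" using h(2,3) by (force simp: Id_on_def)
    fix a a' b b' assume "(a, a') \<in> (\<lambda>x. (x, h x)) ` L" "(b, b') \<in> (\<lambda>x. (x, h x)) ` L"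
    then have ab: "a \<in> L" "b \<in> L" "a' = h a" "b' = h b" by auto
    then show "(a \<oplus> b, a' \<oplus> b') \<in> (\<lambda>x. (x, h x)) ` L" "(a \<otimes> b, a' \<otimes> b') \<in> (\<lambda>x. (x, h x)) ` L"
      using subringE(6,7)[OF L(2) ab(1,2)] embeddingD(1,2)[OF h(1) ab(1,2)] by (auto intro!: image_eqI)
  qed
qed

lemma embedding_of_embedding_graph:
  assumes K: "intermediate K" and \<phi>: "embedding_graph K \<phi>"
  obtains h where "embedding (Domain \<phi>) h" "\<phi> = (\<lambda>x. (x, h x)) ` Domain \<phi>"
    "\<And>x. x \<in> K \<Longrightarrow> h x = x" "K \<subseteq> Domain \<phi>"
proof -
  define h where "h x = (THE y. (x, y) \<in> \<phi>)" for x
  have sv: "y = z" if "(x, y) \<in> \<phi>" "(x, z) \<in> \<phi>" for x y z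
    using that \<phi> unfolding embedding_graph_def single_valued_def by blast
  have h_eq: "h x = y" if "(x, y) \<in> \<phi>" for x y
    unfolding h_def using that sv by blast
  have h_mem: "(x, h x) \<in> \<phi>" if "x \<in> Domain \<phi>" for x
    using that h_eq by auto
  have sub: "\<phi> \<subseteq> Qp_bar \<times> Qp_bar" "Id_on K \<subseteq> \<phi>" using \<phi> unfolding embedding_graph_def by auto
  have h_K: "h x = x" if "x \<in> K" for x using that sub(2) h_eq by (auto simp: Id_on_def)
  have KD: "K \<subseteq> Domain \<phi>" using sub(2) by (auto simp: Id_on_def)
  have cl: "(x \<oplus> y, h x \<oplus> h y) \<in> \<phi>" "(x \<otimes> y, h x \<otimes> h y) \<in> \<phi>"
    if "x \<in> Domain \<phi>" "y \<in> Domain \<phi>" for x y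
    using h_mem[OF that(1)] h_mem[OF that(2)] \<phi> unfolding embedding_graph_def by blast+
  note K' = intermediateD[OF K]
  have DQ: "Domain \<phi> \<subseteq> Qp_bar" using sub(1) by auto
  have "subring (Domain \<phi>) C"
  proof (rule subringI)
    show "Domain \<phi> \<subseteq> carrier C" using DQ Qp_bar_carrier by auto
    show one: "\<one> \<in> Domain \<phi>" using subringE(3)[OF K'(2)] KD by auto
    show "x \<otimes> y \<in> Domain \<phi>" "x \<oplus> y \<in> Domain \<phi>" if "x \<in> Domain \<phi>" "y \<in> Domain \<phi>" for x y
      using cl that by blast+
    fix x assume x: "x \<in> Domain \<phi>"
    have "\<ominus> \<one> \<in> Domain \<phi>" using subringE(3,5)[OF K'(2)] KD by auto
    then have "\<ominus> \<one> \<otimes> x \<in> Domain \<phi>" using cl(2)[OF _ x] by blast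
    moreover have "x \<in> carrier C" using x DQ Qp_bar_carrier by auto
    ultimately show "\<ominus> x \<in> Domain \<phi>" by (simp add: l_minus)
  qed
  then have "intermediate (Domain \<phi>)" using intermediate_subring[OF K _ KD DQ] by blast
  moreover have "h x \<in> Qp_bar" if "x \<in> Domain \<phi>" for x using h_mem[OF that] sub(1) by auto
  moreover have "h \<in> ring_hom (C \<lparr> carrier := Domain \<phi> \<rparr>) C"
  proof (rule ring_hom_memI)
    show "h x \<in> carrier C" if "x \<in> carrier (C \<lparr> carrier := Domain \<phi> \<rparr>)" for x
      using h_mem[of x] that sub(1) Qp_bar_carrier by auto
  qed (use cl[THEN h_eq] h_K[OF subringE(3)[OF K'(2)]] in simp_all)
  ultimately have "embedding (Domain \<phi>) h" unfolding embedding_def by auto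
  moreover have "\<phi> = (\<lambda>x. (x, h x)) ` Domain \<phi>" using h_mem h_eq by (auto intro!: image_eqI)
  ultimately show ?thesis using that h_K KD by blast
qed

lemma abs_GaloisI:
  assumes K: "intermediate K" and h: "embedding Qp_bar h" and fix_K: "\<And>x. x \<in> K \<Longrightarrow> h x = x"
  shows "h \<in> abs_Galois K"
proof -
  have surj: "y \<in> h ` Qp_bar" if y: "y \<in> Qp_bar" for y
  proof -
    note Irr = Irr_polyfun[OF K y]
    define S where "S = {x \<in> Qp_bar. eval (Irr K y) x = \<zero>}"
    have "polyfun Qp_bar (degree (Irr K y)) \<one> (eval (Irr K y))"
      using polyfun_mono[OF Irr(1) intermediateD(5)[OF K]] .
    then have fin: "finite S"
      using polyfun_roots[OF subfieldE(1)[OF subfield_Qp_bar]] one_not_zero unfolding S_def by blast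
    have "h ` S \<subseteq> S"
    proof
      fix z assume "z \<in> h ` S"
      then obtain x where x: "x \<in> Qp_bar" "eval (Irr K y) x = \<zero>" "z = h x" unfolding S_def by auto
      interpret H: ring_hom_ring "C \<lparr> carrier := Qp_bar \<rparr>" C h by (rule embedding_ring_hom_ring[OF h])
      have s: "set (Irr K y) \<subseteq> K" using Irr(4) polynomial_incl univ_poly_carrier by blast
      then have "map h (Irr K y) = Irr K y" using fix_K by (auto intro: map_idI)
      moreover have "h (eval (Irr K y) x) = eval (map h (Irr K y)) (h x)"
        using H.eval_hom'[of x "Irr K y"] x(1) s intermediateD(5)[OF K]
          eval_consistent[OF subfieldE(1)[OF subfield_Qp_bar]] by auto
      ultimately have "eval (Irr K y) (h x) = h \<zero>" using x(2) by (metis (full_types))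
      then have "eval (Irr K y) z = \<zero>" using x(3) embedding_zero[OF h] by simp
      then show "z \<in> S" using embeddingD(4)[OF h x(1)] x(3) unfolding S_def by blast
    qed
    moreover have "inj_on h S" by (rule inj_on_subset[OF embedding_inj[OF h]]) (auto simp: S_def)
    ultimately have "h ` S = S" using fin by (simp add: endo_inj_surj)
    then show ?thesis using y Irr(2) unfolding S_def by blast
  qed
  have "h \<in> ring_iso Qp_bar_field Qp_bar_field"
    unfolding Qp_bar_field_def
    by (rule ring_iso_memI)
      (use embeddingD[OF h] surj embedding_inj[OF h] in \<open>auto simp: bij_betw_def\<close>)
  then show ?thesis unfolding abs_Galois_def using fix_K by auto
qed

theorem abs_Galois_conjugate:
  assumes K: "intermediate K" and x: "x \<in> Qp_bar" and x': "x' \<in> Qp_bar"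
    and root: "eval (Irr K x) x' = \<zero>"
  obtains g where "g \<in> abs_Galois K" "g x = x'"
proof -
  have "map (\<lambda>x. x) (Irr K x) = Irr K x" by simp
  then obtain h0 where h0: "embedding (simple_extension K x) h0" "h0 x = x'" "\<And>y. y \<in> K \<Longrightarrow> h0 y = y"
    using embedding_extend[OF embedding_id[OF K] x x'] root by metis
  note KS = intermediate_simple_extension[OF K x]
  define \<phi>0 where "\<phi>0 = (\<lambda>y. (y, h0 y)) ` simple_extension K x"
  define \<A> where "\<A> = {\<phi>. embedding_graph K \<phi> \<and> \<phi>0 \<subseteq> \<phi>}"
  have "\<phi>0 \<in> \<A>"
    unfolding \<A>_def \<phi>0_def using embedding_graph_of_embedding[OF h0(1) KS(2) h0(3)] by auto
  moreover have "\<Union>\<C> \<in> \<A>" if ne: "\<C> \<noteq> {}" and chain: "subset.chain \<A> \<C>" for \<C>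
  proof -
    have mem: "embedding_graph K \<phi>" "\<phi>0 \<subseteq> \<phi>" if "\<phi> \<in> \<C>" for \<phi>
      using that chain unfolding \<A>_def subset.chain_def by auto
    have two: "\<exists>\<phi> \<in> \<C>. a \<in> \<phi> \<and> b \<in> \<phi>" if ab: "a \<in> \<Union>\<C>" "b \<in> \<Union>\<C>" for a b
    proof -
      obtain \<phi> \<psi> where "\<phi> \<in> \<C>" "\<psi> \<in> \<C>" "a \<in> \<phi>" "b \<in> \<psi>" using ab by blast
      moreover from this have "\<phi> \<subseteq> \<psi> \<or> \<psi> \<subseteq> \<phi>" using subset_chain_def[of \<A> \<C>] chain by simp
      ultimately show ?thesis by blast
    qed
    have "embedding_graph K (\<Union>\<C>)"
      unfolding embedding_graph_def
    proof (intro conjI allI impI)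
      show "\<Union>\<C> \<subseteq> Qp_bar \<times> Qp_bar" using mem(1) unfolding embedding_graph_def by blast
      show "Id_on K \<subseteq> \<Union>\<C>" using ne mem(1) unfolding embedding_graph_def by blast
      show "single_valued (\<Union>\<C>)"
        unfolding single_valued_def
      proof (intro allI impI)
        fix a b c assume "(a, b) \<in> \<Union>\<C>" "(a, c) \<in> \<Union>\<C>"
        then obtain \<phi> where "\<phi> \<in> \<C>" "(a, b) \<in> \<phi>" "(a, c) \<in> \<phi>" using two by blast
        then show "b = c" using mem(1) unfolding embedding_graph_def single_valued_def by blast
      qed
      fix a a' b b' assume "(a, a') \<in> \<Union>\<C>" "(b, b') \<in> \<Union>\<C>"
      then obtain \<phi> where "\<phi> \<in> \<C>" "(a, a') \<in> \<phi>" "(b, b') \<in> \<phi>" using two by blast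
      then show "(a \<oplus> b, a' \<oplus> b') \<in> \<Union>\<C>" "(a \<otimes> b, a' \<otimes> b') \<in> \<Union>\<C>"
        using mem(1) unfolding embedding_graph_def by blast+
    qed
    then show ?thesis unfolding \<A>_def using ne mem(2) by auto
  qed
  ultimately obtain M where M: "M \<in> \<A>" "\<And>\<phi>. \<phi> \<in> \<A> \<Longrightarrow> M \<subseteq> \<phi> \<Longrightarrow> \<phi> = M"
    using subset_Zorn_nonempty[of \<A>] by blast
  then have M': "embedding_graph K M" "\<phi>0 \<subseteq> M" unfolding \<A>_def by auto
  obtain h where h: "embedding (Domain M) h" "M = (\<lambda>x. (x, h x)) ` Domain M"
    "\<And>x. x \<in> K \<Longrightarrow> h x = x" "K \<subseteq> Domain M"
    using embedding_of_embedding_graph[OF K M'(1)] by blast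
  have "Qp_bar \<subseteq> Domain M"
  proof
    fix y assume y: "y \<in> Qp_bar"
    obtain y' where "y' \<in> Qp_bar" "eval (map h (Irr (Domain M) y)) y' = \<zero>"
      using embedding_root_exists[OF h(1) y] by blast
    then obtain h' where h': "embedding (simple_extension (Domain M) y) h'"
      "\<And>z. z \<in> Domain M \<Longrightarrow> h' z = h z"
      using embedding_extend[OF h(1) y] by metis
    have int: "intermediate (Domain M)" using h(1) unfolding embedding_def by blast
    note DS = intermediate_simple_extension[OF int y]
    let ?\<psi> = "(\<lambda>z. (z, h' z)) ` simple_extension (Domain M) y"
    have "h' z = z" if z: "z \<in> K" for z
      using h'(2)[OF subsetD[OF h(4) z]] h(3)[OF z] by (rule trans)
    then have "embedding_graph K ?\<psi>"
      by (rule embedding_graph_of_embedding[OF h'(1) subset_trans[OF h(4) DS(2)]])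
    moreover have "M \<subseteq> ?\<psi>"
    proof
      fix w assume "w \<in> M"
      then obtain z where z: "z \<in> Domain M" "w = (z, h z)" using h(2) by blast
      then have "w = (z, h' z)" using h'(2) by simp
      then show "w \<in> ?\<psi>" using z(1) DS(2) by blast
    qed
    ultimately have "?\<psi> \<in> \<A>" "M \<subseteq> ?\<psi>" using M'(2) unfolding \<A>_def by auto
    then have "?\<psi> = M" by (rule M(2))
    moreover have "(y, h' y) \<in> ?\<psi>" using DS(3) by auto
    ultimately show "y \<in> Domain M" by auto
  qed
  moreover have "intermediate (Domain M)" using h(1) unfolding embedding_def by blast
  then have "Domain M \<subseteq> Qp_bar" by (rule intermediateD(5))
  ultimately have "Domain M = Qp_bar" by (rule subset_antisym[rotated])
  then have "embedding Qp_bar h" using h(1) by (simp only:)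
  then have "h \<in> abs_Galois K" by (rule abs_GaloisI[OF K _ h(3)])
  moreover have "h x = x'"
  proof -
    have "(x, x') \<in> M" using M'(2) KS(3) h0(2) unfolding \<phi>0_def by auto
    then have "(x, x') \<in> (\<lambda>x. (x, h x)) ` Domain M" by (rule subsetD[OF equalityD1[OF h(2)]])
    then show ?thesis by blast
  qed
  ultimately show ?thesis by (rule that)
qed

abbreviation of_nat_C :: "nat \<Rightarrow> 'a" (\<open>\<iota>\<close>)
  where "\<iota> n \<equiv> add_pow C n \<one>"

lemma nat_carrier: "\<iota> n \<in> carrier C"
  by simp

lemma nat_zero: "\<iota> 0 = \<zero>" by simp

lemma nat_add: "\<iota> (m + n) = \<iota> m \<oplus> \<iota> n"
  using add.nat_pow_mult[of \<one> m n] by (simp add: add_pow_def)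

lemma nat_mult: "\<iota> (m * n) = \<iota> m \<otimes> \<iota> n"
  by (metis add_pow_ldistr add.nat_pow_pow l_one nat_carrier one_closed mult.commute add_pow_def)

lemma nat_power: "\<iota> (m ^ n) = (\<iota> m) [^] n"
  by (induction n) (simp_all add: nat_mult m_comm)

lemma v_nat_le: "v (\<iota> n) \<le> 1"
proof (induction n)
  case (Suc n)
  then show ?case using nat_add[of n 1] v_add_le[of "\<iota> n" \<one> 1] by (simp add: v_one)
qed simp

lemma p_gt_1: "1 < p" using prime_p prime_gt_1_nat by blast

lemma v_nat_unit:
  assumes "\<not> p dvd n"
  shows "v (\<iota> n) = 1"
proof (rule ccontr)
  assume "v (\<iota> n) \<noteq> 1"
  then have lt: "v (\<iota> n) < 1" using v_nat_le[of n] by linarith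
  have "coprime p n" using assms prime_p by (simp add: prime_imp_coprime)
  moreover have "n \<noteq> 0" using assms by (metis dvd_0_right)
  ultimately obtain a b where ab: "n * a = p * b + 1"
    using bezout_nat[of n p] by (auto simp: coprime_iff_gcd_eq_1 gcd.commute)
  have "\<one> = \<iota> n \<otimes> \<iota> a \<ominus> \<iota> p \<otimes> \<iota> b"
  proof -
    have "\<iota> n \<otimes> \<iota> a = \<iota> p \<otimes> \<iota> b \<oplus> \<one>"
      using arg_cong[OF ab, of "\<lambda>k. \<iota> k"] nat_add[of "p * b" 1] by (simp add: nat_mult)
    moreover have "\<iota> p \<otimes> \<iota> b \<in> carrier C" by simp
    ultimately show ?thesis by algebra
  qed
  moreover have "v (\<iota> n \<otimes> \<iota> a \<ominus> \<iota> p \<otimes> \<iota> b) < 1"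
  proof (rule v_minus_less)
    have *: "x * y < 1" if "x < 1" "y \<le> 1" "0 \<le> x" "0 \<le> y" for x y :: real
      using that by (metis le_less_trans mult_left_le)
    show "v (\<iota> n \<otimes> \<iota> a) < 1"
      using lt v_nat_le[of a] v_nonneg by (simp add: v_mult *)
    show "v (\<iota> p \<otimes> \<iota> b) < 1"
      using v_p v_nat_le[of b] v_nonneg p_gt_1 by (simp add: v_mult *)
  qed simp_all
  ultimately show False using v_one by simp
qed

lemma v_nat:
  assumes "0 < n"
  shows "v (\<iota> n) = (1 / real p) ^ multiplicity p n"
proof -
  obtain m where m: "n = p ^ multiplicity p n * m" "\<not> p dvd m"
    using multiplicity_decompose'[of n p] assms p_gt_1 by auto
  have "v (\<iota> n) = v ((\<iota> p) [^] multiplicity p n \<otimes> \<iota> m)"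
    using m(1) nat_mult nat_power by metis
  then show ?thesis using v_nat_unit[OF m(2)] v_p by (simp add: v_mult v_pow)
qed

lemma nat_nonzero: "0 < n \<Longrightarrow> \<iota> n \<noteq> \<zero>"
  using v_nat[of n] p_gt_1 by auto

lemma subring_nat_mem:
  assumes "subring K C" shows "\<iota> n \<in> K"
proof (induction n)
  case 0
  then show ?case using subringE(2)[OF assms] by simp
next
  case (Suc n)
  then show ?case using subringE(3,7)[OF assms] nat_add[of n 1] by simp
qed

lemma intermediate_Qp_bar: "intermediate Qp_bar"
proof -
  have "Qp \<subseteq> Qp_bar"
    unfolding Qp_bar_def
    using subfieldE(3)[OF subfield_Qp] algebraic_self[OF subfieldE(1)[OF subfield_Qp]]
    by (auto simp: over_def)
  then show ?thesis unfolding intermediate_def using subfield_Qp_bar by auto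
qed

lemma infinite_Qp_bar: "infinite Qp_bar"
proof -
  have "inj (\<lambda>n::nat. \<iota> n)"
  proof (rule linorder_injI)
    fix m n :: nat assume "m < n"
    show "\<iota> m \<noteq> \<iota> n"
    proof
      assume "\<iota> m = \<iota> n"
      then have "\<iota> m \<oplus> \<iota> (n - m) = \<iota> m \<oplus> \<zero>"
        using nat_add[of m "n - m"] \<open>m < n\<close> by simp
      then have "\<iota> (n - m) = \<zero>" by (simp only: add.l_cancel nat_carrier zero_closed)
      then show False using nat_nonzero \<open>m < n\<close> by simp
    qed
  qed
  then have "infinite (range (\<lambda>n::nat. \<iota> n))" using finite_imageD infinite_UNIV_nat by blast
  moreover have "range (\<lambda>n::nat. \<iota> n) \<subseteq> Qp_bar"
    using subring_nat_mem subfieldE(1)[OF subfield_Qp_bar] by auto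
  ultimately show ?thesis using finite_subset by blast
qed

lemma degree_Irr_le:
  assumes K: "intermediate K" and x: "x \<in> Qp_bar"
    and f: "polyfun K n c f" "c \<noteq> \<zero>" "f x = \<zero>"
  shows "degree (Irr K x) \<le> n"
proof -
  note K' = intermediateD[OF K]
  have xc: "x \<in> carrier C" using x Qp_bar_carrier by auto
  obtain q where q: "set q \<subseteq> K" "length q = Suc n" "hd q = c" "\<forall>x \<in> carrier C. f x = eval q x"
    using f(1) unfolding polyfun_def by blast
  have q_in: "q \<in> carrier (K[X])" "q \<noteq> []"
    using q f(2) by (auto simp: univ_poly_carrier[symmetric] polynomial_def)
  have "eval q x = \<zero>" using q(4) xc f(3) by simp
  then have "Irr K x pdivides q"
    using Irr_minimal[OF K'(1) xc algebraic_over_intermediate[OF K x] q_in(1)] by blast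
  then have "degree (Irr K x) \<le> degree q"
    using pdivides_imp_degree_le[OF K'(2) Irr_polyfun(4)[OF K x] q_in] by blast
  then show ?thesis using q(2) by simp
qed

lemma eval_closed_subring:
  assumes "subring L C" "set q \<subseteq> L" "x \<in> L"
  shows "eval q x \<in> L"
  using assms(2)
proof (induction q)
  case Nil
  then show ?case using subringE(2)[OF assms(1)] by simp
next
  case (Cons a q)
  have pow: "x [^] n \<in> L" for n :: nat
    by (induction n) (use assms(3) subringE(3,6)[OF assms(1)] in auto)
  show ?case
    using Cons pow[of "length q"] subringE(6,7)[OF assms(1)] by auto
qed

lemma polyfun_derivative:
  assumes "subring K C" "polyfun K (Suc n) c f"
  obtains f' where "polyfun K n ([Suc n] \<cdot> c) f'"
    "\<And>L z. \<lbrakk>subring L C; K \<subseteq> L; z \<in> L\<rbrakk> \<Longrightarrow>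
      \<exists>h. polyfun L n c h \<and> (\<forall>y \<in> carrier C. f y = h y \<otimes> (y \<ominus> z) \<oplus> f z) \<and> h z = f' z"
proof -
  note K = subringE(1)[OF assms(1)]
  have "\<exists>f'. polyfun K n ([Suc n] \<cdot> c) f' \<and> (\<forall>L z. subring L C \<longrightarrow> K \<subseteq> L \<longrightarrow> z \<in> L \<longrightarrow>
      (\<exists>h. polyfun L n c h \<and> (\<forall>y \<in> carrier C. f y = h y \<otimes> (y \<ominus> z) \<oplus> f z) \<and> h z = f' z))"
    using assms(2)
  proof (induction n arbitrary: f)
    case 0
    obtain g a where g: "polyfun K 0 c g" "a \<in> K" "\<And>x. x \<in> carrier C \<Longrightarrow> f x = g x \<otimes> x \<oplus> a"
      by (rule polyfun_SucE[OF 0 K]) blast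
    note g0 = polyfun_zero_degree[OF g(1) K]
    have carr: "c \<in> carrier C" "a \<in> carrier C" using g0(1) g(2) K by auto
    have "polyfun K 0 ([Suc 0] \<cdot> c) (\<lambda>_. c)" using polyfun_const[OF g0(1) K] carr by simp
    moreover have "polyfun L 0 c (\<lambda>_. c) \<and> (\<forall>y \<in> carrier C. f y = c \<otimes> (y \<ominus> z) \<oplus> f z)"
      if L: "subring L C" "K \<subseteq> L" "z \<in> L" for L z
    proof -
      have z: "z \<in> carrier C" using L subringE(1)[OF L(1)] by auto
      have "f y = c \<otimes> (y \<ominus> z) \<oplus> f z" if "y \<in> carrier C" for y
        unfolding g(3)[OF that] g(3)[OF z] g0(2)[OF that] g0(2)[OF z] using carr z that by algebra
      moreover have "polyfun L 0 c (\<lambda>_. c)"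
        using polyfun_const g0(1) L(2) subringE(1)[OF L(1)] by blast
      ultimately show ?thesis by blast
    qed
    ultimately show ?case by (intro exI[of _ "\<lambda>_. c"]) blast
  next
    case (Suc n)
    obtain g a where g: "polyfun K (Suc n) c g" "a \<in> K" "\<And>x. x \<in> carrier C \<Longrightarrow> f x = g x \<otimes> x \<oplus> a"
      by (rule polyfun_SucE[OF Suc(2) K]) blast
    obtain g' where g': "polyfun K n ([Suc n] \<cdot> c) g'"
      "\<And>L z. \<lbrakk>subring L C; K \<subseteq> L; z \<in> L\<rbrakk> \<Longrightarrow>
        \<exists>h. polyfun L n c h \<and> (\<forall>y \<in> carrier C. g y = h y \<otimes> (y \<ominus> z) \<oplus> g z) \<and> h z = g' z"
      using Suc.IH[OF g(1)] by blast
    define f' where "f' y = (g' y \<otimes> y \<oplus> \<zero>) \<oplus> g y" for y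
    have c: "c \<in> carrier C" using polyfun_lead[OF g(1)] K by auto
    have "polyfun K (Suc n) ([Suc n] \<cdot> c \<oplus> c) f'"
      unfolding f'_def
      by (intro polyfun_add assms(1) polyfun_Suc g'(1) g(1) K subringE(2)[OF assms(1)])
    moreover have "[Suc n] \<cdot> c \<oplus> c = [Suc (Suc n)] \<cdot> c" by simp
    moreover have "\<exists>h. polyfun L (Suc n) c h \<and> (\<forall>y \<in> carrier C. f y = h y \<otimes> (y \<ominus> z) \<oplus> f z) \<and> h z = f' z"
      if L: "subring L C" "K \<subseteq> L" "z \<in> L" for L z
    proof -
      note LC = subringE(1)[OF L(1)]
      have z: "z \<in> carrier C" and a: "a \<in> carrier C" using L LC g(2) by auto
      obtain h where h: "polyfun L n c h" "\<And>y. y \<in> carrier C \<Longrightarrow> g y = h y \<otimes> (y \<ominus> z) \<oplus> g z" "h z = g' z"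
        using g'(2)[OF L] by blast
      have gz: "g z \<in> L"
      proof -
        obtain k where k: "polyfun L n c k" "\<And>x. x \<in> carrier C \<Longrightarrow> g x = k x \<otimes> (x \<ominus> z) \<oplus> g z"
          by (rule polyfun_divide_linear[OF L(1) polyfun_mono[OF g(1) L(2)] L(3)]) blast
        obtain q where q: "set q \<subseteq> L" "\<forall>x \<in> carrier C. g x = eval q x"
          using polyfun_mono[OF g(1) L(2)] unfolding polyfun_def by blast
        have "eval q z \<in> L" using eval_closed_subring[OF L(1) q(1) L(3)] .
        then show ?thesis using q(2) z by simp
      qed
      have "polyfun L (Suc n) c (\<lambda>y. h y \<otimes> y \<oplus> g z)"
        by (rule polyfun_Suc[OF h(1) gz LC])
      moreover have "f y = (h y \<otimes> y \<oplus> g z) \<otimes> (y \<ominus> z) \<oplus> f z" if y: "y \<in> carrier C" for y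
      proof -
        have hy: "h y \<in> carrier C" using polyfun_closed[OF h(1) LC y] .
        have gzc: "g z \<in> carrier C" using gz LC by auto
        have "f y = (h y \<otimes> (y \<ominus> z) \<oplus> g z) \<otimes> y \<oplus> a" using g(3)[OF y] h(2)[OF y] by simp
        also have "\<dots> = (h y \<otimes> y \<oplus> g z) \<otimes> (y \<ominus> z) \<oplus> (g z \<otimes> z \<oplus> a)"
          using hy gzc y z a by algebra
        finally show ?thesis using g(3)[OF z] by simp
      qed
      moreover have "h z \<otimes> z \<oplus> g z = f' z"
        using polyfun_closed[OF g'(1) K z] z unfolding f'_def h(3) by simp
      ultimately show ?thesis by (intro exI[of _ "\<lambda>y. h y \<otimes> y \<oplus> g z"]) blast
    qed
    ultimately show ?case by (intro exI[of _ f']) auto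
  qed
  then show ?thesis using that by blast
qed

text \<open>In characteristic zero the derivative of a minimal polynomial is a nonzero polynomial of smaller
  degree, so a minimal polynomial with a single root is linear.\<close>

theorem fixed_by_abs_Galois:
  assumes K: "intermediate K" and x: "x \<in> Qp_bar" and fixed: "\<And>g. g \<in> abs_Galois K \<Longrightarrow> g x = x"
  shows "x \<in> K"
proof -
  note K' = intermediateD[OF K] and Irr = Irr_polyfun[OF K x]
  note Q = subfieldE(1)[OF subfield_Qp_bar]
  have xc: "x \<in> carrier C" using x Qp_bar_carrier by auto
  have root: "y = x" if "y \<in> Qp_bar" "eval (Irr K x) y = \<zero>" for y
    using abs_Galois_conjugate[OF K x that] fixed by metis
  obtain n where n: "degree (Irr K x) = Suc n" using Irr(3) by (cases "degree (Irr K x)") auto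
  define f where "f = eval (Irr K x)"
  have f: "polyfun K (Suc n) \<one> f" "f x = \<zero>" using Irr(1,2) n unfolding f_def by auto
  show ?thesis
  proof (cases n)
    case 0
    obtain g a where g: "polyfun K 0 \<one> g" "a \<in> K" "\<And>x. x \<in> carrier C \<Longrightarrow> f x = g x \<otimes> x \<oplus> a"
      by (rule polyfun_SucE[OF f(1)[unfolded 0] K'(3)]) blast
    have "x \<oplus> a = \<zero>" using g(3)[OF xc] f(2) polyfun_zero_degree[OF g(1) K'(3)] xc by simp
    moreover have "a \<in> carrier C" using g(2) K'(3) by auto
    ultimately have "x = \<ominus> a" using xc by (metis minus_equality)
    then show ?thesis using subringE(5)[OF K'(2) g(2)] by simp
  next
    case (Suc m)
    obtain f' where f': "polyfun K n (\<iota> (Suc n)) f'"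
      "\<And>L z. \<lbrakk>subring L C; K \<subseteq> L; z \<in> L\<rbrakk> \<Longrightarrow>
        \<exists>h. polyfun L n \<one> h \<and> (\<forall>y \<in> carrier C. f y = h y \<otimes> (y \<ominus> z) \<oplus> f z) \<and> h z = f' z"
      using polyfun_derivative[OF K'(2) f(1)] by blast
    obtain h where h: "polyfun Qp_bar n \<one> h" "\<forall>y \<in> carrier C. f y = h y \<otimes> (y \<ominus> x) \<oplus> f x" "h x = f' x"
      using f'(2)[OF Q K'(5) x] by blast
    obtain b where b: "b \<in> Qp_bar" "h b = \<zero>"
      using polyfun_exists_root[of m \<one> h] h(1) one_not_zero unfolding Suc by blast
    then have "b \<in> carrier C" using Qp_bar_carrier by auto
    then have "f b = \<zero>" using h(2) b(2) f(2) xc by simp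
    then have "b = x" using root b(1) unfolding f_def by blast
    then have "f' x = \<zero>" using h(3) b(2) by simp
    have "degree (Irr K x) \<le> n"
      by (rule degree_Irr_le[OF K x f'(1) nat_nonzero[OF zero_less_Suc] \<open>f' x = \<zero>\<close>])
    then show ?thesis using n by simp
  qed
qed

lemma abs_Galois_embedding:
  assumes "g \<in> abs_Galois K" shows "embedding Qp_bar g"
proof -
  have "g \<in> ring_iso Qp_bar_field Qp_bar_field" using assms unfolding abs_Galois_def by auto
  then have "g \<in> ring_hom (C \<lparr> carrier := Qp_bar \<rparr>) C" "g ` Qp_bar \<subseteq> Qp_bar"
    using Qp_bar_carrier unfolding ring_iso_def ring_hom_def Qp_bar_field_def by auto
  then show ?thesis unfolding embedding_def using intermediate_Qp_bar by auto
qed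

lemma abs_Galois_bij:
  assumes "g \<in> abs_Galois K" shows "bij_betw g Qp_bar Qp_bar"
  using assms unfolding abs_Galois_def ring_iso_def Qp_bar_field_def by auto

lemma abs_Galois_fixes: "\<lbrakk>g \<in> abs_Galois K; x \<in> K\<rbrakk> \<Longrightarrow> g x = x"
  unfolding abs_Galois_def by auto

lemma abs_Galois_closed: "\<lbrakk>g \<in> abs_Galois K; x \<in> Qp_bar\<rbrakk> \<Longrightarrow> g x \<in> Qp_bar"
  using embeddingD(4)[OF abs_Galois_embedding] .

lemma abs_Galois_inj: "\<lbrakk>g \<in> abs_Galois K; x \<in> Qp_bar; y \<in> Qp_bar; g x = g y\<rbrakk> \<Longrightarrow> x = y"
  using abs_Galois_bij[of g K] by (auto simp: bij_betw_def inj_on_def)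

lemma abs_Galois_comp:
  assumes "g \<in> abs_Galois K" "h \<in> abs_Galois K" shows "g \<circ> h \<in> abs_Galois K"
  using assms ring_iso_set_trans unfolding abs_Galois_def by auto

lemma abs_Galois_id: "(\<lambda>x. x) \<in> abs_Galois K"
  unfolding abs_Galois_def ring_iso_def ring_hom_def by (auto simp: bij_betw_def)

lemma ring_Qp_bar_field: "ring Qp_bar_field"
  unfolding Qp_bar_field_def using subring_is_ring[OF subfieldE(1)[OF subfield_Qp_bar]] .

lemma abs_Galois_inv:
  assumes K: "K \<subseteq> Qp_bar" and g: "g \<in> abs_Galois K"
  obtains h where "h \<in> abs_Galois K" "\<And>x. x \<in> Qp_bar \<Longrightarrow> g (h x) = x" "\<And>x. x \<in> Qp_bar \<Longrightarrow> h (g x) = x"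
proof -
  let ?h = "inv_into Qp_bar g"
  have gi: "g \<in> ring_iso Qp_bar_field Qp_bar_field" using g unfolding abs_Galois_def by auto
  have hi: "?h \<in> ring_iso Qp_bar_field Qp_bar_field"
    using ring_iso_set_sym[OF ring_Qp_bar_field gi] by (simp add: Qp_bar_field_def)
  note bij = abs_Galois_bij[OF g]
  have gh: "g (?h x) = x" if "x \<in> Qp_bar" for x using bij that by (simp add: bij_betw_inv_into_right)
  have hg: "?h (g x) = x" if "x \<in> Qp_bar" for x using bij that by (simp add: bij_betw_inv_into_left)
  have "?h x = x" if "x \<in> K" for x using hg[of x] that K abs_Galois_fixes[OF g that] by auto
  then have "?h \<in> abs_Galois K" unfolding abs_Galois_def using hi by auto
  then show ?thesis using that gh hg by blast
qed

lemma abs_Galois_finsum: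
  assumes "g \<in> abs_Galois K" "finite I" "\<And>i. i \<in> I \<Longrightarrow> f i \<in> Qp_bar"
  shows "g (\<Oplus>i\<in>I. f i) = (\<Oplus>i\<in>I. g (f i)) \<and> (\<Oplus>i\<in>I. f i) \<in> Qp_bar"
  using assms(2,3)
proof (induction I)
  case empty
  then show ?case
    using embedding_zero[OF abs_Galois_embedding[OF assms(1)]] subringE(2)[OF subfieldE(1)[OF subfield_Qp_bar]]
    by simp
next
  case (insert i I)
  note E = abs_Galois_embedding[OF assms(1)]
  have f: "f j \<in> carrier C" "g (f j) \<in> carrier C" if "j \<in> insert i I" for j
    using insert(4)[OF that] Qp_bar_carrier embeddingD(5)[OF E] by auto
  have "(\<Oplus>i\<in>insert i I. f i) = f i \<oplus> (\<Oplus>i\<in>I. f i)"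
    "(\<Oplus>i\<in>insert i I. g (f i)) = g (f i) \<oplus> (\<Oplus>i\<in>I. g (f i))"
    using insert f by (auto intro!: finsum_insert)
  then show ?case
    using insert embeddingD(1)[OF E, of "f i" "\<Oplus>i\<in>I. f i"] subringE(7)[OF subfieldE(1)[OF subfield_Qp_bar]]
    by auto
qed

lemma abs_Galois_finprod:
  assumes "g \<in> abs_Galois K" "finite I" "\<And>i. i \<in> I \<Longrightarrow> f i \<in> Qp_bar"
  shows "g (\<Otimes>i\<in>I. f i) = (\<Otimes>i\<in>I. g (f i)) \<and> (\<Otimes>i\<in>I. f i) \<in> Qp_bar"
  using assms(2,3)
proof (induction I)
  case empty
  then show ?case
    using embeddingD(3)[OF abs_Galois_embedding[OF assms(1)]] subringE(3)[OF subfieldE(1)[OF subfield_Qp_bar]]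
    by simp
next
  case (insert i I)
  note E = abs_Galois_embedding[OF assms(1)]
  have f: "f j \<in> carrier C" "g (f j) \<in> carrier C" if "j \<in> insert i I" for j
    using insert(4)[OF that] Qp_bar_carrier embeddingD(5)[OF E] by auto
  have "(\<Otimes>i\<in>insert i I. f i) = f i \<otimes> (\<Otimes>i\<in>I. f i)"
    "(\<Otimes>i\<in>insert i I. g (f i)) = g (f i) \<otimes> (\<Otimes>i\<in>I. g (f i))"
    using insert f by (auto intro!: finprod_insert)
  then show ?case
    using insert embeddingD(2)[OF E, of "f i" "\<Otimes>i\<in>I. f i"] subringE(6)[OF subfieldE(1)[OF subfield_Qp_bar]]
    by auto
qed

lemma abs_Galois_minus_closed:
  assumes "g \<in> abs_Galois K" "x \<in> Qp_bar" "y \<in> Qp_bar"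
  shows "g (x \<ominus> y) = g x \<ominus> g y"
proof -
  note E = abs_Galois_embedding[OF assms(1)]
  have "\<ominus> y \<in> Qp_bar" using subringE(5)[OF subfieldE(1)[OF subfield_Qp_bar]] assms(3) by blast
  then show ?thesis using embeddingD(1)[OF E assms(2)] embedding_minus[OF E assms(3)] by (simp add: minus_eq)
qed

lemma Qp_bar_closed:
  assumes "x \<in> Qp_bar" "y \<in> Qp_bar"
  shows "x \<oplus> y \<in> Qp_bar" "x \<otimes> y \<in> Qp_bar" "\<ominus> x \<in> Qp_bar" "x \<ominus> y \<in> Qp_bar" "x [^] (n::nat) \<in> Qp_bar"
proof -
  note Q = subfieldE(1)[OF subfield_Qp_bar]
  show "x \<oplus> y \<in> Qp_bar" "x \<otimes> y \<in> Qp_bar" "\<ominus> x \<in> Qp_bar" using subringE(5,6,7)[OF Q] assms by auto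
  show "x \<ominus> y \<in> Qp_bar" using subringE(5,7)[OF Q] assms by (simp add: minus_eq)
  show "x [^] n \<in> Qp_bar" by (induction n) (use assms subringE(3,6)[OF Q] in auto)
qed

section \<open>Descent of polynomials\<close>

lemma polyfun_descend:
  assumes K: "intermediate K" and f: "polyfun Qp_bar n c f"
    and equiv: "\<And>g x. \<lbrakk>g \<in> abs_Galois K; x \<in> Qp_bar\<rbrakk> \<Longrightarrow> f (g x) = g (f x)"
  shows "polyfun K n c f"
proof -
  obtain q where q: "set q \<subseteq> Qp_bar" "length q = Suc n" "hd q = c" "\<forall>x \<in> carrier C. f x = eval q x"
    using f unfolding polyfun_def by blast
  have "a \<in> K" if a: "a \<in> set q" for a
  proof (rule fixed_by_abs_Galois[OF K])
    show "a \<in> Qp_bar" using a q(1) by auto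
    fix g assume g: "g \<in> abs_Galois K"
    note E = abs_Galois_embedding[OF g]
    interpret H: ring_hom_ring "C \<lparr> carrier := Qp_bar \<rparr>" C g by (rule embedding_ring_hom_ring[OF E])
    have "map g q = q"
    proof (rule eval_list_eqI[OF _ _ _ infinite_Qp_bar Qp_bar_carrier])
      show "set (map g q) \<subseteq> carrier C" "set q \<subseteq> carrier C" using q(1) Qp_bar_carrier embeddingD(5)[OF E] by auto
      fix y assume "y \<in> Qp_bar"
      then obtain x where x: "x \<in> Qp_bar" "y = g x" using abs_Galois_bij[OF g] by (auto simp: bij_betw_def)
      have "g (eval q x) = eval (map g q) (g x)"
        using H.eval_hom'[of x q] x(1) q(1) eval_consistent[OF subfieldE(1)[OF subfield_Qp_bar]] by simp
      moreover have "eval q x = f x" "eval q (g x) = f (g x)"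
        using q(4) x(1) Qp_bar_carrier embeddingD(5)[OF E] by auto
      ultimately show "eval (map g q) y = eval q y" using equiv[OF g x(1)] x(2) by simp
    qed simp
    then have "map g q = map (\<lambda>x. x) q" by simp
    then show "g a = a" using a by (simp only: map_eq_conv)
  qed
  then show ?thesis unfolding polyfun_def using q by blast
qed

lemma polyfun_symmetrize:
  assumes K: "intermediate K" and I: "finite I" "I \<noteq> {}"
    and w: "\<And>i. i \<in> I \<Longrightarrow> w i \<in> Qp_bar"
    and T: "\<And>i. i \<in> I \<Longrightarrow> finite (T i) \<and> card (T i) = n \<and> T i \<subseteq> Qp_bar"
    and perm: "\<And>g. g \<in> abs_Galois K \<Longrightarrow>
      \<exists>\<pi>. bij_betw \<pi> I I \<and> (\<forall>i \<in> I. g (w i) = w (\<pi> i) \<and> g ` T i = T (\<pi> i))"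
  shows "polyfun K n (\<Oplus>i\<in>I. w i) (\<lambda>x. \<Oplus>i\<in>I. w i \<otimes> (\<Otimes>b\<in>T i. x \<ominus> b))"
proof (rule polyfun_descend[OF K])
  note Q = subfieldE(1)[OF subfield_Qp_bar]
  show "polyfun Qp_bar n (\<Oplus>i\<in>I. w i) (\<lambda>x. \<Oplus>i\<in>I. w i \<otimes> (\<Otimes>b\<in>T i. x \<ominus> b))"
  proof (rule polyfun_finsum[OF Q I])
    fix i assume i: "i \<in> I"
    have "polyfun Qp_bar n \<one> (\<lambda>x. \<Otimes>b\<in>T i. x \<ominus> b)"
      using polyfun_prod_linear[OF Q, of "T i"] T[OF i] by auto
    moreover have "w i \<otimes> \<one> = w i" using w[OF i] Qp_bar_carrier by auto
    ultimately show "polyfun Qp_bar n (w i) (\<lambda>x. w i \<otimes> (\<Otimes>b\<in>T i. x \<ominus> b))"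
      using polyfun_smult[OF Q _ w[OF i]] by fastforce
  qed
  fix g x assume g: "g \<in> abs_Galois K" and x: "x \<in> Qp_bar"
  note E = abs_Galois_embedding[OF g]
  obtain \<pi> where \<pi>: "bij_betw \<pi> I I" "\<And>i. i \<in> I \<Longrightarrow> g (w i) = w (\<pi> i) \<and> g ` T i = T (\<pi> i)"
    using perm[OF g] by blast
  define F where "F y i = w i \<otimes> (\<Otimes>b\<in>T i. y \<ominus> b)" for y i
  have P: "g (\<Otimes>b\<in>T i. x \<ominus> b) = (\<Otimes>b\<in>T i. g (x \<ominus> b)) \<and> (\<Otimes>b\<in>T i. x \<ominus> b) \<in> Qp_bar" if "i \<in> I" for i
    using T[OF that] x by (intro abs_Galois_finprod[OF g]) (auto intro!: Qp_bar_closed)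
  have F: "F y i \<in> Qp_bar" if "y \<in> Qp_bar" "i \<in> I" for y i
  proof -
    have "(\<Otimes>b\<in>T i. y \<ominus> b) \<in> Qp_bar"
      using T[OF that(2)] that(1) abs_Galois_finprod[OF g, of "T i" "\<lambda>b. y \<ominus> b"] by (auto intro!: Qp_bar_closed)
    then show ?thesis unfolding F_def using w[OF that(2)] by (intro Qp_bar_closed)
  qed
  have step: "g (F x i) = F (g x) (\<pi> i)" if i: "i \<in> I" for i
  proof -
    have inj: "inj_on g (T i)"
      using abs_Galois_bij[OF g] T[OF i] by (meson bij_betw_def inj_on_subset)
    have gx: "g x \<in> carrier C" using embeddingD(5)[OF E x] .
    have "(\<Otimes>b\<in>T i. g (x \<ominus> b)) = (\<Otimes>b\<in>T i. g x \<ominus> g b)"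
      using T[OF i] x gx embeddingD(5)[OF E] abs_Galois_minus_closed[OF g x]
      by (intro finprod_cong') auto
    also have "\<dots> = (\<Otimes>b\<in>g ` T i. g x \<ominus> b)"
      using T[OF i] gx embeddingD(5)[OF E] inj by (intro finprod_reindex[symmetric]) auto
    finally show ?thesis
      unfolding F_def using embeddingD(2)[OF E w[OF i]] P[OF i] \<pi>(2)[OF i] by auto
  qed
  have "g (\<Oplus>i\<in>I. F x i) = (\<Oplus>i\<in>I. g (F x i))"
    using abs_Galois_finsum[OF g I(1)] F[OF x] by blast
  also have "\<dots> = (\<Oplus>i\<in>I. F (g x) (\<pi> i))"
    using step subsetD[OF Qp_bar_carrier F[OF embeddingD(4)[OF E x] bij_betwE[OF \<pi>(1), rule_format]]]
    by (intro finsum_cong') auto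
  also have "\<dots> = (\<Oplus>i\<in>\<pi> ` I. F (g x) i)"
    using F[OF embeddingD(4)[OF E x]] Qp_bar_carrier \<pi>(1)
    by (intro finsum_reindex[symmetric]) (auto simp: bij_betw_def)
  also have "\<pi> ` I = I" using \<pi>(1) by (simp add: bij_betw_def)
  finally show "(\<Oplus>i\<in>I. w i \<otimes> (\<Otimes>b\<in>T i. g x \<ominus> b)) = g (\<Oplus>i\<in>I. w i \<otimes> (\<Otimes>b\<in>T i. x \<ominus> b))"
    unfolding F_def by simp
qed

lemma polyfun_close_root:
  assumes "polyfun Qp_bar (Suc n) c f" "c \<noteq> \<zero>" "x \<in> carrier C" "0 < r" "v (f x) \<le> v c * r ^ Suc n"
  shows "\<exists>b \<in> Qp_bar. f b = \<zero> \<and> v (x \<ominus> b) \<le> r"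
  using assms(1,5)
proof (induction n arbitrary: f)
  case 0
  note Q = subfieldE(1)[OF subfield_Qp_bar]
  obtain b where b: "b \<in> Qp_bar" "f b = \<zero>" using polyfun_exists_root[OF 0(1) assms(2)] by blast
  obtain h where h: "polyfun Qp_bar 0 c h" "\<And>x. x \<in> carrier C \<Longrightarrow> f x = h x \<otimes> (x \<ominus> b) \<oplus> f b"
    by (rule polyfun_divide_linear[OF Q 0(1) b(1)]) blast
  have carr: "c \<in> carrier C" "b \<in> carrier C"
    using polyfun_lead[OF 0(1)] b(1) Qp_bar_carrier by auto
  have "f x = c \<otimes> (x \<ominus> b)"
    using h(2)[OF assms(3)] polyfun_zero_degree(2)[OF h(1) Qp_bar_carrier assms(3)] b(2) carr assms(3) by simp
  then have "v c * v (x \<ominus> b) \<le> v c * r" using 0(2) carr assms(3) by (simp add: v_mult)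
  then have "v (x \<ominus> b) \<le> r" using v_pos[OF carr(1) assms(2)] by simp
  then show ?case using b by blast
next
  case (Suc n)
  note Q = subfieldE(1)[OF subfield_Qp_bar]
  obtain b where b: "b \<in> Qp_bar" "f b = \<zero>" using polyfun_exists_root[OF Suc(2) assms(2)] by blast
  obtain h where h: "polyfun Qp_bar (Suc n) c h" "\<And>x. x \<in> carrier C \<Longrightarrow> f x = h x \<otimes> (x \<ominus> b) \<oplus> f b"
    by (rule polyfun_divide_linear[OF Q Suc(2) b(1)]) blast
  show ?case
  proof (cases "v (x \<ominus> b) \<le> r")
    case True
    then show ?thesis using b by blast
  next
    case False
    have carr: "b \<in> carrier C" "h x \<in> carrier C"
      using b(1) Qp_bar_carrier polyfun_closed[OF h(1) Qp_bar_carrier assms(3)] by auto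
    have "f x = h x \<otimes> (x \<ominus> b)" using h(2)[OF assms(3)] b(2) carr assms(3) by simp
    then have "v (h x) * v (x \<ominus> b) \<le> v c * r ^ Suc n * r"
      using Suc(3) carr assms(3) by (simp add: v_mult mult_ac)
    moreover have "v (h x) * r \<le> v (h x) * v (x \<ominus> b)" using False v_nonneg[OF carr(2)] by (intro mult_left_mono) auto
    ultimately have "v (h x) \<le> v c * r ^ Suc n" using assms(4) by (smt (verit) mult_right_le_imp_le)
    then obtain d where d: "d \<in> Qp_bar" "h d = \<zero>" "v (x \<ominus> d) \<le> r" using Suc.IH[OF h(1)] by blast
    then have "d \<in> carrier C" using Qp_bar_carrier by auto
    then have "f d = \<zero>" using h(2) b(2) d(2) carr by simp
    then show ?thesis using d by blast
  qed
qed

lemma polyfun_close_root_strict: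
  assumes f: "polyfun Qp_bar (Suc n) c f" and c: "c \<noteq> \<zero>" and x: "x \<in> carrier C" and r: "0 < r"
    and lt: "v (f x) < v c * r ^ Suc n"
  shows "\<exists>b \<in> Qp_bar. f b = \<zero> \<and> v (x \<ominus> b) < r"
proof -
  have cc: "c \<in> carrier C" using polyfun_lead[OF f] Qp_bar_carrier by auto
  define q where "q = v (f x) / v c"
  have q: "0 \<le> q" "q < r ^ Suc n"
    using lt v_pos[OF cc c] v_nonneg[OF polyfun_closed[OF f Qp_bar_carrier x]]
    unfolding q_def by (auto simp: field_simps)
  define t where "t = root (Suc n) q"
  have t: "0 \<le> t" "t ^ Suc n = q" "t < r"
  proof -
    show "0 \<le> t" unfolding t_def using q by simp
    moreover show "t ^ Suc n = q" unfolding t_def using q(1) by (rule real_root_pow_pos2[OF zero_less_Suc])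
    ultimately show "t < r" using q r by (metis less_le_not_le not_le power_mono linorder_not_less)
  qed
  define s where "s = (t + r) / 2"
  have s: "0 < s" "t \<le> s" "s < r" using t r unfolding s_def by auto
  have "q \<le> s ^ Suc n" using t(1,2) s(2) power_mono by metis
  then have "v (f x) \<le> v c * s ^ Suc n"
    using v_pos[OF cc c] unfolding q_def by (simp add: field_simps)
  then show ?thesis using polyfun_close_root[OF f c x s(1)] s(3) by fastforce
qed

section \<open>Automorphisms are isometries\<close>

definition adherent :: "'a set \<Rightarrow> 'a \<Rightarrow> bool"
  where "adherent S x \<longleftrightarrow> x \<in> carrier C \<and> (\<forall>\<epsilon>>0. \<exists>s \<in> S. v (x \<ominus> s) < \<epsilon>)"

definition seq_closed :: "'a set \<Rightarrow> bool"
  where "seq_closed S \<longleftrightarrow> (\<forall>x. adherent S x \<longrightarrow> x \<in> S)"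

lemma closure_of_iff_adherent:
  assumes "S \<subseteq> carrier C"
  shows "x \<in> metric.mtopology closure_of S \<longleftrightarrow> adherent S x"
  using assms unfolding metric.metric_closure_of adherent_def metric.in_mball vdist_def
  by (auto; blast)

lemma adherent_Qp_iff: "adherent (generate_field C {}) x \<longleftrightarrow> x \<in> Qp"
  unfolding Qp_def using closure_of_iff_adherent[of "generate_field C {}"] generate_field_incl by simp

lemma seq_closed_Qp: "seq_closed Qp"
proof -
  have Q: "Qp \<subseteq> carrier C" using subfieldE(3)[OF subfield_Qp] .
  have "metric.mtopology closure_of Qp = Qp" unfolding Qp_def by simp
  then show ?thesis unfolding seq_closed_def using closure_of_iff_adherent[OF Q] by auto
qed

lemma Cauchy_limit:
  fixes s :: "nat \<Rightarrow> 'a"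
  assumes s: "\<And>n. s n \<in> carrier C"
    and Cauchy: "\<And>\<epsilon>. 0 < \<epsilon> \<Longrightarrow> \<exists>N. \<forall>m\<ge>N. \<forall>n\<ge>N. v (s m \<ominus> s n) < \<epsilon>"
  obtains l where "l \<in> carrier C" "\<And>\<epsilon>. 0 < \<epsilon> \<Longrightarrow> \<exists>N. \<forall>n\<ge>N. v (s n \<ominus> l) < \<epsilon>"
proof -
  have "metric.MCauchy s"
    unfolding metric.MCauchy_def using s Cauchy by (auto simp: vdist_def)
  then obtain l where l: "limitin metric.mtopology s l sequentially"
    using complete unfolding metric.mcomplete_def by blast
  then have lc: "l \<in> carrier C" using limitin_topspace by fastforce
  moreover have "\<exists>N. \<forall>n\<ge>N. v (s n \<ominus> l) < \<epsilon>" if "0 < \<epsilon>" for \<epsilon>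
    using l that s lc unfolding metric.limitin_metric eventually_sequentially by (auto simp: vdist_def; blast)
  ultimately show ?thesis using that by blast
qed

lemma seq_closed_dist:
  assumes "seq_closed W" "u \<in> carrier C" "u \<notin> W"
  obtains d where "0 < d" "\<And>w. w \<in> W \<Longrightarrow> d \<le> v (u \<ominus> w)"
  using assms unfolding seq_closed_def adherent_def by (metis not_le)

lemma line_extension_coeff_bound:
  assumes K: "subfield K C" and W: "W \<subseteq> carrier C" "\<And>k w. \<lbrakk>k \<in> K; w \<in> W\<rbrakk> \<Longrightarrow> k \<otimes> w \<in> W"
    "\<And>w. w \<in> W \<Longrightarrow> \<ominus> w \<in> W"
    and u: "u \<in> carrier C" and d: "\<And>w. w \<in> W \<Longrightarrow> d \<le> v (u \<ominus> w)"
    and k: "k \<in> K" and w: "w \<in> W"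
  shows "d * v k \<le> v (k \<otimes> u \<oplus> w)"
proof (cases "k = \<zero>")
  case True
  have "w \<in> carrier C" using W(1) w by auto
  then show ?thesis using True u v_nonneg by simp
next
  case False
  have kc: "k \<in> carrier C" and wc: "w \<in> carrier C" using subfieldE(3)[OF K] k W(1) w by auto
  note inv = subfield_m_inv[OF K, of k]
  have inv_mem: "inv k \<in> K" "k \<otimes> inv k = \<one>" using inv k False by auto
  then have ic: "inv k \<in> carrier C" using subfieldE(3)[OF K] by auto
  have "k \<otimes> u \<oplus> w = k \<otimes> u \<oplus> (k \<otimes> inv k) \<otimes> w" using inv_mem(2) wc by simp
  also have "\<dots> = k \<otimes> (u \<ominus> (\<ominus> (inv k \<otimes> w)))" using kc ic wc u by algebra
  finally have "v (k \<otimes> u \<oplus> w) = v k * v (u \<ominus> (\<ominus> (inv k \<otimes> w)))"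
    using v_mult[OF kc] u ic wc by simp
  moreover have "d \<le> v (u \<ominus> (\<ominus> (inv k \<otimes> w)))"
    using d W(2)[OF inv_mem(1) w] W(3) by blast
  ultimately show ?thesis using mult_left_mono[OF _ v_nonneg[OF kc]] by (metis mult.commute)
qed

lemma seq_closed_line_extension:
  assumes K: "subfield K C" "seq_closed K" and W: "seq_closed W" "W \<subseteq> carrier C"
    "\<And>k w. \<lbrakk>k \<in> K; w \<in> W\<rbrakk> \<Longrightarrow> k \<otimes> w \<in> W" "\<And>w. w \<in> W \<Longrightarrow> \<ominus> w \<in> W"
    "\<And>w w'. \<lbrakk>w \<in> W; w' \<in> W\<rbrakk> \<Longrightarrow> w \<oplus> w' \<in> W"
    and u: "u \<in> carrier C" "u \<notin> W"
  shows "seq_closed (line_extension K u W)"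
  unfolding seq_closed_def
proof (intro allI impI)
  fix x assume x: "adherent (line_extension K u W) x"
  note Kc = subfieldE(3)[OF K(1)]
  have xc: "x \<in> carrier C" using x unfolding adherent_def by auto
  obtain d where d: "0 < d" "\<And>w. w \<in> W \<Longrightarrow> d \<le> v (u \<ominus> w)"
    using seq_closed_dist[OF W(1) u] by blast
  note bound = line_extension_coeff_bound[OF K(1) W(2,3,4) u(1) d(2)]
  have "\<exists>k w. k \<in> K \<and> w \<in> W \<and> v (x \<ominus> (k \<otimes> u \<oplus> w)) < 1 / real (Suc n)" for n
  proof -
    obtain y where y: "y \<in> line_extension K u W" "v (x \<ominus> y) < 1 / real (Suc n)"
      using x unfolding adherent_def by (metis of_nat_0_less_iff zero_less_Suc zero_less_divide_1_iff)
    then show ?thesis unfolding line_extension_mem_iff by blast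
  qed
  then have "\<forall>n. \<exists>k w. k \<in> K \<and> w \<in> W \<and> v (x \<ominus> (k \<otimes> u \<oplus> w)) < 1 / real (Suc n)" by (rule allI)
  then have "\<exists>k. \<forall>n. \<exists>w. k n \<in> K \<and> w \<in> W \<and> v (x \<ominus> (k n \<otimes> u \<oplus> w)) < 1 / real (Suc n)"
    by (rule choice)
  then obtain k where "\<forall>n. \<exists>w. k n \<in> K \<and> w \<in> W \<and> v (x \<ominus> (k n \<otimes> u \<oplus> w)) < 1 / real (Suc n)"
    by (rule exE)
  then have "\<exists>w. \<forall>n. k n \<in> K \<and> w n \<in> W \<and> v (x \<ominus> (k n \<otimes> u \<oplus> w n)) < 1 / real (Suc n)"
    by (rule choice)
  then obtain w where "\<forall>n. k n \<in> K \<and> w n \<in> W \<and> v (x \<ominus> (k n \<otimes> u \<oplus> w n)) < 1 / real (Suc n)"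
    by (rule exE)
  then have kw: "\<And>n. k n \<in> K" "\<And>n. w n \<in> W"
    "\<And>n. v (x \<ominus> (k n \<otimes> u \<oplus> w n)) < 1 / real (Suc n)" by blast+
  have carr: "k n \<in> carrier C" "w n \<in> carrier C" for n using kw Kc W(2) by auto
  have small: "\<exists>N. \<forall>n\<ge>N. v (x \<ominus> (k n \<otimes> u \<oplus> w n)) < \<epsilon>" if eps: "0 < \<epsilon>" for \<epsilon>
  proof -
    obtain N where N: "1 / real (Suc N) < \<epsilon>" by (rule nat_approx_posE[OF eps])
    have "v (x \<ominus> (k n \<otimes> u \<oplus> w n)) < \<epsilon>" if "N \<le> n" for n
    proof -
      have "1 / real (Suc n) \<le> 1 / real (Suc N)" using that by (intro frac_le) auto
      then show ?thesis using kw(3)[of n] N by linarith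
    qed
    then show ?thesis by blast
  qed
  have diff: "v (k m \<ominus> k n) \<le> max (v (x \<ominus> (k m \<otimes> u \<oplus> w m))) (v (x \<ominus> (k n \<otimes> u \<oplus> w n))) / d" for m n
  proof -
    have "d * v (k m \<ominus> k n) \<le> v ((k m \<ominus> k n) \<otimes> u \<oplus> (w m \<oplus> \<ominus> w n))"
      using kw W(4,5) subringE(5,7)[OF subfieldE(1)[OF K(1)]] by (intro bound) (auto simp: minus_eq)
    also have "(k m \<ominus> k n) \<otimes> u \<oplus> (w m \<oplus> \<ominus> w n) = (x \<ominus> (k n \<otimes> u \<oplus> w n)) \<ominus> (x \<ominus> (k m \<otimes> u \<oplus> w m))"
      using carr[of m] carr[of n] u(1) xc by algebra
    also have "v \<dots> \<le> max (v (x \<ominus> (k m \<otimes> u \<oplus> w m))) (v (x \<ominus> (k n \<otimes> u \<oplus> w n)))"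
      by (rule v_minus_le) (use carr[of m] carr[of n] u(1) xc in auto)
    finally show ?thesis using d(1) by (simp add: field_simps)
  qed
  obtain l where l: "l \<in> carrier C" "\<And>\<epsilon>. 0 < \<epsilon> \<Longrightarrow> \<exists>N. \<forall>n\<ge>N. v (k n \<ominus> l) < \<epsilon>"
  proof (rule Cauchy_limit[of k])
    fix \<epsilon> :: real assume "0 < \<epsilon>"
    then obtain N where N: "\<forall>n\<ge>N. v (x \<ominus> (k n \<otimes> u \<oplus> w n)) < \<epsilon> * d" using small[of "\<epsilon> * d"] d(1) by auto
    have "v (k m \<ominus> k n) < \<epsilon>" if "N \<le> m" "N \<le> n" for m n
    proof -
      have "max (v (x \<ominus> (k m \<otimes> u \<oplus> w m))) (v (x \<ominus> (k n \<otimes> u \<oplus> w n))) < \<epsilon> * d" using N that by auto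
      then show ?thesis using diff[of m n] d(1) by (smt (verit) pos_divide_less_eq)
    qed
    then show "\<exists>N. \<forall>m\<ge>N. \<forall>n\<ge>N. v (k m \<ominus> k n) < \<epsilon>" by blast
  qed (use carr in auto)
  have "adherent K l"
    unfolding adherent_def
  proof (intro conjI allI impI)
    fix \<epsilon> :: real assume "0 < \<epsilon>"
    then obtain N where "v (k N \<ominus> l) < \<epsilon>" using l(2) by blast
    then show "\<exists>s\<in>K. v (l \<ominus> s) < \<epsilon>" using kw(1) v_minus_commute[OF carr(1) l(1)] by metis
  qed (rule l(1))
  then have lK: "l \<in> K" using K(2) unfolding seq_closed_def by blast
  have "adherent W (x \<ominus> l \<otimes> u)"
    unfolding adherent_def
  proof (intro conjI allI impI)
    show "x \<ominus> l \<otimes> u \<in> carrier C" using xc l(1) u(1) by simp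
    fix \<epsilon> :: real assume \<epsilon>: "0 < \<epsilon>"
    have "0 < v u + 1" using v_nonneg[OF u(1)] by linarith
    then obtain N1 N2 where N: "\<forall>n\<ge>N1. v (k n \<ominus> l) < \<epsilon> / (v u + 1)" "\<forall>n\<ge>N2. v (x \<ominus> (k n \<otimes> u \<oplus> w n)) < \<epsilon>"
      using l(2)[of "\<epsilon> / (v u + 1)"] small[OF \<epsilon>] \<epsilon> by auto
    define n where "n = max N1 N2"
    have "x \<ominus> l \<otimes> u \<ominus> w n = (x \<ominus> (k n \<otimes> u \<oplus> w n)) \<oplus> (k n \<ominus> l) \<otimes> u"
      using carr[of n] u(1) xc l(1) by algebra
    moreover have "v ((x \<ominus> (k n \<otimes> u \<oplus> w n)) \<oplus> (k n \<ominus> l) \<otimes> u) < \<epsilon>"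
    proof (rule v_add_less)
      show "v (x \<ominus> (k n \<otimes> u \<oplus> w n)) < \<epsilon>" using N(2) unfolding n_def by simp
      have "v (k n \<ominus> l) < \<epsilon> / (v u + 1)" using N(1) unfolding n_def by simp
      then have "v (k n \<ominus> l) * (v u + 1) < \<epsilon>" using \<open>0 < v u + 1\<close> by (simp add: field_simps)
      moreover have "v (k n \<ominus> l) * v u \<le> v (k n \<ominus> l) * (v u + 1)"
        using v_nonneg carr l(1) by (intro mult_left_mono) auto
      ultimately show "v ((k n \<ominus> l) \<otimes> u) < \<epsilon>" using v_mult[of "k n \<ominus> l" u] carr l(1) u(1) by simp
    qed (use xc carr u(1) l(1) in auto)
    ultimately show "\<exists>s\<in>W. v (x \<ominus> l \<otimes> u \<ominus> s) < \<epsilon>" using kw(2)[of n] by metis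
  qed
  then have "x \<ominus> l \<otimes> u \<in> W" using W(1) unfolding seq_closed_def by blast
  moreover have "x = l \<otimes> u \<oplus> (x \<ominus> l \<otimes> u)" using xc l(1) u(1) by algebra
  ultimately show "x \<in> line_extension K u W" unfolding line_extension_mem_iff using lK by blast
qed

lemma seq_closed_Span:
  assumes K: "subfield K C" "seq_closed K" and "set Us \<subseteq> carrier C"
  shows "seq_closed (Span K Us)"
  using assms(3)
proof (induction Us)
  case Nil
  have "x = \<zero>" if "adherent {\<zero>} x" for x
  proof (rule ccontr)
    assume "x \<noteq> \<zero>"
    moreover have xc: "x \<in> carrier C" using that unfolding adherent_def by auto
    ultimately have "0 < v x" using v_pos by blast
    then have "v (x \<ominus> \<zero>) < v x" using that unfolding adherent_def by blast
    then show False using xc by (simp add: minus_eq)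
  qed
  then show ?case unfolding seq_closed_def by auto
next
  case (Cons u Us)
  then have u: "u \<in> carrier C" "set Us \<subseteq> carrier C" "seq_closed (Span K Us)" by auto
  show ?case
  proof (cases "u \<in> Span K Us")
    case True
    then have "set (u # Us) \<subseteq> Span K Us" using Span_base_incl[OF K(1) u(2)] by auto
    then have "Span K (u # Us) = Span K Us"
      using mono_Span_subset[OF K(1) _ u(2)] mono_Span[OF K(1) u(2,1)] by blast
    then show ?thesis using u(3) by simp
  next
    case False
    have "seq_closed (line_extension K u (Span K Us))"
      by (rule seq_closed_line_extension[OF K u(3) _ _ _ _ u(1) False])
        (use Span_subgroup_props[OF K(1) u(2)] Span_smult_closed[OF K(1) u(2)] in blast)+
    then show ?thesis by simp
  qed
qed

lemma Span_linear_bounded: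
  assumes K: "subfield K C" "seq_closed K" and "set Us \<subseteq> carrier C"
    and h_carr: "\<And>x. x \<in> Span K Us \<Longrightarrow> h x \<in> carrier C"
    and h_add: "\<And>x y. \<lbrakk>x \<in> Span K Us; y \<in> Span K Us\<rbrakk> \<Longrightarrow> h (x \<oplus> y) = h x \<oplus> h y"
    and h_mult: "\<And>k x. \<lbrakk>k \<in> K; x \<in> Span K Us\<rbrakk> \<Longrightarrow> h (k \<otimes> x) = k \<otimes> h x"
  shows "\<exists>M. \<forall>x \<in> Span K Us. v (h x) \<le> M * v x"
  using assms(3-)
proof (induction Us)
  case Nil
  have "h (\<zero> \<otimes> \<zero>) = \<zero> \<otimes> h \<zero>" using Nil(4)[of \<zero> \<zero>] subringE(2)[OF subfieldE(1)[OF K(1)]] by simp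
  then have "h \<zero> = \<zero>" using Nil(2)[of \<zero>] by simp
  then show ?case by auto
next
  case (Cons u Us)
  then have u: "u \<in> carrier C" "set Us \<subseteq> carrier C" by auto
  have mono: "Span K Us \<subseteq> Span K (u # Us)" by (rule mono_Span[OF K(1) u(2,1)])
  have "\<exists>M. \<forall>x \<in> Span K Us. v (h x) \<le> M * v x"
    using mono by (intro Cons.IH u(2) Cons.prems) auto
  then obtain M0 where M0: "\<And>x. x \<in> Span K Us \<Longrightarrow> v (h x) \<le> M0 * v x" by blast
  define M where "M = max M0 0"
  have M: "0 \<le> M" "\<And>x. x \<in> Span K Us \<Longrightarrow> v (h x) \<le> M * v x"
  proof -
    show "v (h x) \<le> M * v x" if x: "x \<in> Span K Us" for x
    proof -
      have "x \<in> carrier C" using x Span_subgroup_props(1)[OF K(1) u(2)] by auto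
      then have "M0 * v x \<le> M * v x" unfolding M_def using v_nonneg by (intro mult_right_mono) auto
      then show ?thesis using M0[OF x] by linarith
    qed
  qed (simp add: M_def)
  show ?case
  proof (cases "u \<in> Span K Us")
    case True
    then have "set (u # Us) \<subseteq> Span K Us" using Span_base_incl[OF K(1) u(2)] by auto
    then have "Span K (u # Us) \<subseteq> Span K Us"
      using mono_Span_subset[OF K(1) _ u(2)] by blast
    then show ?thesis using M(2) by blast
  next
    case False
    note SP = Span_subgroup_props[OF K(1) u(2)] Span_smult_closed[OF K(1) u(2)]
    obtain d where d: "0 < d" "\<And>w. w \<in> Span K Us \<Longrightarrow> d \<le> v (u \<ominus> w)"
      using seq_closed_dist[OF seq_closed_Span[OF K u(2)] u(1) False] by blast
    have u_mem: "u \<in> Span K (u # Us)"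
      using Span_base_incl[OF K(1), of "u # Us"] u by auto
    have hu: "h u \<in> carrier C" by (rule Cons.prems(2)[OF u_mem])
    define N where "N = max (v (h u) / d) (M * max 1 (v u / d))"
    have "v (h x) \<le> N * v x" if x: "x \<in> Span K (u # Us)" for x
    proof -
      obtain k w where kw: "k \<in> K" "w \<in> Span K Us" "x = k \<otimes> u \<oplus> w"
        using x unfolding Span.simps foldr.simps comp_def line_extension_mem_iff by blast
      have carr: "k \<in> carrier C" "w \<in> carrier C" "h w \<in> carrier C"
        using kw subfieldE(3)[OF K(1)] SP(1) Cons.prems(2)[of w] mono by auto
      have xc: "x \<in> carrier C" using kw(3) carr u(1) by simp
      have "d * v k \<le> v x"
        unfolding kw(3) by (rule line_extension_coeff_bound[OF K(1) SP(1,5,4) u(1) d(2) kw(1,2)])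
      then have vk: "v k \<le> v x / d" using pos_le_divide_eq[OF d(1)] by (simp only: mult.commute)
      have vw: "v w \<le> max 1 (v u / d) * v x"
      proof -
        have "w = x \<ominus> k \<otimes> u" unfolding kw(3) using carr u(1) by algebra
        moreover have "v (x \<ominus> k \<otimes> u) \<le> max 1 (v u / d) * v x"
        proof (rule v_minus_le)
          have "1 * v x \<le> max 1 (v u / d) * v x" by (rule mult_right_mono[OF max.cobounded1 v_nonneg[OF xc]])
          then show "v x \<le> max 1 (v u / d) * v x" by (simp only: mult_1_left)
          have "v (k \<otimes> u) \<le> (v x / d) * v u"
            unfolding v_mult[OF carr(1) u(1)] by (rule mult_right_mono[OF vk v_nonneg[OF u(1)]])
          also have "\<dots> = (v u / d) * v x" by simp
          also have "\<dots> \<le> max 1 (v u / d) * v x" by (rule mult_right_mono[OF max.cobounded2 v_nonneg[OF xc]])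
          finally show "v (k \<otimes> u) \<le> max 1 (v u / d) * v x" .
        qed (use xc carr u(1) in auto)
        ultimately show ?thesis by simp
      qed
      have ku: "k \<otimes> u \<in> Span K (u # Us)"
        using Span_smult_closed[OF K(1), of "u # Us"] u kw(1) u_mem by auto
      have "h x = k \<otimes> h u \<oplus> h w"
        unfolding kw(3) Cons.prems(3)[OF ku subsetD[OF mono kw(2)]] Cons.prems(4)[OF kw(1) u_mem] ..
      moreover have "v (k \<otimes> h u \<oplus> h w) \<le> N * v x"
      proof (rule v_add_le)
        have "v (k \<otimes> h u) \<le> (v x / d) * v (h u)"
          unfolding v_mult[OF carr(1) hu] by (rule mult_right_mono[OF vk v_nonneg[OF hu]])
        also have "\<dots> = (v (h u) / d) * v x" by simp
        also have "\<dots> \<le> N * v x" unfolding N_def by (rule mult_right_mono[OF max.cobounded1 v_nonneg[OF xc]])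
        finally show "v (k \<otimes> h u) \<le> N * v x" .
        have "v (h w) \<le> M * (max 1 (v u / d) * v x)"
          using M(2)[OF kw(2)] mult_left_mono[OF vw M(1)] by linarith
        also have "\<dots> = (M * max 1 (v u / d)) * v x" by simp
        also have "\<dots> \<le> N * v x" unfolding N_def by (rule mult_right_mono[OF max.cobounded2 v_nonneg[OF xc]])
        finally show "v (h w) \<le> N * v x" .
      qed (use carr hu in auto)
      ultimately show ?thesis by simp
    qed
    then show ?thesis by blast
  qed
qed

lemma abs_Galois_pow:
  assumes "g \<in> abs_Galois K" "x \<in> Qp_bar"
  shows "g (x [^] (n::nat)) = g x [^] n"
proof (induction n)
  case 0
  then show ?case using embeddingD(3)[OF abs_Galois_embedding[OF assms(1)]] by simp
next
  case (Suc n)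
  then show ?case
    using embeddingD(2)[OF abs_Galois_embedding[OF assms(1)] Qp_bar_closed(5)[OF assms(2) assms(2)] assms(2)]
    by simp
qed

text \<open>Boundedness on the finite-dimensional algebra generated by \<open>x\<close>, applied to all powers of \<open>x\<close>.\<close>

lemma abs_Galois_v_le:
  assumes K: "intermediate K" and g: "g \<in> abs_Galois K" and x: "x \<in> Qp_bar"
  shows "v (g x) \<le> v x"
proof -
  have int: "intermediate Qp"
    unfolding intermediate_def using subfield_Qp intermediateD(4)[OF intermediate_Qp_bar] by auto
  have xc: "x \<in> carrier C" using x Qp_bar_carrier by auto
  note E = abs_Galois_embedding[OF g]
  define Us where "Us = exp_base x (degree (Irr Qp x))"
  have span: "Span Qp Us = simple_extension Qp x"
    unfolding Us_def by (rule Span_exp_base[OF subfield_Qp xc algebraic_over_intermediate[OF int x]])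
  note S = intermediate_simple_extension[OF int x]
  have sub: "Span Qp Us \<subseteq> Qp_bar" unfolding span by (rule intermediateD(5)[OF S(1)])
  have "\<exists>M. \<forall>y \<in> Span Qp Us. v (g y) \<le> M * v y"
  proof (rule Span_linear_bounded[OF subfield_Qp seq_closed_Qp])
    show "set Us \<subseteq> carrier C" unfolding Us_def by (rule exp_base_closed[OF xc])
    show "g y \<in> carrier C" if "y \<in> Span Qp Us" for y using embeddingD(5)[OF E] sub that by auto
    show "g (y \<oplus> z) = g y \<oplus> g z" if "y \<in> Span Qp Us" "z \<in> Span Qp Us" for y z
      using embeddingD(1)[OF E] sub that by auto
    show "g (k \<otimes> y) = k \<otimes> g y" if "k \<in> Qp" "y \<in> Span Qp Us" for k y
    proof -
      have "k \<in> K" using that(1) intermediateD(4)[OF K] by auto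
      moreover have "k \<in> Qp_bar" using that(1) intermediateD(5)[OF int] by auto
      ultimately show ?thesis
        using embeddingD(2)[OF E] sub that(2) abs_Galois_fixes[OF g] by auto
    qed
  qed
  then obtain M where M: "\<And>y. y \<in> simple_extension Qp x \<Longrightarrow> v (g y) \<le> M * v y" unfolding span by blast
  have gx: "g x \<in> carrier C" using embeddingD(5)[OF E x] .
  have pow: "v (g x) ^ n \<le> M * v x ^ n" for n
  proof -
    have "x [^] n \<in> simple_extension Qp x"
      by (induction n) (use S(3) subringE(3,6)[OF intermediateD(2)[OF S(1)]] in auto)
    then have "v (g (x [^] n)) \<le> M * v (x [^] n)" by (rule M)
    then show ?thesis using abs_Galois_pow[OF g x] gx xc by (simp add: v_pow)
  qed
  show ?thesis
  proof (rule ccontr)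
    assume "\<not> v (g x) \<le> v x"
    then have lt: "v x < v (g x)" by simp
    then have "0 < v (g x)" using v_nonneg[OF xc] by linarith
    have "x \<noteq> \<zero>" using lt embedding_zero[OF E] by auto
    then have vx: "0 < v x" using v_pos[OF xc] by simp
    obtain n where "M < (v (g x) / v x) ^ n"
      using real_arch_pow[of "v (g x) / v x" M] lt vx by auto
    then have "M * v x ^ n < v (g x) ^ n" using vx by (simp add: power_divide field_simps)
    then show False using pow[of n] by simp
  qed
qed

lemma abs_Galois_isometry:
  assumes K: "intermediate K" and g: "g \<in> abs_Galois K" and x: "x \<in> Qp_bar"
  shows "v (g x) = v x"
proof (rule antisym)
  show "v (g x) \<le> v x" by (rule abs_Galois_v_le[OF assms])
  obtain h where h: "h \<in> abs_Galois K" "\<And>x. x \<in> Qp_bar \<Longrightarrow> g (h x) = x"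
    "\<And>x. x \<in> Qp_bar \<Longrightarrow> h (g x) = x"
    by (rule abs_Galois_inv[OF intermediateD(5)[OF K] g], rule that)
  show "v x \<le> v (g x)"
    using abs_Galois_v_le[OF K h(1) abs_Galois_closed[OF g x]] h(3)[OF x] by simp
qed

lemma Galois_action_eq:
  assumes K: "intermediate K" and g: "g \<in> abs_Galois K" and x: "x \<in> Qp_bar"
  shows "Galois_action g x = g x"
proof -
  note E = abs_Galois_embedding[OF g]
  let ?m = "metric (carrier C, vdist)"
  have "Lipschitz_continuous_map (submetric ?m Qp_bar) ?m g"
    unfolding Lipschitz_continuous_map_def
  proof (intro conjI exI[of _ 1] ballI)
    show "g \<in> mspace (submetric ?m Qp_bar) \<rightarrow> mspace ?m"
      using embeddingD(5)[OF E] by auto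
    fix y z assume "y \<in> mspace (submetric ?m Qp_bar)" "z \<in> mspace (submetric ?m Qp_bar)"
    then have yz: "y \<in> Qp_bar" "z \<in> Qp_bar" by auto
    then have carr: "y \<in> carrier C" "z \<in> carrier C" "g y \<in> carrier C" "g z \<in> carrier C"
      using embeddingD(5)[OF E] Qp_bar_carrier by blast+
    have "g (y \<ominus> z) = g y \<ominus> g z" by (rule abs_Galois_minus_closed[OF g yz])
    moreover have "v (g (y \<ominus> z)) = v (y \<ominus> z)"
      by (rule abs_Galois_isometry[OF K g Qp_bar_closed(4)[OF yz]])
    ultimately have "v (g y \<ominus> g z) = v (y \<ominus> z)" by simp
    then have "vdist (g y) (g z) = vdist y z" using carr by (simp add: vdist_def)
    then show "mdist ?m (g y) (g z) \<le> 1 * mdist (submetric ?m Qp_bar) y z" by simp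
  qed
  then have "Cauchy_continuous_map (submetric ?m Qp_bar) ?m g" by (rule Lipschitz_imp_Cauchy_continuous_map)
  moreover have "mcomplete_of ?m" using complete by (simp add: mcomplete_of_def)
  ultimately obtain \<tau> where "continuous_map (subtopology (mtopology_of ?m) (mtopology_of ?m closure_of Qp_bar))
      (mtopology_of ?m) \<tau>" and \<tau>_g: "\<And>x. x \<in> Qp_bar \<Longrightarrow> \<tau> x = g x"
    using Cauchy_continuous_map_extends_to_continuous_closure_of by metis
  then have \<tau>: "continuous_map (subtopology metric.mtopology (metric.mtopology closure_of Qp_bar))
      metric.mtopology \<tau>" by (simp only: metric.mtopology_of)
  have "subtopology metric.mtopology (metric.mtopology closure_of Qp_bar) = metric.mtopology"
    unfolding Qp_bar_dense by (metis metric.topspace_mtopology subtopology_topspace)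
  then have \<tau>c: "continuous_map metric.mtopology metric.mtopology \<tau>" using \<tau> by simp
  let ?P = "\<lambda>\<tau>. \<tau> \<in> extensional (carrier C) \<and> continuous_map metric.mtopology metric.mtopology \<tau> \<and>
    (\<forall>x \<in> Qp_bar. \<tau> x = g x)"
  have ex: "?P (restrict \<tau> (carrier C))"
  proof (intro conjI ballI)
    show "continuous_map metric.mtopology metric.mtopology (restrict \<tau> (carrier C))"
      using \<tau>c by (rule continuous_map_eq) auto
  qed (use \<tau>_g Qp_bar_carrier in auto)
  moreover have "\<sigma> = restrict \<tau> (carrier C)" if \<sigma>: "?P \<sigma>" for \<sigma>
  proof (rule extensionalityI[of _ "carrier C"])
    fix y assume "y \<in> carrier C"
    then have y: "y \<in> metric.mtopology closure_of Qp_bar" using Qp_bar_dense by simp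
    show "\<sigma> y = restrict \<tau> (carrier C) y"
    proof (rule forall_in_closure_of_eq[OF y metric.Hausdorff_space_mtopology])
      show "continuous_map metric.mtopology metric.mtopology \<sigma>" using \<sigma> by blast
      show "continuous_map metric.mtopology metric.mtopology (restrict \<tau> (carrier C))" using ex by blast
      show "\<sigma> z = restrict \<tau> (carrier C) z" if "z \<in> Qp_bar" for z
        using \<sigma> ex that by (metis (no_types, lifting))
    qed
  next
    show "\<sigma> \<in> extensional (carrier C)" using \<sigma> by blast
    show "restrict \<tau> (carrier C) \<in> extensional (carrier C)" by (rule restrict_extensional)
  qed
  ultimately have "Galois_action g = restrict \<tau> (carrier C)"
    unfolding Galois_action_def by (rule the_equality)
  then show ?thesis using \<tau>_g[OF x] x Qp_bar_carrier by auto
qed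

lemma disk_recenter:
  assumes "is_disk D" "\<alpha> \<in> D"
  obtains r where "0 < r" "D = {x \<in> carrier C. v (\<alpha> \<ominus> x) \<le> r} \<or> D = {x \<in> carrier C. v (\<alpha> \<ominus> x) < r}"
proof -
  obtain a r where a: "a \<in> carrier C" "0 < r" "D = metric.mcball a r \<or> D = metric.mball a r"
    using assms(1) unfolding is_disk_def by blast
  then have "D = {x \<in> carrier C. v (a \<ominus> x) \<le> r} \<or> D = {x \<in> carrier C. v (a \<ominus> x) < r}"
    by (auto simp: vdist_def)
  then show ?thesis
  proof
    assume D: "D = {x \<in> carrier C. v (a \<ominus> x) \<le> r}"
    then have \<alpha>: "\<alpha> \<in> carrier C" "v (a \<ominus> \<alpha>) \<le> r" "v (\<alpha> \<ominus> a) \<le> r"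
      using assms(2) v_minus_commute a(1) by auto
    have "v (a \<ominus> x) \<le> r \<longleftrightarrow> v (\<alpha> \<ominus> x) \<le> r" if "x \<in> carrier C" for x
      using v_trans_le[OF a(1) \<alpha>(1) that \<alpha>(2)] v_trans_le[OF \<alpha>(1) a(1) that \<alpha>(3)] by blast
    then show ?thesis using that[OF a(2)] D by blast
  next
    assume D: "D = {x \<in> carrier C. v (a \<ominus> x) < r}"
    then have \<alpha>: "\<alpha> \<in> carrier C" "v (a \<ominus> \<alpha>) < r" "v (\<alpha> \<ominus> a) < r"
      using assms(2) v_minus_commute a(1) by auto
    have "v (a \<ominus> x) < r \<longleftrightarrow> v (\<alpha> \<ominus> x) < r" if "x \<in> carrier C" for x
      using v_trans_less[OF a(1) \<alpha>(1) that \<alpha>(2)] v_trans_less[OF \<alpha>(1) a(1) that \<alpha>(3)] by blast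
    then show ?thesis using that[OF a(2)] D by blast
  qed
qed

lemma disk_meets_Qp_bar:
  assumes "is_disk D"
  shows "D \<inter> Qp_bar \<noteq> {}"
proof -
  obtain a r where a: "a \<in> carrier C" "0 < r" "D = metric.mcball a r \<or> D = metric.mball a r"
    using assms unfolding is_disk_def by blast
  then have "a \<in> metric.mtopology closure_of Qp_bar" using Qp_bar_dense by simp
  then obtain y where "y \<in> Qp_bar" "y \<in> metric.mball a r"
    using a(2) unfolding metric.metric_closure_of by blast
  moreover have "metric.mball a r \<subseteq> D" using a(3) metric.mball_subset_mcball by blast
  ultimately show ?thesis by blast
qed

lemma disk_carrier: "is_disk D \<Longrightarrow> D \<subseteq> carrier C"
  unfolding is_disk_def using metric.mball_subset_mspace metric.mcball_subset_mspace by blast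

lemma disk_Galois_closed:
  assumes K: "intermediate K" and D: "is_defined_over K D" and g: "g \<in> abs_Galois K"
    and x: "x \<in> D" "x \<in> Qp_bar"
  shows "g x \<in> D"
proof -
  have "Galois_action g ` D = D" using D g unfolding is_defined_over_def by blast
  then show ?thesis using x Galois_action_eq[OF K g x(2)] by (metis image_eqI)
qed

text \<open>The symmetrized polynomial has coefficients in \<open>K\<close> and unit leading coefficient. All \<open>T i\<close> lie in the
  disk, so its value at \<open>\<alpha>\<close> is bounded by \<open>r ^ n\<close>, and it has a root within \<open>r\<close> of \<open>\<alpha>\<close>.\<close>

lemma disk_descent:
  assumes K: "intermediate K" and D: "is_disk D" and \<alpha>: "\<alpha> \<in> D"
    and I: "finite I" "I \<noteq> {}"
    and w: "\<And>i. i \<in> I \<Longrightarrow> w i \<in> Qp_bar \<and> v (w i) \<le> 1" and sum: "v (\<Oplus>i\<in>I. w i) = 1"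
    and T: "\<And>i. i \<in> I \<Longrightarrow> finite (T i) \<and> card (T i) = n \<and> T i \<subseteq> Qp_bar \<inter> D"
    and n: "0 < n"
    and perm: "\<And>g. g \<in> abs_Galois K \<Longrightarrow>
      \<exists>\<pi>. bij_betw \<pi> I I \<and> (\<forall>i \<in> I. g (w i) = w (\<pi> i) \<and> g ` T i = T (\<pi> i))"
  obtains \<beta> where "\<beta> \<in> D" "\<beta> \<in> Qp_bar" "degree (Irr K \<beta>) \<le> n"
proof -
  define c where "c = (\<Oplus>i\<in>I. w i)"
  define f where "f x = (\<Oplus>i\<in>I. w i \<otimes> (\<Otimes>b\<in>T i. x \<ominus> b))" for x
  have f: "polyfun K n c f"
    unfolding f_def c_def using w T by (intro polyfun_symmetrize[OF K I _ _ perm]) auto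
  have fQ: "polyfun Qp_bar (Suc (n - 1)) c f"
    using polyfun_mono[OF f intermediateD(5)[OF K]] n by simp
  have c0: "c \<noteq> \<zero>" using sum unfolding c_def by auto
  have vc: "v c = 1" using sum unfolding c_def .
  have \<alpha>c: "\<alpha> \<in> carrier C" using \<alpha> disk_carrier[OF D] by auto
  have Tc: "T i \<subseteq> carrier C" if "i \<in> I" for i using T[OF that] Qp_bar_carrier by auto
  have term_carr: "w i \<otimes> (\<Otimes>b\<in>T i. \<alpha> \<ominus> b) \<in> carrier C" if "i \<in> I" for i
    using w[OF that] Qp_bar_carrier Tc[OF that] \<alpha>c by (auto intro!: finprod_closed)
  have term_v: "v (w i \<otimes> (\<Otimes>b\<in>T i. \<alpha> \<ominus> b)) \<le> (\<Prod>b\<in>T i. v (\<alpha> \<ominus> b))" if i: "i \<in> I" for i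
  proof -
    have P: "(\<Otimes>b\<in>T i. \<alpha> \<ominus> b) \<in> carrier C" using Tc[OF i] \<alpha>c by (auto intro!: finprod_closed)
    have "w i \<in> carrier C" using w[OF i] Qp_bar_carrier by auto
    then have "v (w i \<otimes> (\<Otimes>b\<in>T i. \<alpha> \<ominus> b)) = v (w i) * v (\<Otimes>b\<in>T i. \<alpha> \<ominus> b)" by (rule v_mult[OF _ P])
    also have "\<dots> \<le> v (\<Otimes>b\<in>T i. \<alpha> \<ominus> b)" using mult_right_mono[of "v (w i)" 1, OF _ v_nonneg[OF P]] w[OF i] by simp
    also have "\<dots> = (\<Prod>b\<in>T i. v (\<alpha> \<ominus> b))" using T[OF i] Tc[OF i] \<alpha>c by (intro v_finprod) auto
    finally show ?thesis .
  qed
  obtain r where r: "0 < r" "D = {x \<in> carrier C. v (\<alpha> \<ominus> x) \<le> r} \<or> D = {x \<in> carrier C. v (\<alpha> \<ominus> x) < r}"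
    by (rule disk_recenter[OF D \<alpha>], rule that)
  have "\<exists>\<beta> \<in> Qp_bar. f \<beta> = \<zero> \<and> \<beta> \<in> D"
    using r(2)
  proof
    assume D': "D = {x \<in> carrier C. v (\<alpha> \<ominus> x) \<le> r}"
    have "v (f \<alpha>) \<le> r ^ n"
      unfolding f_def
    proof (rule v_finsum_le[OF I(1) term_carr])
      fix i assume i: "i \<in> I"
      have "(\<Prod>b\<in>T i. v (\<alpha> \<ominus> b)) \<le> (\<Prod>b\<in>T i. r)"
      proof (rule prod_mono)
        fix b assume b: "b \<in> T i"
        then have "b \<in> D" using T[OF i] by blast
        then show "0 \<le> v (\<alpha> \<ominus> b) \<and> v (\<alpha> \<ominus> b) \<le> r" using D' \<alpha>c v_nonneg by simp
      qed
      then show "v (w i \<otimes> (\<Otimes>b\<in>T i. \<alpha> \<ominus> b)) \<le> r ^ n" using term_v[OF i] T[OF i] by simp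
    qed (assumption, rule zero_le_power[OF less_imp_le[OF r(1)]])
    then have "v (f \<alpha>) \<le> v c * r ^ Suc (n - 1)" using n vc by simp
    then obtain b where b: "b \<in> Qp_bar" "f b = \<zero>" "v (\<alpha> \<ominus> b) \<le> r"
      by (blast dest: polyfun_close_root[OF fQ c0 \<alpha>c r(1)])
    then show ?thesis using D' Qp_bar_carrier by blast
  next
    assume D': "D = {x \<in> carrier C. v (\<alpha> \<ominus> x) < r}"
    have "v (f \<alpha>) < r ^ n"
      unfolding f_def
    proof (rule v_finsum_less[OF I(1) term_carr])
      fix i assume i: "i \<in> I"
      have bound: "0 \<le> v (\<alpha> \<ominus> b) \<and> v (\<alpha> \<ominus> b) < r" if "b \<in> T i" for b
      proof -
        have "b \<in> D" using T[OF i] that by blast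
        then show ?thesis using D' \<alpha>c v_nonneg by simp
      qed
      have "T i \<noteq> {}" using T[OF i] n by auto
      then obtain b0 where b0: "b0 \<in> T i" by blast
      have "(\<Prod>b\<in>T i. v (\<alpha> \<ominus> b)) < (\<Prod>b\<in>T i. r)"
      proof (rule prod_mono_strict[OF b0])
        show "v (\<alpha> \<ominus> b0) < r" using bound[OF b0] by blast
        show "finite (T i)" using T[OF i] by blast
        show "0 \<le> v (\<alpha> \<ominus> b) \<and> v (\<alpha> \<ominus> b) \<le> r" if "b \<in> T i" for b
          using bound[OF that] by linarith
        show "0 < r" by (rule r(1))
      qed
      then show "v (w i \<otimes> (\<Otimes>b\<in>T i. \<alpha> \<ominus> b)) < r ^ n" using term_v[OF i] T[OF i] by simp
    qed (assumption, rule zero_less_power[OF r(1)])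
    then have "v (f \<alpha>) < v c * r ^ Suc (n - 1)" using n vc by simp
    then obtain b where b: "b \<in> Qp_bar" "f b = \<zero>" "v (\<alpha> \<ominus> b) < r"
      by (blast dest: polyfun_close_root_strict[OF fQ c0 \<alpha>c r(1)])
    then show ?thesis using D' Qp_bar_carrier by blast
  qed
  then obtain \<beta> where \<beta>: "\<beta> \<in> Qp_bar" "f \<beta> = \<zero>" "\<beta> \<in> D" by blast
  show ?thesis using that[OF \<beta>(3,1) degree_Irr_le[OF K \<beta>(1) f c0 \<beta>(2)]] .
qed

section \<open>Values and residues of \<open>Qp\<close>\<close>

lemma nat_diff_cases:
  "\<exists>t. (\<iota> a \<ominus> \<iota> b = \<iota> t \<and> a = b + t) \<or> (\<iota> a \<ominus> \<iota> b = \<ominus> \<iota> t \<and> b = a + t)"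
proof (cases "b \<le> a")
  case True
  then have "a = b + (a - b)" by simp
  then have *: "\<iota> a = \<iota> b \<oplus> \<iota> (a - b)" by (metis nat_add)
  have "\<iota> a \<ominus> \<iota> b = \<iota> (a - b)" unfolding * using nat_carrier[of b] nat_carrier[of "a - b"] by algebra
  then show ?thesis using True by (intro exI[of _ "a - b"]) simp
next
  case False
  then have "b = a + (b - a)" by simp
  then have *: "\<iota> b = \<iota> a \<oplus> \<iota> (b - a)" by (metis nat_add)
  have "\<iota> a \<ominus> \<iota> b = \<ominus> \<iota> (b - a)" unfolding * using nat_carrier[of a] nat_carrier[of "b - a"] by algebra
  then show ?thesis using False by (intro exI[of _ "b - a"]) simp
qed

lemma v_nat_diff:
  obtains t where "v (\<iota> a \<ominus> \<iota> b) = v (\<iota> t)" "a = b + t \<or> b = a + t"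
  using nat_diff_cases[of a b] v_minus[OF nat_carrier] by metis

lemma prime_field_fraction:
  assumes "x \<in> generate_field C {}"
  shows "x \<in> carrier C \<and> (\<exists>c a b. 0 < c \<and> \<iota> c \<otimes> x = \<iota> a \<ominus> \<iota> b)"
  using assms
proof (induction rule: generate_field.induct)
  case one
  have "\<iota> 1 \<otimes> \<one> = \<iota> 1 \<ominus> \<iota> 0" by (simp add: minus_eq)
  then show ?case by (metis one_closed zero_less_one)
next
  case (a_inv x)
  then obtain c a b where h: "0 < c" "\<iota> c \<otimes> x = \<iota> a \<ominus> \<iota> b" "x \<in> carrier C" by blast
  have "\<iota> c \<otimes> (\<ominus> x) = \<ominus> (\<iota> c \<otimes> x)" using h(3) by (simp add: r_minus)
  also have "\<dots> = \<iota> b \<ominus> \<iota> a" unfolding h(2) using nat_carrier[of a] nat_carrier[of b] by algebra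
  finally show ?case using h by (metis a_inv_closed)
next
  case (m_inv x)
  then obtain c a b where h: "0 < c" "\<iota> c \<otimes> x = \<iota> a \<ominus> \<iota> b" "x \<in> carrier C" by blast
  have ix: "inv x \<in> carrier C" "x \<otimes> inv x = \<one>"
    using inv_nonzero_closed mult_inv_cancel(1) h(3) m_inv(2) by auto
  obtain t where t: "(\<iota> a \<ominus> \<iota> b = \<iota> t) \<or> (\<iota> a \<ominus> \<iota> b = \<ominus> \<iota> t)" using nat_diff_cases[of a b] by blast
  have "\<iota> t \<noteq> \<zero>"
  proof
    assume "\<iota> t = \<zero>"
    then have "\<iota> c \<otimes> x = \<zero>" using h(2) t by auto
    then show False using integral[OF _ nat_carrier h(3)] nat_nonzero[OF h(1)] m_inv(2) by blast
  qed
  then have "0 < t" by (cases t) auto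
  have eq: "(\<iota> a \<ominus> \<iota> b) \<otimes> inv x = \<iota> c"
  proof -
    have "(\<iota> c \<otimes> x) \<otimes> inv x = \<iota> c \<otimes> (x \<otimes> inv x)" by (rule m_assoc[OF nat_carrier h(3) ix(1)])
    then show ?thesis using h(2) ix(2) by simp
  qed
  show ?case
  proof (cases "\<iota> a \<ominus> \<iota> b = \<iota> t")
    case True
    then have "\<iota> t \<otimes> inv x = \<iota> c \<ominus> \<iota> 0" using eq by (simp add: minus_eq)
    then show ?thesis using \<open>0 < t\<close> ix(1) by blast
  next
    case False
    then have "\<ominus> \<iota> t \<otimes> inv x = \<iota> c" using eq t by simp
    then have "\<iota> t \<otimes> inv x = \<ominus> \<iota> c" using ix(1) by (metis l_minus minus_minus nat_carrier m_closed)
    then have "\<iota> t \<otimes> inv x = \<iota> 0 \<ominus> \<iota> c" by (simp add: minus_eq)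
    then show ?thesis using \<open>0 < t\<close> ix(1) by blast
  qed
next
  case (eng_add x y)
  then obtain c a b c' a' b' where h: "0 < c" "\<iota> c \<otimes> x = \<iota> a \<ominus> \<iota> b" "x \<in> carrier C"
    "0 < c'" "\<iota> c' \<otimes> y = \<iota> a' \<ominus> \<iota> b'" "y \<in> carrier C" by blast
  note N = nat_carrier[of a] nat_carrier[of b] nat_carrier[of c] nat_carrier[of a'] nat_carrier[of b'] nat_carrier[of c']
  have "\<iota> (c * c') \<otimes> (x \<oplus> y) = \<iota> c' \<otimes> (\<iota> c \<otimes> x) \<oplus> \<iota> c \<otimes> (\<iota> c' \<otimes> y)"
    unfolding nat_mult using N h(3,6) by algebra
  also have "\<dots> = \<iota> (c' * a + c * a') \<ominus> \<iota> (c' * b + c * b')"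
    unfolding h(2,5) nat_mult nat_add using N by algebra
  finally show ?case using h by (metis a_closed nat_0_less_mult_iff)
next
  case (eng_mult x y)
  then obtain c a b c' a' b' where h: "0 < c" "\<iota> c \<otimes> x = \<iota> a \<ominus> \<iota> b" "x \<in> carrier C"
    "0 < c'" "\<iota> c' \<otimes> y = \<iota> a' \<ominus> \<iota> b'" "y \<in> carrier C" by blast
  note N = nat_carrier[of a] nat_carrier[of b] nat_carrier[of c] nat_carrier[of a'] nat_carrier[of b'] nat_carrier[of c']
  have "\<iota> (c * c') \<otimes> (x \<otimes> y) = (\<iota> c \<otimes> x) \<otimes> (\<iota> c' \<otimes> y)"
    unfolding nat_mult using N h(3,6) by algebra
  also have "\<dots> = \<iota> (a * a' + b * b') \<ominus> \<iota> (a * b' + b * a')"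
    unfolding h(2,5) nat_mult nat_add using N by algebra
  finally show ?case using h by (metis m_closed nat_0_less_mult_iff)
qed auto

lemma v_Qp:
  assumes "x \<in> Qp" "x \<noteq> \<zero>"
  obtains k :: int where "v x = real p powi k"
proof -
  have "adherent (generate_field C {}) x" using assms(1) adherent_Qp_iff by simp
  then have xc: "x \<in> carrier C" and "\<exists>y \<in> generate_field C {}. v (x \<ominus> y) < v x"
    using v_pos assms(2) unfolding adherent_def by auto
  then obtain y where y: "y \<in> generate_field C {}" "v (x \<ominus> y) < v x" by blast
  then obtain c a b where h: "0 < c" "\<iota> c \<otimes> y = \<iota> a \<ominus> \<iota> b" "y \<in> carrier C"
    using prime_field_fraction by blast
  have vy: "v y = v x" by (rule v_eq_of_close[OF xc h(3) y(2)])
  obtain t where t: "v (\<iota> a \<ominus> \<iota> b) = v (\<iota> t)" by (rule v_nat_diff)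
  have eq: "v (\<iota> c) * v y = v (\<iota> t)" using t h(2) v_mult[OF nat_carrier h(3)] by metis
  have "0 < t"
  proof (rule ccontr)
    assume "\<not> 0 < t"
    then have "v (\<iota> c) * v x = 0" using eq vy by simp
    then show False using nat_nonzero[OF h(1)] v_pos[OF nat_carrier] v_pos[OF xc assms(2)]
      by (metis mult_eq_0_iff order_less_irrefl)
  qed
  define i where "i = multiplicity p c"
  define j where "j = multiplicity p t"
  have "(1 / real p) ^ i * v x = (1 / real p) ^ j"
    using eq vy v_nat[OF h(1)] v_nat[OF \<open>0 < t\<close>] unfolding i_def j_def by simp
  then have "v x = real p ^ i / real p ^ j"
    using p_gt_1 by (simp add: power_one_over field_simps)
  also have "\<dots> = real p powi (int i - int j)"
    using p_gt_1 by (simp add: power_int_diff)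
  finally show ?thesis by (rule that)
qed

lemma v_nat_cong:
  assumes "m mod p = n mod p"
  shows "v (\<iota> m \<ominus> \<iota> n) < 1"
proof -
  obtain t where t: "v (\<iota> m \<ominus> \<iota> n) = v (\<iota> t)" "m = n + t \<or> n = m + t" by (rule v_nat_diff)
  have "p dvd t"
    using t(2) assms by (metis mod_eq_dvd_iff_nat add_diff_cancel_left' le_add1)
  then obtain s where "t = p * s" by (rule dvdE)
  then have "v (\<iota> t) = v (\<iota> p) * v (\<iota> s)" using nat_mult v_mult[OF nat_carrier nat_carrier] by metis
  also have "\<dots> \<le> 1 / real p * 1"
    unfolding v_p using v_nat_le[of s] by (intro mult_left_mono) auto
  also have "\<dots> < 1" using p_gt_1 by simp
  finally show ?thesis using t(1) by simp
qed

lemma prime_field_digit: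
  assumes "x \<in> carrier C" "0 < c" "\<iota> c \<otimes> x = \<iota> a \<ominus> \<iota> b" "v x \<le> 1"
  shows "\<exists>k<p. v (x \<ominus> \<iota> k) < 1"
  using assms(2,3)
proof (induction c arbitrary: a b rule: less_induct)
  case (less c)
  note xc = assms(1)
  show ?case
  proof (cases "p dvd c")
    case False
    have vc: "v (\<iota> c) = 1" by (rule v_nat_unit[OF False])
    have "coprime c p" using prime_imp_coprime[OF prime_p False] by (simp add: coprime_commute)
    then obtain d q where dq: "c * d = p * q + 1"
      using bezout_nat[of c p] less(2) by (auto simp: coprime_iff_gcd_eq_1)
    define M where "M = a + (p - 1) * b"
    define k where "k = (d * M) mod p"
    have kp: "k < p" unfolding k_def using p_gt_1 by simp
    have "(c * k) mod p = (c * d * M) mod p"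
      unfolding k_def by (simp add: mod_mult_right_eq mult.assoc)
    also have "c * d * M = M + p * (q * M)" unfolding dq by (simp add: algebra_simps)
    also have "(M + p * (q * M)) mod p = M mod p" by simp
    finally have cong: "v (\<iota> M \<ominus> \<iota> (c * k)) < 1" by (intro v_nat_cong) simp
    have cong2: "v (\<iota> (p * b) \<ominus> \<iota> 0) < 1" by (intro v_nat_cong) simp
    note N = nat_carrier[of a] nat_carrier[of b] nat_carrier[of c] nat_carrier[of k] nat_carrier[of M]
      nat_carrier[of "p * b"] nat_carrier[of "c * k"]
    have pb: "\<iota> M \<ominus> \<iota> (p * b) = \<iota> a \<ominus> \<iota> b"
    proof -
      have "a + p * b = M + b" unfolding M_def using p_gt_1 by (cases p) auto
      then have *: "\<iota> a \<oplus> \<iota> (p * b) = \<iota> M \<oplus> \<iota> b" by (metis nat_add)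
      have "\<iota> M \<ominus> \<iota> (p * b) = (\<iota> M \<oplus> \<iota> b) \<ominus> \<iota> b \<ominus> \<iota> (p * b)" using N by algebra
      also have "\<dots> = \<iota> a \<ominus> \<iota> b" unfolding *[symmetric] using N by algebra
      finally show ?thesis .
    qed
    have "\<iota> c \<otimes> (x \<ominus> \<iota> k) = \<iota> c \<otimes> x \<ominus> \<iota> (c * k)"
      unfolding nat_mult using N xc by algebra
    also have "\<dots> = (\<iota> M \<ominus> \<iota> (p * b)) \<ominus> \<iota> (c * k)"
      unfolding less(3) pb ..
    also have "\<dots> = (\<iota> M \<ominus> \<iota> (c * k)) \<ominus> (\<iota> (p * b) \<ominus> \<iota> 0)"
      using N nat_carrier[of 0] by (simp only: nat_zero) algebra
    finally have "v (\<iota> c \<otimes> (x \<ominus> \<iota> k)) < 1"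
      using v_minus_less[OF minus_closed[OF nat_carrier nat_carrier] minus_closed[OF nat_carrier nat_carrier] cong cong2]
      by (simp only:)
    moreover have "v (\<iota> c \<otimes> (x \<ominus> \<iota> k)) = v (\<iota> c) * v (x \<ominus> \<iota> k)"
      by (rule v_mult[OF nat_carrier minus_closed[OF xc nat_carrier]])
    ultimately have "v (x \<ominus> \<iota> k) < 1" unfolding vc by (simp only: mult_1_left)
    then show ?thesis using kp by blast
  next
    case True
    then obtain c' where c': "c = p * c'" by (rule dvdE)
    then have c'0: "0 < c'" "c' < c" using less(2) p_gt_1 by auto
    have p0: "\<iota> p \<noteq> \<zero>" using nat_nonzero p_gt_1 by simp
    have "v (\<iota> c \<otimes> x) = 1 / real p * (v (\<iota> c') * v x)"
      unfolding c' nat_mult using xc v_p by (simp add: v_mult)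
    also have "\<dots> \<le> 1 / real p * 1"
      by (rule mult_left_mono[OF mult_le_one[OF v_nat_le v_nonneg[OF xc] assms(4)]]) simp
    also have "\<dots> < 1" using p_gt_1 by simp
    finally have lt: "v (\<iota> a \<ominus> \<iota> b) < 1" unfolding less(3) .
    obtain t where t: "(\<iota> a \<ominus> \<iota> b = \<iota> t) \<or> (\<iota> a \<ominus> \<iota> b = \<ominus> \<iota> t)" using nat_diff_cases[of a b] by blast
    then have "v (\<iota> t) < 1" using lt v_minus[OF nat_carrier[of t]] by auto
    then have "p dvd t" using v_nat_unit[of t] by auto
    then obtain s where s: "t = p * s" by (rule dvdE)
    have assoc: "\<iota> c \<otimes> x = \<iota> p \<otimes> (\<iota> c' \<otimes> x)"
      unfolding c' nat_mult by (rule m_assoc[OF nat_carrier nat_carrier xc])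
    have cx: "\<iota> c' \<otimes> x \<in> carrier C" using xc by simp
    show ?thesis
    proof (cases "\<iota> a \<ominus> \<iota> b = \<iota> t")
      case True
      then have "\<iota> p \<otimes> (\<iota> c' \<otimes> x) = \<iota> p \<otimes> \<iota> s" using assoc less(3) nat_mult s by metis
      then have "\<iota> c' \<otimes> x = \<iota> s" using m_lcancel[OF p0 nat_carrier cx nat_carrier] by blast
      then have "\<iota> c' \<otimes> x = \<iota> s \<ominus> \<iota> 0" by (simp add: minus_eq)
      then show ?thesis by (rule less(1)[OF c'0(2,1)])
    next
      case False
      then have "\<iota> c \<otimes> x = \<ominus> (\<iota> p \<otimes> \<iota> s)" using t less(3) nat_mult s by metis
      then have "\<iota> p \<otimes> (\<iota> c' \<otimes> x) = \<iota> p \<otimes> (\<ominus> \<iota> s)" using assoc by (simp add: r_minus)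
      then have "\<iota> c' \<otimes> x = \<ominus> \<iota> s" using m_lcancel[OF p0 nat_carrier cx] by simp
      then have "\<iota> c' \<otimes> x = \<iota> 0 \<ominus> \<iota> s" by (simp add: minus_eq)
      then show ?thesis by (rule less(1)[OF c'0(2,1)])
    qed
  qed
qed

lemma Qp_digit:
  assumes "x \<in> Qp" "v x \<le> 1"
  obtains k where "k < p" "v (x \<ominus> \<iota> k) < 1"
proof -
  have "adherent (generate_field C {}) x" using assms(1) adherent_Qp_iff by simp
  then have xc: "x \<in> carrier C" and "\<exists>y \<in> generate_field C {}. v (x \<ominus> y) < 1"
    unfolding adherent_def by auto
  then obtain y where y: "y \<in> generate_field C {}" "v (x \<ominus> y) < 1" by blast
  then obtain c a b where h: "0 < c" "\<iota> c \<otimes> y = \<iota> a \<ominus> \<iota> b" "y \<in> carrier C"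
    using prime_field_fraction by blast
  have "y = x \<ominus> (x \<ominus> y)" using xc h(3) by algebra
  moreover have "v (x \<ominus> (x \<ominus> y)) \<le> 1" by (rule v_minus_le) (use xc h(3) y(2) assms(2) in auto)
  ultimately have "v y \<le> 1" by simp
  then obtain k where "k < p" "v (y \<ominus> \<iota> k) < 1" using prime_field_digit[OF h(3,1,2)] by blast
  then show ?thesis using that v_trans_less[OF xc h(3) nat_carrier y(2)] by blast
qed

section \<open>Roots of unity\<close>

lemma binomial_theorem:
  assumes w: "w \<in> carrier C"
  shows "(\<one> \<oplus> w) [^] n = (\<Oplus>k\<in>{..n}. \<iota> (n choose k) \<otimes> w [^] k)"
proof (induction n)
  case 0
  show ?case using w by simp
next
  case (Suc n)
  define A where "A m k = \<iota> (m choose k) \<otimes> w [^] k" for m k :: nat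
  have A: "A m k \<in> carrier C" for m k unfolding A_def using w by simp
  have S: "(\<Oplus>k\<in>J. A m (f k)) \<in> carrier C" for J :: "nat set" and m f using A by (auto intro: finsum_closed)
  have tail: "A n 0 \<oplus> (\<Oplus>k\<in>{..n}. A n (Suc k)) = (\<Oplus>k\<in>{..n}. A n k)"
  proof -
    have "(\<Oplus>k\<in>{..Suc n}. A n k) = A n (Suc n) \<oplus> (\<Oplus>k\<in>{..n}. A n k)" using A by (intro finsum_Suc) auto
    moreover have "A n (Suc n) = \<zero>" unfolding A_def using w by (simp add: binomial_eq_0)
    moreover have "(\<Oplus>k\<in>{..Suc n}. A n k) = (\<Oplus>k\<in>{..n}. A n (Suc k)) \<oplus> A n 0" using A by (intro finsum_Suc2) auto
    ultimately show ?thesis using S[of n "\<lambda>k. k"] S[of n Suc] A by (simp add: a_comm)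
  qed
  have "(\<Oplus>k\<in>{..Suc n}. A (Suc n) k) = (\<Oplus>k\<in>{..n}. A (Suc n) (Suc k)) \<oplus> A (Suc n) 0"
    using A by (intro finsum_Suc2) auto
  also have "(\<Oplus>k\<in>{..n}. A (Suc n) (Suc k)) = (\<Oplus>k\<in>{..n}. A n k \<otimes> w \<oplus> A n (Suc k))"
  proof (rule finsum_cong')
    fix k :: nat
    have "w [^] k \<in> carrier C" using w by simp
    then show "A (Suc n) (Suc k) = A n k \<otimes> w \<oplus> A n (Suc k)"
      unfolding A_def using w nat_carrier[of "n choose k"] nat_carrier[of "n choose Suc k"]
      by (simp only: binomial_Suc_Suc nat_add nat_pow_Suc) algebra
  qed (use A w in auto)
  also have "\<dots> = (\<Oplus>k\<in>{..n}. A n k) \<otimes> w \<oplus> (\<Oplus>k\<in>{..n}. A n (Suc k))"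
    using A w by (subst finsum_addf) (auto simp: finsum_ldistr)
  also have "A (Suc n) 0 = A n 0" unfolding A_def by simp
  finally have "(\<Oplus>k\<in>{..Suc n}. A (Suc n) k) = (\<Oplus>k\<in>{..n}. A n k) \<otimes> w \<oplus> (A n 0 \<oplus> (\<Oplus>k\<in>{..n}. A n (Suc k)))"
    using S[of n "\<lambda>k. k"] S[of n Suc] A w by (simp add: a_ac)
  also have "\<dots> = (\<Oplus>k\<in>{..n}. A n k) \<otimes> (\<one> \<oplus> w)"
    unfolding tail using S[of n "\<lambda>k. k"] w by (simp add: r_distr a_comm)
  also have "\<dots> = (\<one> \<oplus> w) [^] Suc n" using Suc.IH unfolding A_def by simp
  finally show ?case unfolding A_def by simp
qed

lemma v_Frobenius:
  assumes w: "w \<in> carrier C" "v w \<le> 1"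
  shows "v ((\<one> \<oplus> w) [^] p \<ominus> (\<one> \<oplus> w [^] p)) < 1"
proof -
  define f where "f k = \<iota> (p choose k) \<otimes> w [^] k" for k :: nat
  have f: "f k \<in> carrier C" for k unfolding f_def using w by simp
  have "{..p} = insert 0 (insert p {0<..<p})" using p_gt_1 by auto
  then have "(\<Oplus>k\<in>{..p}. f k) = f 0 \<oplus> (f p \<oplus> (\<Oplus>k\<in>{0<..<p}. f k))"
    using f p_gt_1 by (simp add: finsum_insert)
  moreover have "f 0 = \<one>" "f p = w [^] p" unfolding f_def using w by simp_all
  ultimately have "(\<one> \<oplus> w) [^] p = \<one> \<oplus> (w [^] p \<oplus> (\<Oplus>k\<in>{0<..<p}. f k))"
    using binomial_theorem[OF w(1), of p] unfolding f_def by simp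
  moreover have Sc: "(\<Oplus>k\<in>{0<..<p}. f k) \<in> carrier C" using f by (auto intro: finsum_closed)
  moreover have "w [^] p \<in> carrier C" using w by simp
  ultimately have "(\<one> \<oplus> w) [^] p \<ominus> (\<one> \<oplus> w [^] p) = (\<Oplus>k\<in>{0<..<p}. f k)"
    using one_closed by (simp only:) algebra
  moreover have "v (\<Oplus>k\<in>{0<..<p}. f k) < 1"
  proof (rule v_finsum_less)
    fix k assume k: "k \<in> {0<..<p}"
    have "p dvd (p choose k)" using k by (intro dvd_choose_prime prime_p) auto
    then have "v (\<iota> (p choose k)) < 1" using v_nat_cong[of "p choose k" 0] by (simp add: minus_eq)
    moreover have "v w ^ k \<le> 1" by (rule power_le_one[OF v_nonneg[OF w(1)] w(2)])
    then have "v (\<iota> (p choose k)) * v w ^ k \<le> v (\<iota> (p choose k)) * 1"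
      by (rule mult_left_mono[OF _ v_nonneg[OF nat_carrier]])
    moreover have "v (f k) = v (\<iota> (p choose k)) * v w ^ k"
      unfolding f_def v_mult[OF nat_carrier nat_pow_closed[OF w(1)]] v_pow[OF w(1)] ..
    ultimately show "v (f k) < 1" by linarith
  qed (use f in auto)
  ultimately show ?thesis by simp
qed

lemma v_root_one:
  assumes z: "z \<in> carrier C" "v z \<le> 1" "v (z [^] p \<ominus> \<one>) < 1"
  shows "v (z \<ominus> \<one>) < 1"
proof -
  define w where "w = z \<ominus> \<one>"
  have w: "w \<in> carrier C" "v w \<le> 1" unfolding w_def using z by (auto intro!: v_minus_le simp: v_one)
  have zw: "z = \<one> \<oplus> w" unfolding w_def using z(1) one_closed by algebra
  have wp: "w [^] p \<in> carrier C" "z [^] p \<in> carrier C" using w z by auto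
  have F: "v (z [^] p \<ominus> (\<one> \<oplus> w [^] p)) < 1" using v_Frobenius[OF w] zw by simp
  have "w [^] p = (z [^] p \<ominus> \<one>) \<ominus> (z [^] p \<ominus> (\<one> \<oplus> w [^] p))" using wp one_closed by algebra
  then have "v (w [^] p) < 1" using v_minus_less[OF _ _ z(3) F] wp by simp
  then have "v w ^ p < 1" using w by (simp add: v_pow)
  then have "v w < 1" using w(2) by (cases "v w = 1") auto
  then show ?thesis unfolding w_def .
qed

lemma v_root_one_power:
  assumes z: "z \<in> carrier C" "v z = 1"
  shows "v (z [^] (p ^ a) \<ominus> \<one>) < 1 \<Longrightarrow> v (z \<ominus> \<one>) < 1"
proof (induction a)
  case 0
  then show ?case using z by simp
next
  case (Suc a)
  have eq: "z [^] (p ^ Suc a) = (z [^] (p ^ a)) [^] p"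
    unfolding nat_pow_pow[OF z(1)] by (simp only: power_Suc2)
  have "v (z [^] (p ^ a)) \<le> 1" unfolding v_pow[OF z(1)] z(2) by simp
  then have "v (z [^] (p ^ a) \<ominus> \<one>) < 1"
    using Suc.prems unfolding eq by (rule v_root_one[OF nat_pow_closed[OF z(1)]])
  then show ?case by (rule Suc.IH)
qed

text \<open>Here \<open>s\<close> is \<open>1 + x + \<dots> + x ^ (n - 1)\<close>.\<close>

lemma geometric_sum_exists:
  assumes x: "x \<in> carrier C" "v (x \<ominus> \<one>) < 1"
  shows "\<exists>s \<in> carrier C. (x \<ominus> \<one>) \<otimes> s = x [^] (n::nat) \<ominus> \<one> \<and> v (s \<ominus> \<iota> n) < 1"
proof (induction n)
  case 0
  show ?case using x by (intro bexI[of _ \<zero>]) (auto simp: minus_eq r_neg)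
next
  case (Suc n)
  then obtain s where s: "s \<in> carrier C" "(x \<ominus> \<one>) \<otimes> s = x [^] n \<ominus> \<one>" "v (s \<ominus> \<iota> n) < 1" by blast
  have xn: "x [^] n \<in> carrier C" using x by simp
  have "(x \<ominus> \<one>) \<otimes> (s \<otimes> x \<oplus> \<one>) = ((x \<ominus> \<one>) \<otimes> s) \<otimes> x \<oplus> (x \<ominus> \<one>)" using s(1) x(1) one_closed by algebra
  also have "\<dots> = x [^] n \<otimes> x \<ominus> \<one>" unfolding s(2) using xn x(1) one_closed by algebra
  finally have 1: "(x \<ominus> \<one>) \<otimes> (s \<otimes> x \<oplus> \<one>) = x [^] Suc n \<ominus> \<one>" by simp
  have "s = (s \<ominus> \<iota> n) \<oplus> \<iota> n" using s(1) nat_carrier[of n] by algebra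
  moreover have "v ((s \<ominus> \<iota> n) \<oplus> \<iota> n) \<le> 1" by (rule v_add_le) (use s v_nat_le in auto)
  ultimately have vs: "v s \<le> 1" by simp
  have sx: "v (s \<otimes> (x \<ominus> \<one>)) < 1"
  proof -
    have "v (s \<otimes> (x \<ominus> \<one>)) = v s * v (x \<ominus> \<one>)" using s(1) x(1) by (simp add: v_mult)
    also have "\<dots> \<le> 1 * v (x \<ominus> \<one>)" using vs x(1) by (intro mult_right_mono v_nonneg) auto
    finally show ?thesis using x(2) by simp
  qed
  have "v (s \<otimes> (x \<ominus> \<one>) \<oplus> (s \<ominus> \<iota> n)) < 1"
    by (rule v_add_less[OF _ _ sx s(3)]) (use s(1) x(1) in auto)
  moreover have "(s \<otimes> x \<oplus> \<one>) \<ominus> \<iota> (Suc n) = s \<otimes> (x \<ominus> \<one>) \<oplus> (s \<ominus> \<iota> n)"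
  proof -
    have "\<iota> (Suc n) = \<iota> n \<oplus> \<one>" by simp
    then show ?thesis using s(1) x(1) nat_carrier[of n] one_closed by (simp only:) algebra
  qed
  ultimately have "v ((s \<otimes> x \<oplus> \<one>) \<ominus> \<iota> (Suc n)) < 1" by simp
  then show ?case using 1 s(1) x(1) by (intro bexI[of _ "s \<otimes> x \<oplus> \<one>"]) auto
qed

lemma v_root_of_unity:
  assumes "x \<in> carrier C" "x [^] m = \<one>" "0 < (m::nat)"
  shows "v x = 1"
proof -
  have "v x ^ m = 1" using assms v_pow[OF assms(1), of m] v_one by simp
  then show ?thesis using power_eq_imp_eq_base[of "v x" m 1] v_nonneg[OF assms(1)] assms(3) by simp
qed

lemma roots_of_unity_apart:
  assumes x: "x \<in> carrier C" "x [^] m = \<one>" and y: "y \<in> carrier C" "y [^] m = \<one>"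
    and m: "\<not> p dvd m" and lt: "v (x \<ominus> y) < 1"
  shows "x = y"
proof -
  have m0: "0 < m" using m by (cases m) auto
  have vy: "v y = 1" by (rule v_root_of_unity[OF y m0])
  then have y0: "y \<noteq> \<zero>" by auto
  have iy: "inv y \<in> carrier C" "y \<otimes> inv y = \<one>" using inv_nonzero_closed mult_inv_cancel y(1) y0 by auto
  have viy: "v (inv y) = 1" using v_inv[OF y(1) y0] vy by simp
  define z where "z = x \<otimes> inv y"
  have z: "z \<in> carrier C" unfolding z_def using x iy by simp
  have zm: "z [^] m = \<one>"
  proof -
    have "z [^] m = z [^] m \<otimes> y [^] m" using y(2) z by simp
    also have "\<dots> = (z \<otimes> y) [^] m" using z y(1) by (simp add: nat_pow_distrib)
    also have "z \<otimes> y = x \<otimes> (y \<otimes> inv y)" unfolding z_def using x(1) y(1) iy(1) by algebra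
    also have "\<dots> = x" using iy(2) x(1) by simp
    finally show ?thesis using x(2) by simp
  qed
  have xy: "x \<ominus> y = (z \<ominus> \<one>) \<otimes> y"
  proof -
    have "(z \<ominus> \<one>) \<otimes> y = x \<otimes> (y \<otimes> inv y) \<ominus> y" unfolding z_def using x(1) y(1) iy(1) one_closed by algebra
    then show ?thesis using iy(2) x(1) by simp
  qed
  then have "v (z \<ominus> \<one>) < 1" using lt vy z y(1) v_mult[of "z \<ominus> \<one>" y] by simp
  then obtain s where s: "s \<in> carrier C" "(z \<ominus> \<one>) \<otimes> s = z [^] m \<ominus> \<one>" "v (s \<ominus> \<iota> m) < 1"
    using geometric_sum_exists[OF z, of m] by blast
  then have "(z \<ominus> \<one>) \<otimes> s = \<zero>" using zm by (simp add: minus_eq r_neg)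
  moreover have "s \<noteq> \<zero>"
  proof
    assume "s = \<zero>"
    then have "v (\<iota> m) < 1" using s(3) v_minus[OF nat_carrier[of m]] by (simp add: minus_eq)
    then show False using v_nat_unit[OF m] by simp
  qed
  ultimately have "z \<ominus> \<one> = \<zero>" using integral[of "z \<ominus> \<one>" s] s(1) z by auto
  then have "x \<ominus> y = \<zero>" using xy y(1) by simp
  then show ?thesis using x(1) y(1) by simp
qed

lemma polyfun_power:
  assumes "subring K C"
  shows "polyfun K n \<one> (\<lambda>x. x [^] n)"
proof (induction n)
  case 0
  show ?case using polyfun_const[of \<one> K] subringE(1,3)[OF assms] by simp
next
  case (Suc n)
  have "polyfun K (Suc n) \<one> (\<lambda>x. x [^] n \<otimes> x \<oplus> \<zero>)"
    by (rule polyfun_Suc[OF Suc subringE(2,1)[OF assms]])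
  then show ?case by (rule polyfun_cong) simp
qed

lemma polyfun_roots_of_unity:
  assumes "subring K C" "0 < n"
  shows "polyfun K n \<one> (\<lambda>x. x [^] n \<oplus> \<ominus> \<one>)"
  using polyfun_add_const[OF assms(1), of "n - 1" \<one> "\<lambda>x. x [^] n" "\<ominus> \<one>"] polyfun_power[OF assms(1), of n]
    assms(2) subringE(3,5)[OF assms(1)] by simp

text \<open>Krasner's lemma for roots of unity of order prime to \<open>p\<close>.\<close>

lemma Teichmuller:
  assumes F: "intermediate F" and y: "y \<in> F" "v y = 1" and m: "\<not> p dvd m" "v (y [^] m \<ominus> \<one>) < 1"
  obtains \<eta> where "\<eta> \<in> F" "\<eta> [^] m = \<one>" "v (y \<ominus> \<eta>) < 1"
proof -
  have m0: "0 < m" using m(1) by (cases m) auto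
  have yc: "y \<in> carrier C" "y \<in> Qp_bar" using y intermediateD(3,5)[OF F] by auto
  have f: "polyfun Qp_bar (Suc (m - 1)) \<one> (\<lambda>x. x [^] m \<oplus> \<ominus> \<one>)"
    using polyfun_roots_of_unity[OF subfieldE(1)[OF subfield_Qp_bar] m0] m0 by simp
  have "\<exists>b \<in> Qp_bar. b [^] m \<oplus> \<ominus> \<one> = \<zero> \<and> v (y \<ominus> b) < 1"
    by (rule polyfun_close_root_strict[OF f one_not_zero yc(1) zero_less_one])
      (use m(2) in \<open>simp add: v_one minus_eq\<close>)
  then obtain \<eta> where \<eta>: "\<eta> \<in> Qp_bar" "\<eta> [^] m \<oplus> \<ominus> \<one> = \<zero>" "v (y \<ominus> \<eta>) < 1" by blast
  have \<eta>c: "\<eta> \<in> carrier C" using \<eta>(1) Qp_bar_carrier by auto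
  have \<eta>m: "\<eta> [^] m = \<one>"
    using \<eta>(2) \<eta>c r_right_minus_eq[of "\<eta> [^] m" \<one>] by (simp add: minus_eq)
  have "\<eta> \<in> F"
  proof (rule fixed_by_abs_Galois[OF F \<eta>(1)])
    fix g assume g: "g \<in> abs_Galois F"
    have g\<eta>: "g \<eta> \<in> Qp_bar" "g \<eta> \<in> carrier C" using abs_Galois_closed[OF g \<eta>(1)] Qp_bar_carrier by auto
    have gm: "g \<eta> [^] m = \<one>"
      using abs_Galois_pow[OF g \<eta>(1), of m] \<eta>m embeddingD(3)[OF abs_Galois_embedding[OF g]] by simp
    have "g (y \<ominus> \<eta>) = y \<ominus> g \<eta>"
      using abs_Galois_minus_closed[OF g yc(2) \<eta>(1)] abs_Galois_fixes[OF g y(1)] by simp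
    then have "v (y \<ominus> g \<eta>) < 1"
      using abs_Galois_isometry[OF F g Qp_bar_closed(4)[OF yc(2) \<eta>(1)]] \<eta>(3) by simp
    then have "v (g \<eta> \<ominus> y) < 1" using v_minus_commute[OF g\<eta>(2) yc(1)] by simp
    then have "v (g \<eta> \<ominus> \<eta>) < 1" by (rule v_trans_less[OF g\<eta>(2) yc(1) \<eta>c _ \<eta>(3)])
    then show "g \<eta> = \<eta>" by (rule roots_of_unity_apart[OF g\<eta>(2) gm \<eta>c \<eta>m m(1)])
  qed
  then show ?thesis using that \<eta>m \<eta>(3) by blast
qed

section \<open>Finite extensions\<close>

lemma Span_dimension_le:
  assumes K: "subfield K C" and "set Us \<subseteq> carrier C"
  shows "\<exists>n\<le>length Us. dimension n K (Span K Us)"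
  using assms(2)
proof (induction Us)
  case Nil
  then show ?case using zero_dim by auto
next
  case (Cons u Us)
  then obtain n where n: "n \<le> length Us" "dimension n K (Span K Us)" and u: "u \<in> carrier C" "set Us \<subseteq> carrier C" by auto
  show ?case
  proof (cases "u \<in> Span K Us")
    case True
    then have "set (u # Us) \<subseteq> Span K Us" using Span_base_incl[OF K u(2)] by auto
    then have "Span K (u # Us) = Span K Us"
      using mono_Span_subset[OF K _ u(2)] mono_Span[OF K u(2,1)] by blast
    then show ?thesis using n by (intro exI[of _ n]) simp
  next
    case False
    then have "dimension (Suc n) K (Span K (u # Us))" using Suc_dim[OF u(1) False n(2)] by simp
    then show ?thesis using n(1) by (intro exI[of _ "Suc n"]) simp
  qed
qed

lemma degree_Irr_le_dimension:
  assumes K: "intermediate K" and F: "intermediate F" "dimension N K F" and x: "x \<in> F"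
  shows "degree (Irr K x) \<le> N"
proof -
  have xb: "x \<in> Qp_bar" "x \<in> carrier C" using x intermediateD(3,5)[OF F(1)] by auto
  have pow: "x [^] n \<in> F" for n :: nat
    by (induction n) (use x subringE(3,6)[OF intermediateD(2)[OF F(1)]] in auto)
  have "independent K (exp_base x (degree (Irr K x)))"
    using exp_base_independent[OF intermediateD(1)[OF K] xb(2) algebraic_over_intermediate[OF K xb(1)]] .
  moreover have "set (exp_base x (degree (Irr K x))) \<subseteq> F" using pow unfolding exp_base_def by auto
  ultimately have "length (exp_base x (degree (Irr K x))) \<le> N"
    by (rule independent_length_le_dimension[OF intermediateD(1)[OF K] F(2)])
  then show ?thesis unfolding exp_base_def by simp
qed

lemma eval_zeros: "set q \<subseteq> {\<zero>} \<Longrightarrow> y \<in> carrier C \<Longrightarrow> eval q y = \<zero>"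
  by (induction q) auto

lemma eval_value:
  assumes K: "subfield K C" and y: "y \<in> carrier C" "y \<noteq> \<zero>" and "set q \<subseteq> K"
  shows "set q \<subseteq> {\<zero>} \<or> (\<exists>i<length q. \<exists>a\<in>K - {\<zero>}. v (eval q y) = v a * v y ^ i) \<or>
    (\<exists>k. 0 < k \<and> k < length q \<and> (\<exists>a\<in>K - {\<zero>}. v y ^ k = v a))"
  using assms(4)
proof (induction q)
  case Nil
  then show ?case by simp
next
  case (Cons b q)
  note Kc = subfieldE(3)[OF K]
  have b: "b \<in> K" "b \<in> carrier C" and q: "set q \<subseteq> K" "set q \<subseteq> carrier C" using Cons Kc by auto
  have e: "eval q y \<in> carrier C" by (rule eval_in_carrier[OF q(2) y(1)])
  have yn: "y [^] length q \<in> carrier C" using y by simp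
  define n where "n = length q"
  show ?case
  proof (cases "b = \<zero>")
    case True
    then have "eval (b # q) y = eval q y" using e yn by simp
    then show ?thesis using Cons.IH[OF q(1)] True by (auto simp: less_Suc_eq)
  next
    case False
    have ev: "eval (b # q) y = b \<otimes> y [^] n \<oplus> eval q y" unfolding n_def by simp
    have vb: "v (b \<otimes> y [^] n) = v b * v y ^ n" using b y by (simp add: v_mult v_pow)
    consider "set q \<subseteq> {\<zero>}" | i a where "i < n" "a \<in> K - {\<zero>}" "v (eval q y) = v a * v y ^ i"
      | "\<exists>k. 0 < k \<and> k < length q \<and> (\<exists>a\<in>K - {\<zero>}. v y ^ k = v a)"
      using Cons.IH[OF q(1)] unfolding n_def by blast
    then show ?thesis
    proof cases
      case 1
      then have "v (eval (b # q) y) = v b * v y ^ n"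
        using ev vb eval_zeros[OF 1 y(1)] b y by simp
      then have "\<exists>i<length (b # q). \<exists>a\<in>K - {\<zero>}. v (eval (b # q) y) = v a * v y ^ i"
        using False b unfolding n_def by (intro exI[of _ "length q"]) auto
      then show ?thesis by blast
    next
      case 2
      have ac: "a \<in> carrier C" using 2 Kc by auto
      show ?thesis
      proof (cases "v b * v y ^ n = v a * v y ^ i")
        case True
        have ib: "inv b \<in> K - {\<zero>}" using subfield_m_inv(1)[OF K, of b] b False by auto
        have vy: "0 < v y" and vb0: "0 < v b" using v_pos y b False by auto
        have "v y ^ n = v y ^ (n - i) * v y ^ i" using \<open>i < n\<close> by (simp add: power_add[symmetric])
        then have "v b * v y ^ (n - i) = v a" using True vy by simp
        then have "v y ^ (n - i) = v a * inverse (v b)" using vb0 by (simp add: field_simps)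
        also have "\<dots> = v (a \<otimes> inv b)" using ac ib Kc v_inv[OF b(2) False] by (subst v_mult) auto
        finally have "v y ^ (n - i) = v (a \<otimes> inv b)" .
        moreover have "a \<otimes> inv b \<in> K - {\<zero>}"
          using 2 ib subringE(6)[OF subfieldE(1)[OF K]] integral[of a "inv b"] ac Kc by auto
        ultimately have "0 < n - i \<and> n - i < length (b # q) \<and> (\<exists>a\<in>K - {\<zero>}. v y ^ (n - i) = v a)"
          using \<open>i < n\<close> unfolding n_def by auto
        then show ?thesis by blast
      next
        case False
        then have "v (eval (b # q) y) = max (v b * v y ^ n) (v a * v y ^ i)"
          unfolding ev using v_add_eq_max[of "b \<otimes> y [^] n" "eval q y"] b y e vb 2(3) by simp
        then consider (new) "v (eval (b # q) y) = v b * v y ^ n" | (old) "v (eval (b # q) y) = v a * v y ^ i"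
          by (metis max_def)
        then have "\<exists>i<length (b # q). \<exists>a\<in>K - {\<zero>}. v (eval (b # q) y) = v a * v y ^ i"
        proof cases
          case new
          then show ?thesis using \<open>b \<noteq> \<zero>\<close> b unfolding n_def by (intro exI[of _ "length q"]) auto
        next
          case old
          then show ?thesis using 2(1,2) unfolding n_def by (intro exI[of _ i]) auto
        qed
        then show ?thesis by blast
      qed
    next
      case 3
      then have "\<exists>k. 0 < k \<and> k < length (b # q) \<and> (\<exists>a\<in>K - {\<zero>}. v y ^ k = v a)"
        by (metis length_Cons less_SucI)
      then show ?thesis by blast
    qed
  qed
qed

lemma intermediate_Qp: "intermediate Qp"
  unfolding intermediate_def using subfield_Qp intermediateD(4)[OF intermediate_Qp_bar] by auto

lemma finite_ext_discrete:
  assumes F: "intermediate F" "dimension N Qp F" and y: "y \<in> F" "y \<noteq> \<zero>"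
  obtains k :: int where "v y ^ fact N = real p powi k"
proof -
  have yb: "y \<in> Qp_bar" "y \<in> carrier C" using y intermediateD(3,5)[OF F(1)] by auto
  note Irr = Irr_polyfun[OF intermediate_Qp yb(1)]
  define q where "q = Irr Qp y"
  have len: "length q \<le> Suc N" using degree_Irr_le_dimension[OF intermediate_Qp F y(1)] unfolding q_def by simp
  have hd: "hd q = \<one>"
    unfolding q_def by (rule IrrE(3)[OF subfield_Qp yb(2) algebraic_over_intermediate[OF intermediate_Qp yb(1)]])
  have ne: "q \<noteq> []" using Irr(3) unfolding q_def by auto
  have sub: "set q \<subseteq> Qp" using Irr(4) polynomial_incl univ_poly_carrier unfolding q_def by blast
  have vy: "0 < v y" using v_pos yb y by auto
  have "\<not> set q \<subseteq> {\<zero>}" using hd ne hd_in_set one_not_zero by fastforce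
  moreover have "\<not> (\<exists>i<length q. \<exists>a\<in>Qp - {\<zero>}. v (eval q y) = v a * v y ^ i)"
  proof
    assume "\<exists>i<length q. \<exists>a\<in>Qp - {\<zero>}. v (eval q y) = v a * v y ^ i"
    then obtain i a where a: "a \<in> Qp" "a \<noteq> \<zero>" "v (eval q y) = v a * v y ^ i" by blast
    then have "0 < v a" using v_pos subfieldE(3)[OF subfield_Qp] by auto
    then have "0 < v (eval q y)" using a(3) vy by simp
    then show False using Irr(2) unfolding q_def by simp
  qed
  ultimately obtain k a where k: "0 < k" "k < length q" "a \<in> Qp - {\<zero>}" "v y ^ k = v a"
    using eval_value[OF subfield_Qp yb(2) y(2) sub] by blast
  obtain j :: int where j: "v a = real p powi j"
    by (rule v_Qp[of a]) (use k(3) in auto)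
  have "k dvd fact N" using k(1,2) len by (intro dvd_fact) auto
  then obtain t where t: "fact N = k * t" by (rule dvdE)
  have "v y ^ fact N = (v y ^ k) ^ t" unfolding t by (rule power_mult)
  also have "\<dots> = (real p powi j) ^ t" using k(4) j by simp
  also have "\<dots> = real p powi (j * int t)" by (simp add: power_int_mult)
  finally show ?thesis by (rule that)
qed

definition residually_independent :: "'a list \<Rightarrow> bool"
  where "residually_independent bs \<longleftrightarrow> (\<forall>ks. set ks \<subseteq> Qp \<longrightarrow> length ks = length bs \<longrightarrow>
    (\<forall>k\<in>set ks. v k \<le> 1) \<longrightarrow> v (combine ks bs) < 1 \<longrightarrow> (\<forall>k\<in>set ks. v k < 1))"

lemma residually_independentD:
  "\<lbrakk>residually_independent bs; set ks \<subseteq> Qp; length ks = length bs; \<And>k. k \<in> set ks \<Longrightarrow> v k \<le> 1;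
    v (combine ks bs) < 1; k \<in> set ks\<rbrakk> \<Longrightarrow> v k < 1"
  unfolding residually_independent_def by blast

lemma residually_independent_imp_independent:
  assumes "residually_independent bs" "set bs \<subseteq> carrier C"
  shows "independent Qp bs"
  using assms
proof (induction bs)
  case Nil
  show ?case by simp
next
  case (Cons b bs)
  note Q = subfieldE(1,3)[OF subfield_Qp]
  have b: "b \<in> carrier C" "set bs \<subseteq> carrier C" using Cons by auto
  have "residually_independent bs"
    unfolding residually_independent_def
  proof (intro allI impI ballI)
    fix ks k assume ks: "set ks \<subseteq> Qp" "length ks = length bs" "\<forall>k\<in>set ks. v k \<le> 1" "v (combine ks bs) < 1" "k \<in> set ks"
    have "combine ks bs \<in> carrier C" using ks(1) Q(2) b(2) by auto
    then have eq: "combine (\<zero> # ks) (b # bs) = combine ks bs" using b(1) by simp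
    show "v k < 1"
    proof (rule residually_independentD[OF Cons.prems(1)])
      show "set (\<zero> # ks) \<subseteq> Qp" using ks(1) subringE(2)[OF Q(1)] by simp
      show "length (\<zero> # ks) = length (b # bs)" using ks(2) by simp
      show "v l \<le> 1" if "l \<in> set (\<zero> # ks)" for l using that ks(3) by auto
      show "v (combine (\<zero> # ks) (b # bs)) < 1" unfolding eq by (rule ks(4))
      show "k \<in> set (\<zero> # ks)" using ks(5) by simp
    qed
  qed
  then have ind: "independent Qp bs" using Cons.IH b(2) by blast
  have "b \<notin> Span Qp bs"
  proof
    assume "b \<in> Span Qp bs"
    then obtain k ks where k: "k \<in> Qp - {\<zero>}" "set ks \<subseteq> Qp" "length ks = length bs" "combine (k # ks) (b # bs) = \<zero>"
      by (rule Span_mem_imp_non_trivial_combine[OF subfield_Qp b(2)])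
    define L where "L = k # ks"
    have L: "set L \<subseteq> Qp" "finite (v ` set L)" "v ` set L \<noteq> {}" "set L \<subseteq> carrier C" unfolding L_def using k Q(2) by auto
    obtain c where c: "c \<in> set L" "v c = Max (v ` set L)" using Max_in[OF L(2,3)] by auto
    have max: "v l \<le> v c" if "l \<in> set L" for l using c(2) Max_ge[OF L(2)] that by simp
    have kc: "k \<in> carrier C" using k(1) Q(2) by auto
    have "0 < v k" using v_pos kc k(1) by auto
    then have vc: "0 < v c" using max[of k] unfolding L_def by simp
    then have c0: "c \<in> Qp - {\<zero>}" using c(1) L(1) by auto
    then have ic: "inv c \<in> Qp" "inv c \<in> carrier C" "c \<in> carrier C" using subfield_m_inv(1)[OF subfield_Qp c0] Q(2) by auto
    have vic: "v (inv c) = inverse (v c)" using v_inv ic(3) c0 by auto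
    define M where "M = map ((\<otimes>) (inv c)) L"
    have "combine M (b # bs) = inv c \<otimes> combine L (b # bs)"
      unfolding M_def using combine_r_distr[of L "b # bs" "inv c"] L(4) b ic by auto
    also have "\<dots> = \<zero>" using k(4) ic unfolding L_def by simp
    finally have cM: "v (combine M (b # bs)) < 1" by simp
    have vM: "v (inv c \<otimes> l) = v l / v c" if "l \<in> set L" for l
      using that L(4) ic vic by (subst v_mult) (auto simp: divide_inverse)
    have mem: "inv c \<otimes> c \<in> set M" unfolding M_def using c(1) by auto
    have "v (inv c \<otimes> c) < 1"
    proof (rule residually_independentD[OF Cons.prems(1) _ _ _ cM mem])
      show "set M \<subseteq> Qp" unfolding M_def using L(1) ic subringE(6)[OF Q(1)] by auto
      show "length M = length (b # bs)" unfolding M_def L_def using k(3) by simp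
      show "v l \<le> 1" if "l \<in> set M" for l
      proof -
        obtain z where z: "z \<in> set L" "l = inv c \<otimes> z" using \<open>l \<in> set M\<close> unfolding M_def by auto
        show ?thesis unfolding z(2) vM[OF z(1)] using max[OF z(1)] vc by simp
      qed
    qed
    moreover have "v (inv c \<otimes> c) = 1" unfolding vM[OF c(1)] using vc by simp
    ultimately show False by simp
  qed
  then show ?case using li_Cons[OF b(1) _ ind] by blast
qed

lemma combine_close:
  assumes "length ks = length bs" "length ds = length bs" "set ks \<subseteq> carrier C" "set ds \<subseteq> carrier C"
    and "set bs \<subseteq> carrier C" "\<And>b. b \<in> set bs \<Longrightarrow> v b \<le> 1" "\<And>i. i < length bs \<Longrightarrow> v (ks ! i \<ominus> ds ! i) < 1"
  shows "v (combine ks bs \<ominus> combine ds bs) < 1"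
  using assms
proof (induction bs arbitrary: ks ds)
  case Nil
  then show ?case by (simp add: minus_eq r_neg)
next
  case (Cons b bs)
  obtain k ks' d ds' where kd: "ks = k # ks'" "ds = d # ds'"
    using Cons.prems(1,2) by (metis length_Suc_conv length_Cons)
  have carr: "k \<in> carrier C" "d \<in> carrier C" "b \<in> carrier C" using Cons.prems kd by auto
  have c2: "combine ks' bs \<in> carrier C" "combine ds' bs \<in> carrier C" using Cons.prems kd by auto
  have IH: "v (combine ks' bs \<ominus> combine ds' bs) < 1"
  proof (rule Cons.IH)
    show "v (ks' ! i \<ominus> ds' ! i) < 1" if "i < length bs" for i
      using Cons.prems(7)[of "Suc i"] that kd by simp
  qed (use Cons.prems kd in auto)
  have kd1: "v (k \<ominus> d) < 1" using Cons.prems(7)[of 0] kd by simp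
  have "v ((k \<ominus> d) \<otimes> b) < 1"
  proof -
    have "v ((k \<ominus> d) \<otimes> b) = v (k \<ominus> d) * v b" using carr by (simp add: v_mult)
    also have "\<dots> \<le> v (k \<ominus> d) * 1" using Cons.prems(6) carr by (intro mult_left_mono v_nonneg) auto
    finally show ?thesis using kd1 by simp
  qed
  then have "v ((k \<ominus> d) \<otimes> b \<oplus> (combine ks' bs \<ominus> combine ds' bs)) < 1"
    using IH carr c2 by (intro v_add_less) auto
  moreover have "combine ks bs' \<ominus> combine ds bs' = (k \<ominus> d) \<otimes> b \<oplus> (combine ks' bs \<ominus> combine ds' bs)"
    if "bs' = b # bs" for bs'
    unfolding that kd combine.simps using carr c2 by algebra
  ultimately show ?case by simp
qed

lemma finite_ext_residues:
  assumes F: "intermediate F" "dimension N Qp F"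
  obtains A where "finite A" "A \<subseteq> carrier C" "\<And>x. \<lbrakk>x \<in> F; v x \<le> 1\<rbrakk> \<Longrightarrow> \<exists>a\<in>A. v (x \<ominus> a) < 1"
proof -
  note Fc = intermediateD(3)[OF F(1)]
  note Q = subfieldE(1,3)[OF subfield_Qp]
  define P where "P bs \<longleftrightarrow> residually_independent bs \<and> set bs \<subseteq> {x \<in> F. v x \<le> 1}" for bs
  have "P []" unfolding P_def residually_independent_def by simp
  have bound: "length bs \<le> N" if "P bs" for bs
  proof -
    have "independent Qp bs" using residually_independent_imp_independent that Fc unfolding P_def by blast
    then show ?thesis
      using independent_length_le_dimension[OF subfield_Qp F(2)] that unfolding P_def by blast
  qed
  then have "\<forall>cs. P cs \<longrightarrow> length cs < Suc N" by (simp add: less_Suc_eq_le)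
  then obtain bs where bs: "P bs" "\<And>cs. P cs \<Longrightarrow> length cs \<le> length bs"
    using ex_has_greatest_nat[of P "[]" length "Suc N", OF \<open>P []\<close>] by blast
  have bsF: "set bs \<subseteq> carrier C" "\<And>b. b \<in> set bs \<Longrightarrow> v b \<le> 1" and ri: "residually_independent bs"
    using bs(1) Fc unfolding P_def by auto
  define \<Delta> where "\<Delta> = {ds. set ds \<subseteq> \<iota> ` {..<p} \<and> length ds = length bs}"
  define A where "A = (\<lambda>ds. combine ds bs) ` \<Delta>"
  have "finite \<Delta>" unfolding \<Delta>_def by (intro finite_lists_length_eq) auto
  then have "finite A" unfolding A_def by simp
  moreover have "A \<subseteq> carrier C" unfolding A_def \<Delta>_def using bsF(1) by (auto intro!: combine_in_carrier)
  moreover have "\<exists>a\<in>A. v (x \<ominus> a) < 1" if x: "x \<in> F" "v x \<le> 1" for x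
  proof -
    have xc: "x \<in> carrier C" using x Fc by auto
    have "\<not> P (x # bs)" using bs(2)[of "x # bs"] by auto
    then have "\<not> residually_independent (x # bs)" using bs(1) x unfolding P_def by auto
    then obtain L where L: "set L \<subseteq> Qp" "length L = length (x # bs)" "\<forall>k\<in>set L. v k \<le> 1"
      "v (combine L (x # bs)) < 1" "\<not> (\<forall>k\<in>set L. v k < 1)"
      unfolding residually_independent_def by blast
    obtain k ks where kks: "L = k # ks" using L(2) by (cases L) auto
    have k: "k \<in> Qp" "v k \<le> 1" "set ks \<subseteq> Qp" "length ks = length bs" "\<And>l. l \<in> set ks \<Longrightarrow> v l \<le> 1"
      using L kks by auto
    have kc: "k \<in> carrier C" "set ks \<subseteq> carrier C" using k Q(2) by auto
    have cc: "combine ks bs \<in> carrier C" using kc(2) bsF(1) by auto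
    have small: "v (k \<otimes> x \<oplus> combine ks bs) < 1" using L(4) unfolding kks by simp
    have vk: "v k = 1"
    proof (rule ccontr)
      assume "v k \<noteq> 1"
      then have lt: "v k < 1" using k(2) by simp
      have "v (k \<otimes> x) \<le> v k * 1" unfolding v_mult[OF kc(1) xc] by (rule mult_left_mono[OF x(2) v_nonneg[OF kc(1)]])
      then have "v (k \<otimes> x) < 1" using lt by simp
      then have "v ((k \<otimes> x \<oplus> combine ks bs) \<ominus> k \<otimes> x) < 1" using small kc xc cc by (intro v_minus_less) auto
      moreover have "(k \<otimes> x \<oplus> combine ks bs) \<ominus> k \<otimes> x = combine ks bs" using kc(1) xc cc by algebra
      ultimately have "v (combine ks bs) < 1" by simp
      then have "\<forall>l\<in>set ks. v l < 1" using residually_independentD[OF ri k(3,4,5)] by blast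
      then show False using L(5) lt unfolding kks by auto
    qed
    have k0: "k \<in> Qp - {\<zero>}" using k(1) vk by auto
    define c where "c = \<ominus> (inv k)"
    have ik: "inv k \<in> Qp" "k \<otimes> inv k = \<one>" "inv k \<in> carrier C" using subfield_m_inv[OF subfield_Qp k0] Q(2) by auto
    have c: "c \<in> Qp" "c \<in> carrier C" "v c = 1"
      unfolding c_def using ik subringE(5)[OF Q(1)] v_minus v_inv[OF kc(1)] vk k0 by auto
    define es where "es = map ((\<otimes>) c) ks"
    have es: "set es \<subseteq> Qp" "length es = length bs" "\<And>e. e \<in> set es \<Longrightarrow> v e \<le> 1"
    proof -
      show "set es \<subseteq> Qp" unfolding es_def using k(3) c(1) subringE(6)[OF Q(1)] by auto
      show "length es = length bs" unfolding es_def using k(4) by simp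
      show "v e \<le> 1" if "e \<in> set es" for e
      proof -
        obtain l where l: "l \<in> set ks" "e = c \<otimes> l" using \<open>e \<in> set es\<close> unfolding es_def by auto
        then have "l \<in> carrier C" using kc(2) by auto
        then show ?thesis unfolding l(2) using v_mult[OF c(2)] c(3) k(5)[OF l(1)] by simp
      qed
    qed
    have ces: "combine es bs = c \<otimes> combine ks bs"
      unfolding es_def using combine_r_distr[OF kc(2) bsF(1) c(2)] by simp
    have "x \<ominus> combine es bs = (k \<otimes> inv k) \<otimes> x \<ominus> c \<otimes> combine ks bs" using ik(2) xc ces by simp
    also have "\<dots> = inv k \<otimes> (k \<otimes> x \<oplus> combine ks bs)" unfolding c_def using kc(1) ik(3) xc cc by algebra
    finally have "v (x \<ominus> combine es bs) = v (inv k) * v (k \<otimes> x \<oplus> combine ks bs)"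
      using v_mult[OF ik(3)] kc xc cc by simp
    also have "v (inv k) = 1" using v_inv[OF kc(1)] vk k0 by auto
    finally have xe: "v (x \<ominus> combine es bs) < 1" using small by simp
    have "\<exists>d. i < length bs \<longrightarrow> d < p \<and> v (es ! i \<ominus> \<iota> d) < 1" for i
    proof (cases "i < length bs")
      case True
      then have mem: "es ! i \<in> set es" using es(2) by simp
      obtain d where "d < p" "v (es ! i \<ominus> \<iota> d) < 1"
        by (rule Qp_digit[OF subsetD[OF es(1) mem] es(3)[OF mem]])
      then show ?thesis by blast
    qed simp
    then have "\<exists>\<delta>. \<forall>i. i < length bs \<longrightarrow> \<delta> i < p \<and> v (es ! i \<ominus> \<iota> (\<delta> i)) < 1" by (intro choice allI)
    then obtain \<delta> where \<delta>: "\<And>i. i < length bs \<Longrightarrow> \<delta> i < p \<and> v (es ! i \<ominus> \<iota> (\<delta> i)) < 1" by blast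
    define ds where "ds = map (\<lambda>i. \<iota> (\<delta> i)) [0..<length bs]"
    have ds: "ds \<in> \<Delta>" unfolding ds_def \<Delta>_def using \<delta> by auto
    have dsc: "set ds \<subseteq> carrier C" unfolding ds_def by auto
    have esc: "set es \<subseteq> carrier C" using es(1) Q(2) by auto
    have ed: "v (combine es bs \<ominus> combine ds bs) < 1"
    proof (rule combine_close[OF es(2) _ esc dsc bsF])
      show "length ds = length bs" unfolding ds_def by simp
      show "v (es ! i \<ominus> ds ! i) < 1" if "i < length bs" for i using \<delta>[OF that] that unfolding ds_def by simp
    qed
    have "v (x \<ominus> combine ds bs) < 1"
      by (rule v_trans_less[OF xc _ _ xe ed]) (use esc dsc bsF(1) in auto)
    then show ?thesis unfolding A_def using ds by blast
  qed
  ultimately show ?thesis by (rule that)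
qed

lemma finite_ext_unit_power:
  assumes F: "intermediate F" "dimension N Qp F"
  obtains m where "\<not> p dvd m" "\<And>y. \<lbrakk>y \<in> F; v y = 1\<rbrakk> \<Longrightarrow> v (y [^] m \<ominus> \<one>) < 1"
proof -
  obtain A where A: "finite A" "A \<subseteq> carrier C" "\<And>x. \<lbrakk>x \<in> F; v x \<le> 1\<rbrakk> \<Longrightarrow> \<exists>a\<in>A. v (x \<ominus> a) < 1"
    by (rule finite_ext_residues[OF F]) (rule that)
  define M :: nat where "M = fact (card A)"
  have M0: "0 < M" unfolding M_def by simp
  have pow: "v (y [^] M \<ominus> \<one>) < 1" if y: "y \<in> F" "v y = 1" for y
  proof -
    have yc: "y \<in> carrier C" using y intermediateD(3)[OF F(1)] by auto
    have yF: "y [^] n \<in> F" for n :: nat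
      by (induction n) (use subringE(3,6)[OF intermediateD(2)[OF F(1)]] y(1) in auto)
    have yv: "v (y [^] n) = 1" for n :: nat using v_pow[OF yc] y(2) by simp
    define a where "a n = (SOME a. a \<in> A \<and> v (y [^] n \<ominus> a) < 1)" for n :: nat
    have a: "a n \<in> A \<and> v (y [^] n \<ominus> a n) < 1" for n
      unfolding a_def by (rule someI_ex) (use A(3)[OF yF] yv in auto)
    have "\<not> inj_on a {..card A}"
    proof
      assume "inj_on a {..card A}"
      then have "card (a ` {..card A}) = Suc (card A)" by (simp add: card_image)
      moreover have "card (a ` {..card A}) \<le> card A" using a A(1) by (intro card_mono) auto
      ultimately show False by simp
    qed
    then obtain i j where ij: "i \<le> card A" "j \<le> card A" "a i = a j" "i \<noteq> j"
      unfolding inj_on_def by auto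
    define s where "s = min i j"
    define t where "t = max i j"
    have st: "s < t" "t \<le> card A" "a s = a t"
      unfolding s_def t_def using ij by (auto simp: min_def max_def)
    have ac: "a n \<in> carrier C" for n using a A(2) by auto
    have "v (a s \<ominus> y [^] s) < 1" using a[of s] v_minus_commute[OF ac nat_pow_closed[OF yc]] by simp
    then have lt: "v (y [^] t \<ominus> y [^] s) < 1"
      using v_trans_less[OF nat_pow_closed[OF yc] ac nat_pow_closed[OF yc], of t t 1 s] a[of t] st(3) by simp
    define d where "d = t - s"
    have d: "0 < d" "d \<le> card A" using st unfolding d_def by auto
    have ys: "y [^] s \<in> carrier C" "y [^] d \<in> carrier C" using yc by auto
    have "y [^] t = y [^] s \<otimes> y [^] d" using st(1) yc by (simp add: nat_pow_mult d_def)
    then have "y [^] t \<ominus> y [^] s = y [^] s \<otimes> (y [^] d \<ominus> \<one>)" using ys one_closed by (simp only:) algebra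
    then have lt1: "v (y [^] d \<ominus> \<one>) < 1" using lt v_mult[OF ys(1), of "y [^] d \<ominus> \<one>"] ys yv[of s] by simp
    have "d dvd M" unfolding M_def using d by (intro dvd_fact) auto
    then obtain n where n: "M = d * n" by (rule dvdE)
    obtain s where s: "s \<in> carrier C" "(y [^] d \<ominus> \<one>) \<otimes> s = (y [^] d) [^] n \<ominus> \<one>" "v (s \<ominus> \<iota> n) < 1"
      using geometric_sum_exists[OF ys(2) lt1, of n] by blast
    have "s = (s \<ominus> \<iota> n) \<oplus> \<iota> n" using s(1) nat_carrier[of n] by algebra
    moreover have "v ((s \<ominus> \<iota> n) \<oplus> \<iota> n) \<le> 1" by (rule v_add_le) (use s v_nat_le in auto)
    ultimately have vs: "v s \<le> 1" by simp
    have "v ((y [^] d) [^] n \<ominus> \<one>) = v (y [^] d \<ominus> \<one>) * v s" unfolding s(2)[symmetric] using s(1) ys by (simp add: v_mult)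
    also have "\<dots> \<le> v (y [^] d \<ominus> \<one>) * 1" using vs ys by (intro mult_left_mono v_nonneg) auto
    also have "\<dots> < 1" using lt1 by simp
    finally show ?thesis unfolding n nat_pow_pow[OF yc, symmetric] .
  qed
  obtain m where m: "M = p ^ multiplicity p M * m" "\<not> p dvd m"
    using multiplicity_decompose'[of M p] M0 p_gt_1 by auto
  have "v (y [^] m \<ominus> \<one>) < 1" if y: "y \<in> F" "v y = 1" for y
  proof -
    have yc: "y \<in> carrier C" using y intermediateD(3)[OF F(1)] by auto
    have "y [^] M = (y [^] m) [^] (p ^ multiplicity p M)"
      unfolding nat_pow_pow[OF yc] using m(1) by (simp add: mult.commute)
    then have "v ((y [^] m) [^] (p ^ multiplicity p M) \<ominus> \<one>) < 1" using pow[OF y] by simp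
    then show ?thesis using v_root_one_power[of "y [^] m"] yc y(2) v_pow[OF yc] by simp
  qed
  then show ?thesis using that m(2) by blast
qed

definition value_coset :: "'a set \<Rightarrow> 'a \<Rightarrow> real set"
  where "value_coset K x = {v c * v x |c. c \<in> K - {\<zero>}}"

lemma rcosets_value_group:
  "rcosets\<^bsub>value_group F\<^esub> (carrier (value_group K)) = value_coset K ` (F - {\<zero>})"
  unfolding RCOSETS_def r_coset_def value_group_def value_coset_def by auto

lemma value_coset_eq_iff:
  assumes K: "subfield K C" and x: "x \<in> carrier C" and y: "y \<in> carrier C"
  shows "value_coset K x = value_coset K y \<longleftrightarrow> (\<exists>c \<in> K - {\<zero>}. v x = v c * v y)"
proof
  note Kr = subfieldE(1,3)[OF K]
  assume eq: "value_coset K x = value_coset K y"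
  have "\<one> \<in> K - {\<zero>}" using subringE(3)[OF Kr(1)] by simp
  then have "v \<one> * v x \<in> value_coset K x" unfolding value_coset_def by blast
  then have "v x \<in> value_coset K y" unfolding eq by (simp add: v_one)
  then show "\<exists>c \<in> K - {\<zero>}. v x = v c * v y" unfolding value_coset_def by blast
next
  note Kr = subfieldE(1,3)[OF K]
  have sub: "value_coset K x \<subseteq> value_coset K y"
    if c: "c \<in> K - {\<zero>}" "v x = v c * v y" for x y c
  proof
    fix r assume "r \<in> value_coset K x"
    then obtain a where a: "a \<in> K - {\<zero>}" "r = v a * v x" unfolding value_coset_def by blast
    have carr: "a \<in> carrier C" "c \<in> carrier C" using a c Kr(2) by auto
    then have "r = v (a \<otimes> c) * v y" using a(2) c(2) by (simp add: v_mult)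
    moreover have "a \<otimes> c \<in> K - {\<zero>}" using a(1) c(1) carr subringE(6)[OF Kr(1)] integral[of a c] by auto
    ultimately show "r \<in> value_coset K y" unfolding value_coset_def by blast
  qed
  assume "\<exists>c \<in> K - {\<zero>}. v x = v c * v y"
  then obtain c where c: "c \<in> K - {\<zero>}" "v x = v c * v y" by blast
  then have cc: "c \<in> carrier C" "c \<noteq> \<zero>" using Kr(2) by auto
  have "v y = v (inv c) * v x" using c(2) v_inv[OF cc] v_pos[OF cc] by simp
  then have "value_coset K y \<subseteq> value_coset K x" by (rule sub[OF subfield_m_inv(1)[OF K c(1)]])
  then show "value_coset K x = value_coset K y" using sub[OF c] by blast
qed

lemma distinct_cosets_independent:
  assumes K: "subfield K C"
    and "set bs \<subseteq> carrier C - {\<zero>}" "distinct bs" "inj_on (value_coset K) (set bs)"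
  shows "independent K bs \<and>
    (\<forall>x \<in> Span K bs. x \<noteq> \<zero> \<longrightarrow> (\<exists>b \<in> set bs. \<exists>c \<in> K - {\<zero>}. v x = v c * v b))"
  using assms(2-)
proof (induction bs)
  case Nil
  show ?case by simp
next
  case (Cons b bs)
  note Kr = subfieldE(1,3)[OF K]
  have b: "b \<in> carrier C" "b \<noteq> \<zero>" "set bs \<subseteq> carrier C" "b \<notin> set bs" using Cons.prems by auto
  have inj: "inj_on (value_coset K) (set bs)" using Cons.prems(3) by (auto intro: inj_on_subset)
  have IH: "independent K bs"
    "\<And>x. \<lbrakk>x \<in> Span K bs; x \<noteq> \<zero>\<rbrakk> \<Longrightarrow> \<exists>b \<in> set bs. \<exists>c \<in> K - {\<zero>}. v x = v c * v b"
    using Cons.IH Cons.prems inj by auto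
  have apart: "v (k \<otimes> b) \<noteq> v x" if k: "k \<in> K - {\<zero>}" and x: "x \<in> Span K bs" "x \<noteq> \<zero>" for k x
  proof
    assume eq: "v (k \<otimes> b) = v x"
    obtain b' c where c: "b' \<in> set bs" "c \<in> K - {\<zero>}" "v x = v c * v b'" using IH(2)[OF x] by blast
    have carr: "k \<in> carrier C" "c \<in> carrier C" "b' \<in> carrier C" using k c Kr(2) b(3) by auto
    have ik: "inv k \<in> K - {\<zero>}" "inv k \<in> carrier C" using subfield_m_inv(1)[OF K k] Kr(2) by auto
    have "v k * v b = v c * v b'" using eq c(3) v_mult[OF carr(1) b(1)] by simp
    moreover have "0 < v k" using v_pos[OF carr(1)] k by auto
    ultimately have "v b = inverse (v k) * v c * v b'" by (simp add: field_simps)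
    also have "\<dots> = v (inv k \<otimes> c) * v b'" using v_inv[OF carr(1)] k v_mult[OF ik(2) carr(2)] by auto
    finally have "v b = v (inv k \<otimes> c) * v b'" .
    moreover have "inv k \<otimes> c \<in> K - {\<zero>}" using ik c(2) carr(2) subringE(6)[OF Kr(1)] integral[of "inv k" c] by auto
    ultimately have "value_coset K b = value_coset K b'" using value_coset_eq_iff[OF K b(1) carr(3)] by blast
    then have "b = b'" using Cons.prems(3) c(1) by (auto dest: inj_onD)
    then show False using b(4) c(1) by blast
  qed
  have "b \<notin> Span K bs"
  proof
    assume "b \<in> Span K bs"
    moreover have "\<one> \<in> K - {\<zero>}" using subringE(3)[OF Kr(1)] by simp
    ultimately have "v (\<one> \<otimes> b) \<noteq> v b" using apart b(2) by blast
    then show False using b(1) by simp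
  qed
  then have ind: "independent K (b # bs)" by (rule li_Cons[OF b(1) _ IH(1)])
  moreover have "\<exists>b' \<in> set (b # bs). \<exists>c \<in> K - {\<zero>}. v x = v c * v b'" if x: "x \<in> Span K (b # bs)" "x \<noteq> \<zero>" for x
  proof -
    obtain k w where kw: "k \<in> K" "w \<in> Span K bs" "x = k \<otimes> b \<oplus> w"
      using x(1) unfolding Span.simps foldr.simps comp_def line_extension_mem_iff by blast
    have carr: "k \<in> carrier C" "w \<in> carrier C" using kw Kr(2) Span_subgroup_props(1)[OF K b(3)] by auto
    show ?thesis
    proof (cases "k = \<zero>")
      case True
      then have "x = w" using kw(3) carr b(1) by simp
      then show ?thesis using IH(2)[OF kw(2)] x(2) by auto
    next
      case False
      then have k: "k \<in> K - {\<zero>}" using kw(1) by simp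
      have vkb: "v (k \<otimes> b) = v k * v b" by (rule v_mult[OF carr(1) b(1)])
      show ?thesis
      proof (cases "w = \<zero>")
        case True
        then have "v x = v k * v b" using kw(3) vkb carr b(1) by simp
        then show ?thesis using k by auto
      next
        case False
        have "v x = max (v (k \<otimes> b)) (v w)"
          unfolding kw(3) using apart[OF k kw(2) False] carr b(1) by (intro v_add_eq_max) auto
        then have "v x = v k * v b \<or> v x = v w" unfolding vkb by (simp add: max_def split: if_splits)
        then show ?thesis
        proof
          assume "v x = v k * v b"
          then show ?thesis using k by auto
        next
          assume "v x = v w"
          then show ?thesis using IH(2)[OF kw(2) False] by auto
        qed
      qed
    qed
  qed
  ultimately show ?case by blast
qed

lemma ramification_index_properties:
  assumes K: "intermediate K" and F: "intermediate F" "K \<subseteq> F" and N: "dimension N K F"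
  shows "ramification_index K F \<le> N" "0 < ramification_index K F"
    "\<exists>bs. set bs \<subseteq> F - {\<zero>} \<and> length bs = ramification_index K F \<and>
      (\<forall>x \<in> F - {\<zero>}. \<exists>b \<in> set bs. \<exists>c \<in> K - {\<zero>}. v x = v c * v b)"
proof -
  note Ks = intermediateD(1)[OF K] and Fc = intermediateD(3)[OF F(1)]
  define R where "R = value_coset K ` (F - {\<zero>})"
  have idx: "ramification_index K F = card R"
    unfolding ramification_index_def rcosets_value_group R_def ..
  have bound: "card S \<le> N" if "S \<subseteq> R" and fin: "finite S" for S
  proof -
    obtain J where J: "J \<subseteq> F - {\<zero>}" "inj_on (value_coset K) J" "S = value_coset K ` J"
      using iffD1[OF subset_image_inj, OF \<open>S \<subseteq> R\<close>[unfolded R_def]] by blast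
    have "finite J" using finite_image_iff[OF J(2)] fin J(3) by simp
    then obtain bs where bs: "set bs = J" "distinct bs" using finite_distinct_list by blast
    have "set bs \<subseteq> carrier C - {\<zero>}" using J(1) Fc bs(1) by auto
    then have "independent K bs" using distinct_cosets_independent[OF Ks _ bs(2)] J(2) bs(1) by blast
    moreover have "set bs \<subseteq> F" using J(1) bs(1) by auto
    ultimately have "length bs \<le> N" by (rule independent_length_le_dimension[OF Ks N])
    then show ?thesis using J(3) bs(1) card_image[OF J(2)] distinct_card[OF bs(2)] by simp
  qed
  have finR: "finite R"
  proof (rule ccontr)
    assume "infinite R"
    then obtain S where S: "S \<subseteq> R" "finite S" "card S = Suc N"
      using infinite_arbitrarily_large[of R "Suc N"] by blast
    show False using bound[OF S(1,2)] S(3) by simp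
  qed
  show "ramification_index K F \<le> N" unfolding idx by (rule bound[OF subset_refl finR])
  have "\<one> \<in> F - {\<zero>}" using subringE(3)[OF intermediateD(2)[OF F(1)]] by simp
  then have "R \<noteq> {}" unfolding R_def by blast
  then show "0 < ramification_index K F" unfolding idx using finR by (simp add: card_gt_0_iff)
  obtain J where J: "J \<subseteq> F - {\<zero>}" "inj_on (value_coset K) J" "R = value_coset K ` J"
    using iffD1[OF subset_image_inj, of R "value_coset K" "F - {\<zero>}"] unfolding R_def by blast
  have "finite J" using finite_image_iff[OF J(2)] finR J(3) by simp
  then obtain bs where bs: "set bs = J" "distinct bs" using finite_distinct_list by blast
  have "length bs = card R" using J(3) bs(1) card_image[OF J(2)] distinct_card[OF bs(2)] by simp
  moreover have "\<exists>b \<in> set bs. \<exists>c \<in> K - {\<zero>}. v x = v c * v b" if x: "x \<in> F - {\<zero>}" for x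
  proof -
    have "value_coset K x \<in> value_coset K ` J" using x J(3) unfolding R_def by blast
    then obtain b where b: "b \<in> J" "value_coset K x = value_coset K b" by blast
    have "x \<in> carrier C" "b \<in> carrier C" using x b(1) J(1) Fc by auto
    then show ?thesis using b value_coset_eq_iff[OF Ks] bs(1) by blast
  qed
  ultimately show "\<exists>bs. set bs \<subseteq> F - {\<zero>} \<and> length bs = ramification_index K F \<and>
      (\<forall>x \<in> F - {\<zero>}. \<exists>b \<in> set bs. \<exists>c \<in> K - {\<zero>}. v x = v c * v b)"
    unfolding idx using bs(1) J(1) by blast
qed

text \<open>A point of the span at minimal distance from \<open>x\<close> exists because \<open>v\<close> is discrete on \<open>F\<close>; a nonzero
  error could be diminished further, since \<open>K\<close> contains representatives of all residues of \<open>F\<close>.\<close>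

lemma Span_eq_of_residues_and_values:
  assumes K: "intermediate K" and F: "intermediate F" "K \<subseteq> F" "dimension N Qp F"
    and bs: "set bs \<subseteq> F - {\<zero>}"
    and val: "\<And>x. x \<in> F - {\<zero>} \<Longrightarrow> \<exists>b \<in> set bs. \<exists>c \<in> K - {\<zero>}. v x = v c * v b"
    and res: "\<And>y. \<lbrakk>y \<in> F; v y = 1\<rbrakk> \<Longrightarrow> \<exists>\<eta> \<in> K. v (y \<ominus> \<eta>) < 1"
  shows "Span K bs = F"
proof
  note Ks = intermediateD(1)[OF K] and Kc = intermediateD(3)[OF K]
  note Fc = intermediateD(3)[OF F(1)] and Fr = intermediateD(2)[OF F(1)]
  have bsc: "set bs \<subseteq> carrier C" using bs Fc by auto
  note SP = Span_subgroup_props[OF Ks bsc] Span_smult_closed[OF Ks bsc]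
  have Fsub: "subgroup F (add_monoid C)" using subring.axioms(1)[OF Fr] .
  show sub: "Span K bs \<subseteq> F"
  proof (rule Span_min[OF Ks bsc Fsub])
    show "K <#> set bs \<subseteq> F"
      unfolding set_mult_def using F(2) bs subringE(6)[OF Fr] by auto
  qed
  have "subalgebra Qp (Span K bs) C"
  proof (intro subalgebra.intro subalgebra_axioms.intro)
    show "subgroup (Span K bs) (add_monoid C)" by (rule Span_is_add_subgroup[OF Ks bsc])
    show "k \<otimes> w \<in> Span K bs" if "k \<in> Qp" "w \<in> Span K bs" for k w
      using SP(5) that intermediateD(4)[OF K] by blast
  qed
  then have "finite_dimension Qp (Span K bs)"
    using subalbegra_incl_imp_finite_dimension[OF subfield_Qp finite_dimensionI[OF F(3)] _ sub] by blast
  then obtain n where "dimension n Qp (Span K bs)" unfolding finite_dimension_def by blast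
  then obtain Us where Us: "set Us \<subseteq> carrier C" "Span Qp Us = Span K bs"
    using exists_base[OF subfield_Qp] by metis
  have closed: "seq_closed (Span K bs)"
    using seq_closed_Span[OF subfield_Qp seq_closed_Qp Us(1)] unfolding Us(2) .
  show "F \<subseteq> Span K bs"
  proof (rule subsetI, rule ccontr)
    fix x assume xF: "x \<in> F" and x: "x \<notin> Span K bs"
    have xc: "x \<in> carrier C" using xF Fc by auto
    obtain d where d: "0 < d" "\<And>w. w \<in> Span K bs \<Longrightarrow> d \<le> v (x \<ominus> w)"
      by (rule seq_closed_dist[OF closed xc x]) (rule that)
    define q where "q = real p"
    have q: "1 < q" unfolding q_def using p_gt_1 by simp
    have powi_less: "a < b" if "q powi a < q powi b" for a b :: int
      using power_int_increasing[of b a q] q that by (meson linorder_not_less less_imp_le)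
    define M :: nat where "M = fact N"
    have M: "0 < M" unfolding M_def by simp
    have ex_k: "\<exists>k::int. v (x \<ominus> w) ^ M = q powi k" if w: "w \<in> Span K bs" for w
    proof -
      have "w \<in> F" using w sub by auto
      then have "x \<ominus> w \<in> F" using xF subringE(5,7)[OF Fr] by (simp add: minus_eq)
      moreover have "x \<ominus> w \<noteq> \<zero>" using d(1) d(2)[OF w] by auto
      ultimately obtain k :: int where "v (x \<ominus> w) ^ fact N = real p powi k" by (rule finite_ext_discrete[OF F(1,3)])
      then show ?thesis unfolding M_def q_def by blast
    qed
    define \<kappa> where "\<kappa> w = (SOME k::int. v (x \<ominus> w) ^ M = q powi k)" for w
    have \<kappa>: "v (x \<ominus> w) ^ M = q powi (\<kappa> w)" if "w \<in> Span K bs" for w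
      unfolding \<kappa>_def using ex_k[OF that] by (rule someI_ex)
    obtain L :: nat where L: "inverse q ^ L < d ^ M"
      using real_arch_pow_inv[of "d ^ M" "inverse q"] d(1) q by (auto simp: field_simps)
    have lower: "- int L \<le> \<kappa> w" if w: "w \<in> Span K bs" for w
    proof -
      have "q powi (- int L) = inverse q ^ L" by (simp add: power_int_minus power_inverse)
      also have "\<dots> < v (x \<ominus> w) ^ M" using L power_mono[OF d(2)[OF w], of M] d(1) by simp
      finally have "q powi (- int L) < q powi (\<kappa> w)" using \<kappa>[OF w] by simp
      then have "- int L < \<kappa> w" by (rule powi_less)
      then show ?thesis by simp
    qed
    have "\<zero> \<in> Span K bs" by (rule SP(2))
    then obtain y where y: "y \<in> Span K bs" "\<And>w. w \<in> Span K bs \<Longrightarrow> nat (\<kappa> y + int L) \<le> nat (\<kappa> w + int L)"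
      using ex_has_least_nat[of "\<lambda>w. w \<in> Span K bs" \<zero> "\<lambda>w. nat (\<kappa> w + int L)"] by blast
    have min: "\<kappa> y \<le> \<kappa> w" if w: "w \<in> Span K bs" for w
      using y(2)[OF w] lower[OF w] lower[OF y(1)] by linarith
    define z where "z = x \<ominus> y"
    have yc: "y \<in> carrier C" using SP(1) y(1) by auto
    have zc: "z \<in> carrier C" unfolding z_def using xc yc by simp
    have z0: "z \<noteq> \<zero>" using d(1) d(2)[OF y(1)] unfolding z_def by auto
    have zF: "z \<in> F" unfolding z_def using xF y(1) sub subringE(5,7)[OF Fr] by (auto simp: minus_eq)
    obtain b c where bc: "b \<in> set bs" "c \<in> K - {\<zero>}" "v z = v c * v b" using val[of z] zF z0 by blast
    have carr: "b \<in> carrier C" "c \<in> carrier C" using bc bsc Kc by auto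
    define u where "u = c \<otimes> b"
    have u: "u \<in> carrier C" "u \<noteq> \<zero>" "u \<in> F" "v u = v z"
      unfolding u_def using carr bc bs integral[of c b] subringE(6)[OF Fr] F(2) by (auto simp: v_mult)
    have iu: "inv u \<in> F" "inv u \<in> carrier C" "u \<otimes> inv u = \<one>"
      using subfield_m_inv[OF intermediateD(1)[OF F(1)], of u] u Fc by auto
    have "v (z \<otimes> inv u) = 1"
      using v_mult[OF zc iu(2)] v_inv[OF u(1,2)] u(4) v_pos[OF zc z0] by simp
    moreover have "z \<otimes> inv u \<in> F" using zF iu(1) subringE(6)[OF Fr] by blast
    ultimately obtain \<eta> where \<eta>: "\<eta> \<in> K" "v (z \<otimes> inv u \<ominus> \<eta>) < 1" using res by blast
    have \<eta>c: "\<eta> \<in> carrier C" using \<eta>(1) Kc by auto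
    define y' where "y' = y \<oplus> (\<eta> \<otimes> c) \<otimes> b"
    have b_mem: "b \<in> Span K bs" using Span_base_incl[OF Ks bsc] bc(1) by auto
    have "\<eta> \<otimes> c \<in> K" using \<eta>(1) bc(2) subringE(6)[OF intermediateD(2)[OF K]] by auto
    then have y'_mem: "y' \<in> Span K bs" unfolding y'_def using SP(3)[OF y(1) SP(5)[OF _ b_mem]] by blast
    have "x \<ominus> y' = z \<ominus> \<eta> \<otimes> u" unfolding y'_def z_def u_def using xc yc \<eta>c carr by algebra
    also have "\<dots> = (u \<otimes> inv u) \<otimes> z \<ominus> \<eta> \<otimes> u" using iu(3) zc by simp
    also have "\<dots> = u \<otimes> (z \<otimes> inv u \<ominus> \<eta>)" using u(1) iu(2) zc \<eta>c by algebra
    finally have "v (x \<ominus> y') = v u * v (z \<otimes> inv u \<ominus> \<eta>)" using v_mult[OF u(1)] zc iu(2) \<eta>c by simp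
    also have "\<dots> < v u * 1" by (rule mult_strict_left_mono[OF \<eta>(2) v_pos[OF u(1,2)]])
    finally have lt: "v (x \<ominus> y') < v (x \<ominus> y)" using u(4) unfolding z_def by simp
    have "x \<ominus> y' \<in> carrier C" using xc y'_mem SP(1) by auto
    then have "v (x \<ominus> y') ^ M < v (x \<ominus> y) ^ M" by (rule power_strict_mono[OF lt v_nonneg M])
    then have "q powi (\<kappa> y') < q powi (\<kappa> y)" using \<kappa>[OF y'_mem] \<kappa>[OF y(1)] by simp
    then have "\<kappa> y' < \<kappa> y" by (rule powi_less)
    then show False using min[OF y'_mem] by simp
  qed
qed

section \<open>Points of small degree in a disk\<close>

text \<open>Otherwise the sums against all polynomials in the values \<open>z u\<close> would be small as well, among them
  the sum against the polynomial that singles out one \<open>z\<close>.\<close>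

lemma exists_unit_character_sum:
  assumes Z: "finite Z" "z0 \<in> Z" and m: "\<not> p dvd m"
    and M: "\<one> \<in> M" "\<And>u u'. \<lbrakk>u \<in> M; u' \<in> M\<rbrakk> \<Longrightarrow> u \<otimes> u' \<in> M"
    and z: "\<And>z u. \<lbrakk>z \<in> Z; u \<in> M\<rbrakk> \<Longrightarrow> z u \<in> carrier C \<and> z u [^] m = \<one>"
    and z_mult: "\<And>z u u'. \<lbrakk>z \<in> Z; u \<in> M; u' \<in> M\<rbrakk> \<Longrightarrow> z (u \<otimes> u') = z u \<otimes> z u'"
    and sep: "\<And>z z'. \<lbrakk>z \<in> Z; z' \<in> Z; z \<noteq> z'\<rbrakk> \<Longrightarrow> \<exists>u \<in> M. z u \<noteq> z' u"
  shows "\<exists>u \<in> M. v (\<Oplus>z\<in>Z. z u) = 1"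
proof (rule ccontr)
  assume neg: "\<not> (\<exists>u \<in> M. v (\<Oplus>z\<in>Z. z u) = 1)"
  have m0: "0 < m" using m by (cases m) auto
  have zc: "z u \<in> carrier C" "v (z u) = 1" if "z \<in> Z" "u \<in> M" for z u
    using z[OF that] v_root_of_unity m0 by auto
  have small: "v (\<Oplus>z\<in>Z. z u) < 1" if u: "u \<in> M" for u
  proof -
    have "v (\<Oplus>z\<in>Z. z u) \<le> 1" using zc u Z(1) by (intro v_finsum_le) auto
    moreover have "v (\<Oplus>z\<in>Z. z u) \<noteq> 1" using neg u by blast
    ultimately show ?thesis by linarith
  qed
  obtain a where a: "\<And>z'. z' \<in> Z - {z0} \<Longrightarrow> a z' \<in> M \<and> z0 (a z') \<noteq> z' (a z')"
  proof -
    have "\<exists>u. z' \<in> Z - {z0} \<longrightarrow> u \<in> M \<and> z0 u \<noteq> z' u" for z'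
      using sep[OF Z(2), of z'] by blast
    then have "\<exists>a. \<forall>z'. z' \<in> Z - {z0} \<longrightarrow> a z' \<in> M \<and> z0 (a z') \<noteq> z' (a z')" by (intro choice allI)
    then show ?thesis using that by blast
  qed
  define P where "P S z = (\<Otimes>z'\<in>S. z (a z') \<ominus> z' (a z'))" for S z
  have factor: "z (a z') \<ominus> z' (a z') \<in> carrier C" if "z \<in> Z" "z' \<in> Z - {z0}" for z z'
    using zc(1)[OF that(1), of "a z'"] zc(1)[of z' "a z'"] a[OF that(2)] that(2) by auto
  have Pc: "P S z \<in> carrier C" if "S \<subseteq> Z - {z0}" "z \<in> Z" for S z
    unfolding P_def using factor that by (intro finprod_closed) auto
  have claim: "\<forall>u \<in> M. v (\<Oplus>z\<in>Z. z u \<otimes> P S z) < 1" if "S \<subseteq> Z - {z0}" for S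
  proof -
    have "finite S" using that Z(1) finite_subset by blast
    then show ?thesis using that
    proof (induction S)
      case empty
      have "(\<Oplus>z\<in>Z. z u \<otimes> P {} z) = (\<Oplus>z\<in>Z. z u)" if "u \<in> M" for u
        unfolding P_def using zc(1)[OF _ that] by (intro finsum_cong') auto
      then show ?case using small by simp
    next
      case (insert z1 S)
      have z1: "z1 \<in> Z" "a z1 \<in> M" and S: "S \<subseteq> Z - {z0}" using insert.prems a by auto
      define c where "c = z1 (a z1)"
      have c: "c \<in> carrier C" "v c = 1" unfolding c_def using zc z1 by auto
      show ?case
      proof
        fix u assume u: "u \<in> M"
        have ua: "u \<otimes> a z1 \<in> M" by (rule M(2)[OF u z1(2)])
        define X1 where "X1 = (\<Oplus>z\<in>Z. z (u \<otimes> a z1) \<otimes> P S z)"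
        define X2 where "X2 = (\<Oplus>z\<in>Z. z u \<otimes> P S z)"
        have X: "X1 \<in> carrier C" "X2 \<in> carrier C"
          unfolding X1_def X2_def using zc(1) ua u Pc[OF S] by (auto intro!: finsum_closed)
        have "(\<Oplus>z\<in>Z. z u \<otimes> P (insert z1 S) z) = (\<Oplus>z\<in>Z. z (u \<otimes> a z1) \<otimes> P S z \<oplus> (\<ominus> c) \<otimes> (z u \<otimes> P S z))"
        proof (rule finsum_cong')
          fix z assume zZ: "z \<in> Z"
          have "P (insert z1 S) z = (z (a z1) \<ominus> c) \<otimes> P S z"
            unfolding P_def c_def using insert.hyps factor[OF zZ] insert.prems
            by (intro finprod_insert) auto
          then show "z u \<otimes> P (insert z1 S) z = z (u \<otimes> a z1) \<otimes> P S z \<oplus> (\<ominus> c) \<otimes> (z u \<otimes> P S z)"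
            unfolding z_mult[OF zZ u z1(2)] using zc(1)[OF zZ u] zc(1)[OF zZ z1(2)] Pc[OF S zZ] c(1)
            by (simp only:) algebra
        qed (use zc(1) ua u Pc[OF S] c(1) in auto)
        also have "\<dots> = X1 \<oplus> (\<ominus> c) \<otimes> X2"
          unfolding X1_def X2_def using zc(1) ua u Pc[OF S] c(1) Z(1)
          by (subst finsum_addf) (auto simp: finsum_rdistr)
        finally have eq: "(\<Oplus>z\<in>Z. z u \<otimes> P (insert z1 S) z) = X1 \<oplus> (\<ominus> c) \<otimes> X2" .
        have "v X1 < 1" "v X2 < 1" unfolding X1_def X2_def using insert.IH[OF S] ua u by auto
        moreover have "v ((\<ominus> c) \<otimes> X2) = v X2" using v_mult[of "\<ominus> c" X2] v_minus[OF c(1)] c X(2) by simp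
        ultimately show "v (\<Oplus>z\<in>Z. z u \<otimes> P (insert z1 S) z) < 1"
          unfolding eq using X c(1) by (intro v_add_less) auto
      qed
    qed
  qed
  let ?S = "Z - {z0}"
  have zero: "P ?S z = \<zero>" if zZ: "z \<in> ?S" for z
  proof -
    have "P ?S z = (\<Otimes>z'\<in>insert z (?S - {z}). z (a z') \<ominus> z' (a z'))"
      unfolding P_def using insert_Diff[OF zZ] by simp
    also have "\<dots> = (z (a z) \<ominus> z (a z)) \<otimes> (\<Otimes>z'\<in>?S - {z}. z (a z') \<ominus> z' (a z'))"
      using Z(1) factor zZ by (intro finprod_insert) auto
    also have "z (a z) \<ominus> z (a z) = \<zero>" using zc(1)[of z "a z"] a[OF zZ] zZ by (simp add: minus_eq r_neg)
    also have "\<zero> \<otimes> (\<Otimes>z'\<in>?S - {z}. z (a z') \<ominus> z' (a z')) = \<zero>"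
      using factor zZ by (intro l_null finprod_closed) auto
    finally show ?thesis .
  qed
  have unit: "v (P ?S z0) = 1"
  proof -
    have "v (z0 (a z') \<ominus> z' (a z')) = 1" if z': "z' \<in> ?S" for z'
    proof -
      have mem: "z' \<in> Z" "a z' \<in> M" "z0 (a z') \<noteq> z' (a z')" using z' a by auto
      note z1 = z[OF Z(2) mem(2)] and z2 = z[OF mem(1,2)]
      have "\<not> v (z0 (a z') \<ominus> z' (a z')) < 1" using roots_of_unity_apart[of "z0 (a z')" m "z' (a z')"] z1 z2 m mem(3) by blast
      moreover have "v (z0 (a z') \<ominus> z' (a z')) \<le> 1"
        using zc[OF Z(2) mem(2)] zc[OF mem(1,2)] by (intro v_minus_le) auto
      ultimately show ?thesis by linarith
    qed
    moreover have "v (P ?S z0) = (\<Prod>z'\<in>?S. v (z0 (a z') \<ominus> z' (a z')))"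
      unfolding P_def using Z factor by (intro v_finprod) auto
    ultimately show ?thesis by simp
  qed
  have terms: "z \<one> \<otimes> P ?S z \<in> carrier C" if "z \<in> Z" for z using zc(1)[OF that M(1)] Pc[OF subset_refl that] by simp
  have "(\<Oplus>z\<in>Z. z \<one> \<otimes> P ?S z) = (\<Oplus>z\<in>insert z0 ?S. z \<one> \<otimes> P ?S z)" using Z(2) by (simp add: insert_absorb)
  also have "\<dots> = z0 \<one> \<otimes> P ?S z0 \<oplus> (\<Oplus>z\<in>?S. z \<one> \<otimes> P ?S z)"
    using Z terms by (intro finsum_insert) auto
  also have "(\<Oplus>z\<in>?S. z \<one> \<otimes> P ?S z) = (\<Oplus>z\<in>?S. \<zero>)"
    using zero zc(1) M(1) by (intro finsum_cong') auto
  also have "z0 \<one> \<otimes> P ?S z0 \<oplus> (\<Oplus>z\<in>?S. \<zero>) = z0 \<one> \<otimes> P ?S z0" using terms[OF Z(2)] by simp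
  finally have "v (\<Oplus>z\<in>Z. z \<one> \<otimes> P ?S z) = 1"
    using v_mult[OF zc(1)[OF Z(2) M(1)] Pc[OF subset_refl Z(2)]] zc(2)[OF Z(2) M(1)] unit by simp
  then show False using claim[OF subset_refl] M(1) by fastforce
qed

lemma is_finite_extensionD:
  assumes "intermediate K" "is_finite_extension K F"
  shows "intermediate F" "K \<subseteq> F" "finite_dimension K F"
  using assms unfolding is_finite_extension_def intermediate_def by auto

lemma is_finite_extension_simple:
  assumes K: "intermediate K" and x: "x \<in> Qp_bar"
  shows "is_finite_extension K (simple_extension K x)"
    and "dimension (degree (Irr K x)) K (simple_extension K x)"
proof -
  have xc: "x \<in> carrier C" using x Qp_bar_carrier by auto
  note S = intermediate_simple_extension[OF K x]
  show dim: "dimension (degree (Irr K x)) K (simple_extension K x)"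
    by (rule dimension_simple_extension[OF intermediateD(1)[OF K] xc algebraic_over_intermediate[OF K x]])
  show "is_finite_extension K (simple_extension K x)"
    unfolding is_finite_extension_def
    using intermediateD[OF K] intermediateD[OF S(1)] S(2) finite_dimensionI[OF dim] by blast
qed

lemma abs_Galois_Irr_root:
  assumes K: "intermediate K" and x: "x \<in> Qp_bar" and g: "g \<in> abs_Galois K"
  shows "eval (Irr K x) (g x) = \<zero>"
proof -
  note Irr = Irr_polyfun[OF K x] and E = abs_Galois_embedding[OF g]
  interpret H: ring_hom_ring "C \<lparr> carrier := Qp_bar \<rparr>" C g by (rule embedding_ring_hom_ring[OF E])
  have s: "set (Irr K x) \<subseteq> K" using Irr(4) polynomial_incl univ_poly_carrier by blast
  then have mp: "map g (Irr K x) = Irr K x" using abs_Galois_fixes[OF g] by (auto intro: map_idI)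
  have sq: "set (Irr K x) \<subseteq> Qp_bar" using s intermediateD(5)[OF K] by auto
  have "g (eval (Irr K x) x) = eval (map g (Irr K x)) (g x)"
    using H.eval_hom'[of x "Irr K x"] x sq eval_consistent[OF subfieldE(1)[OF subfield_Qp_bar]] by simp
  then show ?thesis unfolding mp Irr(2) embedding_zero[OF E] by (rule sym)
qed

lemma orbit_bound:
  assumes K: "intermediate K" and x: "x \<in> Qp_bar" and S: "\<And>y. y \<in> S \<Longrightarrow> \<exists>g \<in> abs_Galois K. y = g x"
  shows "finite S" "card S \<le> degree (Irr K x)"
proof -
  define R where "R = {y \<in> Qp_bar. eval (Irr K x) y = \<zero>}"
  have "polyfun Qp_bar (degree (Irr K x)) \<one> (eval (Irr K x))"
    using polyfun_mono[OF Irr_polyfun(1)[OF K x] intermediateD(5)[OF K]] .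
  then have R: "finite R" "card R \<le> degree (Irr K x)"
    using polyfun_roots[OF subfieldE(1)[OF subfield_Qp_bar] _ one_not_zero] unfolding R_def by blast+
  have "S \<subseteq> R"
  proof
    fix y assume "y \<in> S"
    then obtain g where g: "g \<in> abs_Galois K" "y = g x" using S by blast
    then show "y \<in> R" unfolding R_def using abs_Galois_closed[OF g(1) x] abs_Galois_Irr_root[OF K x g(1)] by blast
  qed
  then show "finite S" "card S \<le> degree (Irr K x)"
    using R finite_subset card_mono[OF R(1)] by (blast, meson le_trans)
qed

lemma intermediate_fixed_field:
  assumes E: "intermediate E" and F: "intermediate F" "E \<subseteq> F" and G: "G \<subseteq> abs_Galois E"
  shows "intermediate {x \<in> F. \<forall>g \<in> G. g x = x}" "E \<subseteq> {x \<in> F. \<forall>g \<in> G. g x = x}"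
proof -
  define L where "L = {x \<in> F. \<forall>g \<in> G. g x = x}"
  note Fr = intermediateD(2)[OF F(1)]
  have emb: "embedding Qp_bar g" if "g \<in> G" for g using that G abs_Galois_embedding by blast
  have LQ: "L \<subseteq> Qp_bar" unfolding L_def using intermediateD(5)[OF F(1)] by auto
  have EL: "E \<subseteq> L" unfolding L_def using F(2) G abs_Galois_fixes by blast
  have "subring L C"
  proof (rule subringI)
    show "L \<subseteq> carrier C" using LQ Qp_bar_carrier by auto
    show "\<one> \<in> L" using EL subringE(3)[OF intermediateD(2)[OF E]] by auto
    fix x assume x: "x \<in> L"
    then have xF: "x \<in> F" "x \<in> Qp_bar" "\<And>g. g \<in> G \<Longrightarrow> g x = x" using LQ unfolding L_def by auto
    have "g (\<ominus> x) = \<ominus> x" if "g \<in> G" for g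
      using embedding_minus[OF emb[OF that] xF(2)] xF(3)[OF that] by simp
    then show "\<ominus> x \<in> L" using subringE(5)[OF Fr xF(1)] unfolding L_def by blast
    fix y assume y: "y \<in> L"
    then have yF: "y \<in> F" "y \<in> Qp_bar" "\<And>g. g \<in> G \<Longrightarrow> g y = y" using LQ unfolding L_def by auto
    have "g (x \<otimes> y) = x \<otimes> y" "g (x \<oplus> y) = x \<oplus> y" if "g \<in> G" for g
      using embeddingD(1,2)[OF emb[OF that] xF(2) yF(2)] xF(3)[OF that] yF(3)[OF that] by simp_all
    then show "x \<otimes> y \<in> L" "x \<oplus> y \<in> L" using subringE(6,7)[OF Fr xF(1) yF(1)] unfolding L_def by blast+
  qed
  then have "intermediate L" by (rule intermediate_subring[OF E _ EL LQ])
  then show "intermediate {x \<in> F. \<forall>g \<in> G. g x = x}" "E \<subseteq> {x \<in> F. \<forall>g \<in> G. g x = x}"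
    using EL unfolding L_def by auto
qed

text \<open>The orbit of \<open>\<alpha>\<close> under the automorphisms fixing the roots of unity \<open>M\<close> has at most
  \<open>ramification_index E F\<close> elements, since \<open>F\<close> is totally ramified over the fixed field \<open>L\<close>. Averaging the
  conjugates of the corresponding polynomial over \<open>L\<close> descends it to \<open>E\<close>.\<close>

lemma disk_point_of_degree_le_ramification_index:
  assumes E: "intermediate E" "finite_dimension Qp E" and D: "is_disk D" "is_defined_over E D"
    and F: "is_finite_extension E F" and \<alpha>: "\<alpha> \<in> F" "\<alpha> \<in> D"
  obtains \<beta> where "\<beta> \<in> D" "\<beta> \<in> Qp_bar" "degree (Irr E \<beta>) \<le> ramification_index E F"
proof -
  note F' = is_finite_extensionD[OF E(1) F]
  have \<alpha>Q: "\<alpha> \<in> Qp_bar" using \<alpha>(1) intermediateD(5)[OF F'(1)] by auto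
  have EQ: "E \<subseteq> Qp_bar" by (rule intermediateD(5)[OF E(1)])
  obtain NE where NE: "dimension NE E F" using F'(3) unfolding finite_dimension_def by blast
  have "finite_dimension Qp F"
    by (rule telescopic_base_dim(1)[OF subfield_Qp intermediateD(1)[OF E(1)] E(2) F'(3)])
  then obtain N where N: "dimension N Qp F" unfolding finite_dimension_def by blast
  obtain m where m: "\<not> p dvd m" "\<And>y. \<lbrakk>y \<in> F; v y = 1\<rbrakk> \<Longrightarrow> v (y [^] m \<ominus> \<one>) < 1"
    by (rule finite_ext_unit_power[OF F'(1) N]) (rule that)
  have m0: "0 < m" using m(1) by (cases m) auto
  define \<mu> where "\<mu> = {x \<in> Qp_bar. x [^] m = \<one>}"
  have fin\<mu>: "finite \<mu>"
  proof -
    have "finite {x \<in> Qp_bar. x [^] m \<oplus> \<ominus> \<one> = \<zero>}"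
      using polyfun_roots[OF subfieldE(1)[OF subfield_Qp_bar] polyfun_roots_of_unity[OF subfieldE(1)[OF subfield_Qp_bar] m0] one_not_zero]
      by blast
    moreover have "\<mu> \<subseteq> {x \<in> Qp_bar. x [^] m \<oplus> \<ominus> \<one> = \<zero>}" unfolding \<mu>_def by (auto simp: r_neg)
    ultimately show ?thesis by (rule rev_finite_subset)
  qed
  define M where "M = {x \<in> F. x [^] m = \<one>}"
  have M\<mu>: "M \<subseteq> \<mu>" unfolding M_def \<mu>_def using intermediateD(5)[OF F'(1)] by auto
  have MQ: "M \<subseteq> Qp_bar" using M\<mu> unfolding \<mu>_def by auto
  have finM: "finite M" using M\<mu> fin\<mu> finite_subset by blast
  have M1: "\<one> \<in> M" unfolding M_def using subringE(3)[OF intermediateD(2)[OF F'(1)]] by simp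
  have Mm: "u \<otimes> u' \<in> M" if "u \<in> M" "u' \<in> M" for u u'
    using that subringE(6)[OF intermediateD(2)[OF F'(1)]] intermediateD(3)[OF F'(1)]
    unfolding M_def by (auto simp: nat_pow_distrib subset_iff)
  define G where "G = abs_Galois E"
  have G\<mu>: "g u \<in> \<mu>" if "g \<in> G" "u \<in> \<mu>" for g u
    using that abs_Galois_pow[of g E u m] abs_Galois_closed[of g E u] embeddingD(3)[OF abs_Galois_embedding[of g E]]
    unfolding \<mu>_def G_def by auto
  define Z where "Z = (\<lambda>g. restrict g M) ` G"
  define T where "T z = {g \<alpha> |g. g \<in> G \<and> restrict g M = z}" for z
  define \<pi> where "\<pi> g z = restrict (\<lambda>u. g (z u)) M" for g z :: "'a \<Rightarrow> 'a"
  have \<pi>r: "\<pi> g (restrict h M) = restrict (g \<circ> h) M" for g h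
    unfolding \<pi>_def by (rule ext) (simp add: restrict_def)
  have "Z \<subseteq> M \<rightarrow>\<^sub>E \<mu>" unfolding Z_def using G\<mu> M\<mu> by auto
  then have finZ: "finite Z" using finite_PiE[OF finM, of "\<lambda>_. \<mu>"] fin\<mu> finite_subset by blast
  define z0 where "z0 = restrict (\<lambda>x. x) M"
  have z0: "z0 \<in> Z" unfolding z0_def Z_def G_def using abs_Galois_id by blast
  have \<pi>Z: "\<pi> g z \<in> Z" if "g \<in> G" "z \<in> Z" for g z
    using that \<pi>r abs_Galois_comp unfolding Z_def G_def by (auto intro!: image_eqI)
  have ZQ: "z u \<in> Qp_bar" if "z \<in> Z" "u \<in> M" for z u
    using that MQ abs_Galois_closed unfolding Z_def G_def by auto
  have Zext: "z \<in> extensional M" if "z \<in> Z" for z using that unfolding Z_def by auto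
  have \<pi>_inv: "\<pi> h (\<pi> g z) = z" if "z \<in> Z" "\<And>x. x \<in> Qp_bar \<Longrightarrow> h (g x) = x" for g h z
  proof (rule extensionalityI[of _ M])
    show "\<pi> h (\<pi> g z) u = z u" if "u \<in> M" for u
      using that \<open>\<And>x. x \<in> Qp_bar \<Longrightarrow> h (g x) = x\<close> ZQ[OF \<open>z \<in> Z\<close> that] unfolding \<pi>_def by simp
  qed (use Zext[OF that(1)] in \<open>auto simp: \<pi>_def\<close>)
  have T_sub: "g ` T z \<subseteq> T (\<pi> g z)" if "g \<in> G" "z \<in> Z" for g z
  proof
    fix y assume "y \<in> g ` T z"
    then obtain h where h: "h \<in> G" "restrict h M = z" "y = g (h \<alpha>)" unfolding T_def by auto
    then have "restrict (g \<circ> h) M = \<pi> g z" "y = (g \<circ> h) \<alpha>" using \<pi>r by auto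
    moreover have "g \<circ> h \<in> G" using that(1) h(1) abs_Galois_comp unfolding G_def by blast
    ultimately show "y \<in> T (\<pi> g z)" unfolding T_def by blast
  qed
  have TQ: "T z \<subseteq> Qp_bar \<inter> D" for z
    unfolding T_def G_def using abs_Galois_closed[OF _ \<alpha>Q] disk_Galois_closed[OF E(1) D(2) _ \<alpha>(2) \<alpha>Q] by blast
  have T_eq: "bij_betw (\<pi> g) Z Z \<and> (\<forall>z \<in> Z. g ` T z = T (\<pi> g z))" if g: "g \<in> G" for g
  proof -
    obtain h where h: "h \<in> abs_Galois E" "\<And>x. x \<in> Qp_bar \<Longrightarrow> g (h x) = x" "\<And>x. x \<in> Qp_bar \<Longrightarrow> h (g x) = x"
      using g unfolding G_def by (rule abs_Galois_inv[OF EQ]) (rule that)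
    have hG: "h \<in> G" using h(1) unfolding G_def .
    have "bij_betw (\<pi> g) Z Z"
    proof (rule bij_betwI[of _ _ _ "\<pi> h"])
      show "\<pi> g \<in> Z \<rightarrow> Z" "\<pi> h \<in> Z \<rightarrow> Z" using \<pi>Z[OF g] \<pi>Z[OF hG] by blast+
      show "\<pi> h (\<pi> g z) = z" if "z \<in> Z" for z by (rule \<pi>_inv[of z h g, OF that h(3)])
      show "\<pi> g (\<pi> h z) = z" if "z \<in> Z" for z by (rule \<pi>_inv[of z g h, OF that h(2)])
    qed
    moreover have "T (\<pi> g z) \<subseteq> g ` T z" if zZ: "z \<in> Z" for z
    proof
      fix y assume y: "y \<in> T (\<pi> g z)"
      have "h y \<in> T (\<pi> h (\<pi> g z))" using T_sub[OF hG \<pi>Z[OF g zZ]] y by blast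
      then have "h y \<in> T z" using \<pi>_inv[of z h g, OF zZ h(3)] by simp
      moreover have "g (h y) = y" using h(2)[of y] y TQ[of "\<pi> g z"] by (simp add: subset_iff)
      ultimately show "y \<in> g ` T z" by (intro image_eqI[of _ g "h y"]) simp_all
    qed
    ultimately show ?thesis using T_sub[OF g] by (intro conjI ballI subset_antisym)
  qed

  define G0 where "G0 = {g \<in> G. restrict g M = z0}"
  define L where "L = {x \<in> F. \<forall>g \<in> G0. g x = x}"
  have L: "intermediate L" "E \<subseteq> L"
    unfolding L_def using intermediate_fixed_field[OF E(1) F'(1,2), of G0] unfolding G0_def G_def by auto
  have M_sub_L: "M \<subseteq> L"
  proof
    fix u assume u: "u \<in> M"
    have "g u = u" if "g \<in> G0" for g
    proof -
      have "restrict g M u = z0 u" using that unfolding G0_def by simp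
      then show ?thesis using u unfolding z0_def by simp
    qed
    then show "u \<in> L" using u unfolding L_def M_def by blast
  qed
  have G0L: "G0 \<subseteq> abs_Galois L" unfolding L_def G0_def G_def abs_Galois_def by auto
  obtain bs where bs: "set bs \<subseteq> F - {\<zero>}" "length bs = ramification_index E F"
    "\<And>x. x \<in> F - {\<zero>} \<Longrightarrow> \<exists>b \<in> set bs. \<exists>c \<in> E - {\<zero>}. v x = v c * v b"
    using ramification_index_properties(3)[OF E(1) F'(1,2) NE] by blast
  have "Span L bs = F"
  proof (rule Span_eq_of_residues_and_values[OF L(1) F'(1) _ N bs(1)])
    show "L \<subseteq> F" unfolding L_def by auto
    show "\<exists>b \<in> set bs. \<exists>c \<in> L - {\<zero>}. v x = v c * v b" if "x \<in> F - {\<zero>}" for x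
      using bs(3)[OF that] L(2) by blast
    show "\<exists>\<eta> \<in> L. v (y \<ominus> \<eta>) < 1" if y: "y \<in> F" "v y = 1" for y
    proof -
      obtain \<eta> where \<eta>: "\<eta> \<in> F" "\<eta> [^] m = \<one>" "v (y \<ominus> \<eta>) < 1"
        by (rule Teichmuller[OF F'(1) y m(1) m(2)[OF y]]) (rule that)
      then have "\<eta> \<in> L" using M_sub_L unfolding M_def by blast
      then show ?thesis using \<eta>(3) by blast
    qed
  qed
  moreover have "set bs \<subseteq> carrier C" using bs(1) intermediateD(3)[OF F'(1)] by auto
  ultimately obtain n where n: "n \<le> length bs" "dimension n L F"
    using Span_dimension_le[OF intermediateD(1)[OF L(1)]] by metis
  have T0: "\<exists>g \<in> abs_Galois L. y = g \<alpha>" if "y \<in> T z0" for y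
    using that G0L unfolding T_def G0_def by blast
  have finT0: "finite (T z0)" by (rule orbit_bound(1)[OF L(1) \<alpha>Q T0])
  define n' where "n' = card (T z0)"
  have "n' \<le> degree (Irr L \<alpha>)" unfolding n'_def by (rule orbit_bound(2)[OF L(1) \<alpha>Q T0])
  also have "\<dots> \<le> n" by (rule degree_Irr_le_dimension[OF L(1) F'(1) n(2) \<alpha>(1)])
  finally have n'_le: "n' \<le> ramification_index E F" using n(1) bs(2) by simp
  have "(\<lambda>x. x) \<in> G" unfolding G_def by (rule abs_Galois_id)
  then have "\<alpha> \<in> T z0" unfolding T_def z0_def by (intro CollectI exI[of _ "\<lambda>x. x"]) auto
  then have n'0: "0 < n'" unfolding n'_def using finT0 by (auto simp: card_gt_0_iff)
  have Tz: "finite (T z) \<and> card (T z) = n' \<and> T z \<subseteq> Qp_bar \<inter> D" if "z \<in> Z" for z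
  proof -
    obtain g where g: "g \<in> G" "z = restrict g M" using \<open>z \<in> Z\<close> unfolding Z_def by blast
    have "\<pi> g z0 = z" unfolding z0_def \<pi>r g(2) by (simp add: comp_def)
    then have img: "T z = g ` T z0" using T_eq[OF g(1)] z0 by auto
    have "inj_on g (T z0)"
      using abs_Galois_inj[of g E] g(1) TQ[of z0] unfolding G_def inj_on_def by blast
    then show ?thesis unfolding img using finT0 TQ[of z] img by (simp add: card_image n'_def)
  qed

  have Zchar: "z u \<in> carrier C \<and> z u [^] m = \<one>" if "z \<in> Z" "u \<in> M" for z u
  proof -
    obtain g where "g \<in> G" "z = restrict g M" using \<open>z \<in> Z\<close> unfolding Z_def by blast
    then have "z u \<in> \<mu>" using G\<mu> M\<mu> \<open>u \<in> M\<close> by auto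
    then show ?thesis unfolding \<mu>_def using Qp_bar_carrier by auto
  qed
  have "\<exists>u \<in> M. v (\<Oplus>z\<in>Z. z u) = 1"
  proof (rule exists_unit_character_sum[of Z z0 m M, OF finZ z0 m(1) M1])
    show "u \<otimes> u' \<in> M" if "u \<in> M" "u' \<in> M" for u u' by (rule Mm[OF that])
    show "z u \<in> carrier C \<and> z u [^] m = \<one>" if "z \<in> Z" "u \<in> M" for z u by (rule Zchar[OF that])
    show "z (u \<otimes> u') = z u \<otimes> z u'" if "z \<in> Z" "u \<in> M" "u' \<in> M" for z u u'
    proof -
      obtain g where g: "g \<in> abs_Galois E" "z = restrict g M" using \<open>z \<in> Z\<close> unfolding Z_def G_def by blast
      show ?thesis
        using embeddingD(2)[OF abs_Galois_embedding[OF g(1)], of u u'] MQ Mm that(2,3) unfolding g(2) by auto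
    qed
    show "\<exists>u \<in> M. z u \<noteq> z' u" if "z \<in> Z" "z' \<in> Z" "z \<noteq> z'" for z z'
      using extensionalityI[OF Zext[OF that(1)] Zext[OF that(2)]] that(3) by blast
  qed
  then obtain u where u: "u \<in> M" "v (\<Oplus>z\<in>Z. z u) = 1" by blast
  obtain \<beta> where \<beta>: "\<beta> \<in> D" "\<beta> \<in> Qp_bar" "degree (Irr E \<beta>) \<le> n'"
  proof (rule disk_descent[OF E(1) D(1) \<alpha>(2) finZ _ _ u(2) Tz n'0])
    show "Z \<noteq> {}" using z0 by blast
    show "z u \<in> Qp_bar \<and> v (z u) \<le> 1" if "z \<in> Z" for z
      using ZQ[OF that u(1)] Zchar[OF that u(1)] v_root_of_unity[OF _ _ m0, of "z u"] by auto
    show "\<exists>\<pi>. bij_betw \<pi> Z Z \<and> (\<forall>z\<in>Z. g (z u) = \<pi> z u \<and> g ` T z = T (\<pi> z))" if "g \<in> abs_Galois E" for g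
      using T_eq[of g] that u(1) unfolding G_def by (intro exI[of _ "\<pi> g"]) (simp add: \<pi>_def)
  qed (assumption | rule that)+
  show ?thesis using that \<beta> n'_le by fastforce
qed

text \<open>If \<open>q\<close> is the largest power of \<open>p\<close> dividing \<open>e\<close> and \<open>q < e\<close>, the \<open>q\<close>-th divided derivative of the
  minimal polynomial of \<open>\<beta>\<close>, written as a sum over subsets of its roots, has the unit \<open>e choose q\<close> as its
  leading coefficient, hence a root of degree at most \<open>e - q\<close> in the disk.\<close>

lemma minimal_degree_prime_power:
  assumes E: "intermediate E" and D: "is_disk D" "is_defined_over E D"
    and \<beta>: "\<beta> \<in> D" "\<beta> \<in> Qp_bar" "degree (Irr E \<beta>) \<le> e"
    and min: "\<And>\<gamma>. \<lbrakk>\<gamma> \<in> D; \<gamma> \<in> Qp_bar\<rbrakk> \<Longrightarrow> e \<le> degree (Irr E \<gamma>)"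
  shows "\<exists>k. e = p ^ k"
proof -
  define S where "S = {g \<beta> |g. g \<in> abs_Galois E}"
  have orb: "\<exists>g \<in> abs_Galois E. y = g \<beta>" if "y \<in> S" for y using that unfolding S_def by blast
  have finS: "finite S" by (rule orbit_bound(1)[OF E \<beta>(2) orb])
  have "card S \<le> degree (Irr E \<beta>)" by (rule orbit_bound(2)[OF E \<beta>(2) orb])
  then have card_le: "card S \<le> e" using \<beta>(3) by (rule le_trans)
  have \<beta>S: "\<beta> \<in> S" unfolding S_def by (intro CollectI exI[of _ "\<lambda>x. x"] conjI refl abs_Galois_id)
  have S0: "0 < card S" unfolding card_gt_0_iff using finS \<beta>S by blast
  have SQ: "S \<subseteq> Qp_bar \<inter> D"
    unfolding S_def using abs_Galois_closed[OF _ \<beta>(2)] disk_Galois_closed[OF E D(2) _ \<beta>(1,2)] by blast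
  have gS: "g ` S = S" "inj_on g S" if g: "g \<in> abs_Galois E" for g :: "'a \<Rightarrow> 'a"
  proof -
    have inj: "inj_on g S"
      by (rule inj_on_subset[of g Qp_bar]) (use abs_Galois_inj[OF g] SQ in \<open>auto simp: inj_on_def\<close>)
    have "g ` S \<subseteq> S"
    proof
      fix y assume "y \<in> g ` S"
      then obtain h where h: "h \<in> abs_Galois E" "y = (g \<circ> h) \<beta>" unfolding S_def by auto
      show "y \<in> S" unfolding S_def h(2) by (intro CollectI exI[of _ "g \<circ> h"] conjI refl abs_Galois_comp[OF g h(1)])
    qed
    then show "g ` S = S" by (rule endo_inj_surj[OF finS _ inj])
    show "inj_on g S" by (rule inj)
  qed
  have one: "\<one> \<in> Qp_bar \<and> v \<one> \<le> 1" "\<And>g. g \<in> abs_Galois E \<Longrightarrow> g \<one> = \<one>"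
    using subringE(3)[OF subfieldE(1)[OF subfield_Qp_bar]] v_one embeddingD(3)[OF abs_Galois_embedding] by auto
  have descend: "e \<le> n" if n: "0 < n" "n \<le> card S" "\<not> p dvd (card S choose n)" for n
  proof -
    define I where "I = {T. T \<subseteq> S \<and> card T = n}"
    have finI: "finite I" unfolding I_def using finS by (auto intro: finite_subset[of _ "Pow S"])
    have cardI: "card I = card S choose n" unfolding I_def by (rule n_subsets[OF finS])
    then have I0: "I \<noteq> {}" using n(2) by (metis binomial_eq_0_iff card.empty not_le)
    have sum: "(\<Oplus>T\<in>I. \<one>) = \<iota> (card S choose n)"
      using add.finprod_const[of \<one> I] cardI by simp
    obtain \<gamma> where \<gamma>: "\<gamma> \<in> D" "\<gamma> \<in> Qp_bar" "degree (Irr E \<gamma>) \<le> n"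
    proof (rule disk_descent[OF E D(1) \<beta>(1) finI I0, of "\<lambda>_. \<one>" "\<lambda>T. T" n])
      show "v (\<Oplus>T\<in>I. \<one>) = 1" unfolding sum by (rule v_nat_unit[OF n(3)])
      show "finite T \<and> card T = n \<and> T \<subseteq> Qp_bar \<inter> D" if "T \<in> I" for T
        using that finS SQ finite_subset unfolding I_def by blast
      show "\<exists>\<pi>. bij_betw \<pi> I I \<and> (\<forall>T\<in>I. g \<one> = \<one> \<and> g ` T = \<pi> T)" if g: "g \<in> abs_Galois E" for g
      proof (intro exI[of _ "image g"] conjI ballI)
        have inj: "inj_on (image g) I"
          using inj_on_image_Pow[OF gS(2)[OF g]] by (rule inj_on_subset) (auto simp: I_def)
        moreover have "image g ` I \<subseteq> I"
        proof
          fix T' assume "T' \<in> image g ` I"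
          then obtain T where T: "T \<subseteq> S" "card T = n" "T' = g ` T" unfolding I_def by blast
          have "g ` T \<subseteq> g ` S" using T(1) by (rule image_mono)
          moreover have "card (g ` T) = card T" by (rule card_image[OF inj_on_subset[OF gS(2)[OF g] T(1)]])
          ultimately show "T' \<in> I" unfolding I_def using T gS(1)[OF g] by simp
        qed
        ultimately show "bij_betw (image g) I I" using endo_inj_surj[OF finI] unfolding bij_betw_def by blast
      qed (use one(2)[OF g] in auto)
    qed (use one(1) n(1) that in blast)+
    then show ?thesis using min[OF \<gamma>(1,2)] by linarith
  qed
  have "\<not> p dvd 1" using p_gt_1 by simp
  then have "e \<le> card S" using descend[OF S0 le_refl] by simp
  then have cS: "card S = e" using card_le by simp
  then have e0: "e \<noteq> 0" using S0 by simp
  obtain m where m: "e = p ^ multiplicity p e * m" "\<not> p dvd m"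
    using multiplicity_decompose'[of e p] e0 p_gt_1 by auto
  define q where "q = p ^ multiplicity p e"
  have q0: "0 < q" unfolding q_def using p_gt_1 by simp
  have m0: "0 < m" using m(2) by (cases m) auto
  have "m = 1"
  proof (rule ccontr)
    assume "m \<noteq> 1"
    then have "1 < m" using m0 by simp
    then have qe: "q < e" using m(1) q0 unfolding q_def by (metis mult.right_neutral mult_less_cancel1)
    have "multiplicity p (e choose q) = multiplicity p m"
      using const_p_fac[OF m0 prime_p, of "multiplicity p e"] m(1) unfolding q_def by simp
    also have "\<dots> = 0" using m(2) by (rule not_dvd_imp_multiplicity_0)
    finally have "\<not> p dvd (e choose q)"
      using qe prime_p by (subst (asm) multiplicity_eq_zero_iff) auto
    moreover have "e choose q = e choose (e - q)" using qe by (intro binomial_symmetric) simp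
    ultimately have "e \<le> e - q" using descend[of "e - q"] qe unfolding cS by simp
    then show False using q0 qe by simp
  qed
  then show ?thesis using m(1) by auto
qed

theorem totally_ramified_disk_point:
  assumes E: "is_finite_extension Qp E" and D: "is_disk D" "is_defined_over E D"
    and e: "e = (LEAST n. \<exists>F. is_finite_extension E F \<and> ramification_index E F = n \<and> F \<inter> D \<noteq> {})"
  shows "\<exists>s. e = p ^ s \<and> (\<exists>F. is_totally_ramified E F \<and> (dim over E) F = p ^ s \<and> F \<inter> D \<noteq> {})"
proof -
  have int: "intermediate E" and finE: "finite_dimension Qp E"
    using is_finite_extensionD[OF intermediate_Qp E] by auto
  define P where "P n \<longleftrightarrow> (\<exists>F. is_finite_extension E F \<and> ramification_index E F = n \<and> F \<inter> D \<noteq> {})" for n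
  have e: "e = Least P" using e unfolding P_def .
  have simple: "P (ramification_index E (simple_extension E x))" if "x \<in> D" "x \<in> Qp_bar" for x
    unfolding P_def using is_finite_extension_simple(1)[OF int that(2)] intermediate_simple_extension(3)[OF int that(2)] that(1) by blast
  obtain x where x: "x \<in> D" "x \<in> Qp_bar" using disk_meets_Qp_bar[OF D(1)] by blast
  have "P e" unfolding e using simple[OF x] by (rule LeastI)
  then obtain F \<alpha> where F: "is_finite_extension E F" "ramification_index E F = e" "\<alpha> \<in> F" "\<alpha> \<in> D"
    unfolding P_def by blast
  have min: "e \<le> ramification_index E (simple_extension E \<gamma>)"
    "ramification_index E (simple_extension E \<gamma>) \<le> degree (Irr E \<gamma>)" if \<gamma>: "\<gamma> \<in> D" "\<gamma> \<in> Qp_bar" for \<gamma>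
  proof -
    show "e \<le> ramification_index E (simple_extension E \<gamma>)" unfolding e using simple[OF \<gamma>] by (rule Least_le)
    show "ramification_index E (simple_extension E \<gamma>) \<le> degree (Irr E \<gamma>)"
      by (rule ramification_index_properties(1)[OF int intermediate_simple_extension(1,2)[OF int \<gamma>(2)] is_finite_extension_simple(2)[OF int \<gamma>(2)]])
  qed
  obtain \<beta> where \<beta>: "\<beta> \<in> D" "\<beta> \<in> Qp_bar" "degree (Irr E \<beta>) \<le> ramification_index E F"
    by (rule disk_point_of_degree_le_ramification_index[OF int finE D F(1,3,4)]) (rule that)
  then have le: "degree (Irr E \<beta>) \<le> e" using F(2) by simp
  have "\<exists>s. e = p ^ s"
    by (rule minimal_degree_prime_power[OF int D \<beta>(1,2) le]) (use min order_trans in blast)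
  then obtain s where s: "e = p ^ s" by blast
  let ?F = "simple_extension E \<beta>"
  have deg: "degree (Irr E \<beta>) = e" "ramification_index E ?F = e" using min[OF \<beta>(1,2)] le by auto
  have dim: "(dim over E) ?F = e"
    using dimI[OF intermediateD(1)[OF int] is_finite_extension_simple(2)[OF int \<beta>(2)]] deg(1) by simp
  have "is_totally_ramified E ?F"
    unfolding is_totally_ramified_def using is_finite_extension_simple(1)[OF int \<beta>(2)] deg(2) dim by simp
  moreover have "?F \<inter> D \<noteq> {}" using intermediate_simple_extension(3)[OF int \<beta>(2)] \<beta>(1) by blast
  ultimately show ?thesis using s dim by blast
qed

end

theorem theorem1p2:
  fixes C :: "('a, 'b) ring_scheme" (structure)
    and v :: "'a \<Rightarrow> real"
    and E D :: "'a set"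
    and e :: nat
  assumes "padic_complex_field C v 2"
    and "valued_field.is_finite_extension C v (valued_field.Qp C v) E"
    and "valued_field.is_disk C v D"
    and "valued_field.is_defined_over C v E D"
    and "e = (LEAST n. \<exists>F. valued_field.is_finite_extension C v E F \<and>
                valued_field.ramification_index C v E F = n \<and> F \<inter> D \<noteq> {})"
  shows "\<exists>s::nat. e = 2 ^ s \<and>
           (\<exists>F. valued_field.is_totally_ramified C v E F \<and>
                (ring.dim C over E) F = 2 ^ s \<and> F \<inter> D \<noteq> {})"
proof -
  interpret padic_complex_field C v 2 by (rule assms(1))
  show ?thesis by (rule totally_ramified_disk_point[OF assms(2-5)])
qed

end
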